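(* Let $\beta>-1$ and let $d$ be a random variable with values in $\mathbb{N}=\{1,2,\dots\}$. Put $m_j=\sum_{i=j}^{\infty}\mathbb{P}(d=i)\binom{i}{j}$ for $j\in\mathbb{N}$, and suppose that there is a constant $C>0$ such that $m_j<C^j$ for all $j\in\mathbb{N}$. Let $M(n)$ be the maximal vertex degree of $P_n$ in the max-choice Mori preferential attachment tree model $(P_n)$ with parameters $\beta$ and $d$. (i) If $\mathbb{E}d<2+\beta$, then for every $\epsilon>0$ $$\lim_{n\to\infty}\mathbb{P}\left(n^{\mathbb{E}d/(2+\beta)-\epsilon}<M(n)<n^{\mathbb{E}d/(2+\beta)+\epsilon}\right)=1.$$ (ii) If $\mathbb{E}d>2+\beta$, then $$\frac{M(n)}{n}\to x^{\ast}\quad\text{almost surely as } n\to\infty,$$ where $x^{\ast}$ is the unique positive solution, in the interval $0\le x\le 1$, of the equation $$\sum_{i=1}^{\infty}\mathbb{P}(d=i)\left(1-\left(1-\frac{x}{2+\beta}\right)^i\right)=x.$$ (iii) If $\mathbb{E}d=2+\beta$, then $$\frac{M(n)\ln n}{n}\to\frac{(2+\beta)^2}{m_2}\quad\text{almost surely as } n\to\infty.$$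
   Context: Max-choice Mori preferential attachment tree model with parameters $\beta>-1$ and $d$ (an $\mathbb{N}$-valued random variable): let $d_1,d_2,\dots$ be i.i.d. copies of $d$ and let $v_1,v_2,\dots$ be a fixed sequence of distinct vertices. $P_0$ is the single vertex $v_1$ with no edges; $P_1$ is the tree with vertices $v_1,v_2$ and one edge between them. For $n\ge 1$, given $P_n$ (a tree on $v_1,\dots,v_{n+1}$ with $n$ edges), let $\deg v_i(n)$ be the degree of $v_i$ in $P_n$ and $\mathcal{F}_n=\sigma\{E(P_1),\dots,E(P_n)\}$. The variable $d_n$ is independent of $\mathcal{F}_n$. Given $\mathcal{F}_n$ and $d_n$, sample vertices $X_n^1,\dots,X_n^{d_n}$ i.i.d. from $\{v_1,\dots,v_{n+1}\}$ with $$\mathbb{P}(X_n^1=v_i\mid\mathcal{F}_n)=\frac{\deg v_i(n)+\beta}{(2+\beta)n+\beta}.$$ Let $Y_n$ be whichever of $X_n^1,\dots,X_n^{d_n}$ has the largest degree in $P_n$, ties being broken by an independent fair random choice among the sampled vertices of largest degree. Then $P_{n+1}$ is obtained from $P_n$ by adding the vertex $v_{n+2}$ and the edge $\{v_{n+2},Y_n\}$. Let $M(n)=\max_i\deg v_i(n)$. *)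

theory Defs
  imports "HOL-Probability.Probability"
begin

text \<open>
  The vertex \<open>v\<^sub>i\<close> is the natural number \<open>i \<ge> 1\<close>, and a tree is given by its set of edges, an edge
  being a two-element set of vertices.
\<close>

text \<open>
  \<open>tree_edges y n\<close> is the edge set of \<open>P\<^sub>n\<close> when \<open>y k\<close> is the vertex to which \<open>v\<^bsub>k+2\<^esub>\<close> is attached
  in the step from \<open>P\<^sub>k\<close> to \<open>P\<^bsub>k+1\<^esub>\<close>, for \<open>k \<ge> 1\<close>.
\<close>

fun tree_edges :: "(nat \<Rightarrow> nat) \<Rightarrow> nat \<Rightarrow> nat set set" where
  "tree_edges y 0 = {}"
| "tree_edges y (Suc 0) = {{1, 2}}"
| "tree_edges y (Suc (Suc n)) = insert {n + 3, y (Suc n)} (tree_edges y (Suc n))"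

definition vdegree :: "nat set set \<Rightarrow> nat \<Rightarrow> nat" where
  "vdegree E v = card {e \<in> E. v \<in> e}"

definition max_degree :: "(nat \<Rightarrow> nat) \<Rightarrow> nat \<Rightarrow> nat" where
  "max_degree y n = Max ((\<lambda>i. vdegree (tree_edges y n) i) ` {1..n + 1})"

definition mori_weight :: "real \<Rightarrow> nat \<Rightarrow> nat set set \<Rightarrow> nat \<Rightarrow> real" where
  "mori_weight \<beta> n E i =
     (if i \<in> {1..n + 1} then (real (vdegree E i) + \<beta>) / ((2 + \<beta>) * real n + \<beta>) else 0)"

text \<open>The sampled vertices of largest degree. Repetitions in the sample are disregarded.\<close>

definition top_sampled :: "nat set set \<Rightarrow> nat list \<Rightarrow> nat set" where
  "top_sampled E xs = {x \<in> set xs. \<forall>x' \<in> set xs. vdegree E x' \<le> vdegree E x}"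

text \<open>
  The \<open>\<sigma>\<close>-algebra generated by \<open>f\<close>. The discrete \<open>\<sigma>\<close>-algebra on the target type is the right
  one because it is used only for functions with countable range.
\<close>

definition sigma_of :: "'a measure \<Rightarrow> ('a \<Rightarrow> 'b) \<Rightarrow> 'a measure" where
  "sigma_of M f = vimage_algebra (space M) f (count_space UNIV)"

text \<open>The tuple \<open>(E(P\<^sub>1), \<dots>, E(P\<^sub>n))\<close>, which generates \<open>\<F>\<^sub>n\<close>.\<close>

definition edge_history :: "(nat \<Rightarrow> nat) \<Rightarrow> nat \<Rightarrow> nat set set list" where
  "edge_history y n = map (tree_edges y) [1..<n + 1]"

text \<open>
  \<open>D\<close> is the distribution of \<open>d\<close>; \<open>X n \<omega>\<close> is the list of the sampled vertices
  \<open>X\<^sub>n\<^sup>1, \<dots>, X\<^sub>n\<^bsup>d\<^sub>n\<^esup>\<close>. Only the indices \<open>n \<ge> 1\<close> of \<open>d\<close>, \<open>X\<close>, \<open>Y\<close> are relevant.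
\<close>

locale max_choice_mori = prob_space M
  for M :: "'a measure" and \<beta> :: real and D :: "nat pmf"
    and d :: "nat \<Rightarrow> 'a \<Rightarrow> nat" and X :: "nat \<Rightarrow> 'a \<Rightarrow> nat list" and Y :: "nat \<Rightarrow> 'a \<Rightarrow> nat" +
  assumes measurable_d: "\<And>n. n \<ge> 1 \<Longrightarrow> d n \<in> M \<rightarrow>\<^sub>M count_space UNIV"
    and measurable_X: "\<And>n. n \<ge> 1 \<Longrightarrow> X n \<in> M \<rightarrow>\<^sub>M count_space UNIV"
    and measurable_Y: "\<And>n. n \<ge> 1 \<Longrightarrow> Y n \<in> M \<rightarrow>\<^sub>M count_space UNIV"
    and distr_d: "\<And>n. n \<ge> 1 \<Longrightarrow> distr M (count_space UNIV) (d n) = measure_pmf D"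
    and indep_d: "indep_vars (\<lambda>_. count_space UNIV) d {1..}"
    and indep_d_history: "\<And>n. n \<ge> 1 \<Longrightarrow>
          indep_set (sets (sigma_of M (d n)))
                    (sets (sigma_of M (\<lambda>\<omega>. edge_history (\<lambda>k. Y k \<omega>) n)))"
    and length_X: "\<And>n \<omega>. n \<ge> 1 \<Longrightarrow> \<omega> \<in> space M \<Longrightarrow> length (X n \<omega>) = d n \<omega>"
    and cond_X: "\<And>n xs. n \<ge> 1 \<Longrightarrow>
          AE \<omega> in M.
            real_cond_exp M (sigma_of M (\<lambda>\<omega>. (edge_history (\<lambda>k. Y k \<omega>) n, d n \<omega>)))
              (indicator {\<omega> \<in> space M. X n \<omega> = xs}) \<omega> =
            (if length xs = d n \<omega>
             then \<Prod>x\<leftarrow>xs. mori_weight \<beta> n (tree_edges (\<lambda>k. Y k \<omega>) n) x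
             else 0)"
    and cond_Y: "\<And>n y. n \<ge> 1 \<Longrightarrow>
          AE \<omega> in M.
            real_cond_exp M (sigma_of M (\<lambda>\<omega>. (edge_history (\<lambda>k. Y k \<omega>) n, d n \<omega>, X n \<omega>)))
              (indicator {\<omega> \<in> space M. Y n \<omega> = y}) \<omega> =
            (let T = top_sampled (tree_edges (\<lambda>k. Y k \<omega>) n) (X n \<omega>)
             in if y \<in> T then 1 / real (card T) else 0)"

text \<open>
  \<open>m\<^sub>j = \<Sum>\<^bsub>i\<ge>j\<^esub> P(d = i) (i choose j)\<close>, with value \<open>\<infinity>\<close> when the series diverges.
\<close>

definition binom_moment :: "nat pmf \<Rightarrow> nat \<Rightarrow> ennreal" where
  "binom_moment D j = (\<Sum>\<^sub>\<infinity>i\<in>{j..}. ennreal (pmf D i * real (i choose j)))"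

end

theory Submission
  imports Defs "HOL-Real_Asymp.Real_Asymp"
begin

text \<open>
  Write \<open>w = 2 + \<beta>\<close>, \<open>\<tau> n = n + \<beta>/w\<close>, and call \<open>deg v + \<beta>\<close> the weight of \<open>v\<close>, so that the weights in \<open>P\<^sub>n\<close>
  sum to \<open>w * \<tau> n\<close>. A vertex of weight \<open>z = u * \<tau> n\<close> is sampled with conditional probability \<open>u * r u\<close>,
  where \<open>r u = E (\<Sum>j<d. (1 - u/w)^j) / w\<close> is decreasing with \<open>r 0 = E d / w\<close>. This bounds from above the
  probability that the vertex is chosen and, for a vertex of maximal degree, bounds from below the
  probability that the maximal degree grows; no other information on the choice is used. Ignoring noise, the
  relative weight therefore obeys \<open>\<tau> * u' = - u * (1 - r u)\<close>, which gives the three regimes.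

  The noise is controlled by potentials that are nonnegative supermartingales up to summable errors, and
  hence almost surely bounded. From above, one sums over all vertices the squared excess of \<open>u\<close> over a
  slowly moving threshold; since the values of \<open>u\<close> sum to \<open>w\<close>, the total error per step is \<open>O(1/n\<^sup>2)\<close>,
  and no union bound over vertices is needed. From below, one uses the squared excess of \<open>u powr -s\<close>, for the
  heaviest vertex and a small \<open>s > 0\<close>; its error is controlled by a polynomial decay of the expected inverse
  maximal weight. In the subcritical regime high moments of the weights replace the squared excess above.
\<close>


subsection \<open>Degrees in attachment trees\<close>

text \<open>Each regime is encoded by two deterministic sequences. The threshold \<open>x\<close>
  follows the noise-free equation with a little slack, and the width \<open>\<rho>\<close> bounds
  the random excess over it. The rate of change of \<open>\<rho>\<close> is placed strictly between
  the rate of \<open>x\<close> and the rate that the drift at \<open>x\<close> would permit: the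
  potential normalised by \<open>\<rho>\<close> is then still almost a supermartingale, and
  \<open>\<rho>\<close> becomes negligible against \<open>x\<close>. For lower bounds
  \<open>\<rho>\<close> is measured on the scale of \<open>1 / x\<close>. Two obstacles shape the
  lower bound. A heaviest vertex above the threshold drifts down faster than one at the threshold,
  since \<open>r\<close> decreases; the Lipschitz bound on \<open>r\<close> shows that its distance
  to the threshold makes up for this. And the relative noise of a weight \<open>z\<close> has size
  \<open>1 / z\<close>, which need not be small; a small power \<open>s\<close> makes its expected
  contribution summable as soon as the expected inverse maximal weight decays like any power of n.
  Conditioning stays elementary: a history almost surely takes finitely many values, so conditional
  inequalities are tested against functions \<open>f\<close> of the history.\<close>

definition valid_attachment :: "(nat \<Rightarrow> nat) \<Rightarrow> bool" where
  "valid_attachment y \<longleftrightarrow> (\<forall>k\<ge>1. y k \<in> {1..k + 1})"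

lemma tree_edges_Suc:
  assumes "n \<ge> 1"
  shows "tree_edges y (Suc n) = insert {n + 2, y n} (tree_edges y n)"
proof -
  obtain m where "n = Suc m" using assms by (cases n) auto
  then show ?thesis by (simp add: eval_nat_numeral)
qed

lemma tree_edges_cong:
  assumes "\<And>k. 1 \<le> k \<Longrightarrow> k < n \<Longrightarrow> y k = y' k"
  shows "tree_edges y n = tree_edges y' n"
  using assms
proof (induction y n rule: tree_edges.induct)
  case (3 y n)
  then have "tree_edges y (Suc n) = tree_edges y' (Suc n)" by simp
  then show ?case using 3(2)[of "Suc n"] by simp
qed auto

lemma finite_tree_edges [simp]: "finite (tree_edges y n)"
  by (induction y n rule: tree_edges.induct) auto

lemma tree_edges_subset:
  assumes "valid_attachment y" "e \<in> tree_edges y n"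
  shows "e \<subseteq> {1..n + 1}"
  using assms
proof (induction y n rule: tree_edges.induct)
  case (3 y n)
  have "y (Suc n) \<in> {1..n + 2}" using 3(2) unfolding valid_attachment_def by force
  then show ?case using 3 by fastforce
qed (auto)

lemma vdegree_insert:
  assumes "finite E" "e \<notin> E"
  shows "vdegree (insert e E) v = vdegree E v + (if v \<in> e then 1 else 0)"
proof -
  have "{e' \<in> insert e E. v \<in> e'} = (if v \<in> e then insert e {e' \<in> E. v \<in> e'} else {e' \<in> E. v \<in> e'})"
    by auto
  then show ?thesis using assms by (auto simp: vdegree_def)
qed

lemma vdegree_tree_edges_Suc:
  assumes "valid_attachment y" "n \<ge> 1"
  shows "vdegree (tree_edges y (Suc n)) v =
    vdegree (tree_edges y n) v + (if v = n + 2 \<or> v = y n then 1 else 0)"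
proof -
  have "{n + 2, y n} \<notin> tree_edges y n"
    using tree_edges_subset[OF assms(1), of _ n] by force
  then show ?thesis
    using tree_edges_Suc[OF assms(2)] by (simp add: vdegree_insert)
qed

lemma vdegree_fresh:
  assumes "valid_attachment y" "v > n + 1"
  shows "vdegree (tree_edges y n) v = 0"
proof -
  have "{e \<in> tree_edges y n. v \<in> e} = {}"
    using tree_edges_subset[OF assms(1), of _ n] assms(2) by force
  then show ?thesis by (simp only: vdegree_def) simp
qed

lemma vdegree_pos:
  assumes "n \<ge> 1" "v \<in> {1..n + 1}"
  shows "vdegree (tree_edges y n) v \<ge> 1"
proof -
  have "\<exists>e\<in>tree_edges y n. v \<in> e"
    using assms
  proof (induction n rule: nat_induct_at_least)
    case base
    then show ?case by auto
  next
    case (Suc n)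
    then show ?case using tree_edges_Suc[OF Suc(1), of y]
      by (cases "v \<le> n + 1") (auto simp: le_Suc_eq)
  qed
  then have "{e \<in> tree_edges y n. v \<in> e} \<noteq> {}" by auto
  then have "card {e \<in> tree_edges y n. v \<in> e} > 0" by (subst card_gt_0_iff) simp
  then show ?thesis by (simp add: vdegree_def)
qed

lemma sum_vdegree:
  assumes "valid_attachment y" "n \<ge> 1"
  shows "(\<Sum>v\<in>{1..n + 1}. vdegree (tree_edges y n) v) = 2 * n"
  using assms(2)
proof (induction n rule: nat_induct_at_least)
  case base
  have "{e. e = {1, 2::nat} \<and> 1 \<in> e} = {{1,2}}" "{e. e = {1, 2::nat} \<and> 2 \<in> e} = {{1,2}}" by auto
  then have "vdegree {{1,2}} 1 = 1" "vdegree {{1,2}} 2 = 1" by (auto simp: vdegree_def)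
  then show ?case by (simp add: numeral_2_eq_2)
next
  case (Suc n)
  have y: "y n \<in> {1..n + 1}" using assms(1) Suc(1) by (auto simp: valid_attachment_def)
  have "(\<Sum>v\<in>{1..Suc n + 1}. vdegree (tree_edges y (Suc n)) v) =
     (\<Sum>v\<in>{1..n + 1}. vdegree (tree_edges y (Suc n)) v) + vdegree (tree_edges y (Suc n)) (n + 2)"
    by simp
  also have "vdegree (tree_edges y (Suc n)) (n + 2) = 1"
    using vdegree_tree_edges_Suc[OF assms(1) Suc(1)] vdegree_fresh[OF assms(1), of n "n + 2"] by simp
  also have "(\<Sum>v\<in>{1..n + 1}. vdegree (tree_edges y (Suc n)) v) =
     (\<Sum>v\<in>{1..n + 1}. vdegree (tree_edges y n) v + (if v = y n then 1 else 0))"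
    by (rule sum.cong) (auto simp: vdegree_tree_edges_Suc[OF assms(1) Suc(1)])
  also have "\<dots> = 2 * n + 1"
    using Suc y by (simp add: sum.distrib sum.delta)
  finally show ?case by simp
qed

lemma max_degree_ge:
  "v \<in> {1..n + 1} \<Longrightarrow> vdegree (tree_edges y n) v \<le> max_degree y n"
  by (auto simp: max_degree_def intro!: Max_ge)

lemma max_degree_attained:
  obtains v where "v \<in> {1..n + 1}" "vdegree (tree_edges y n) v = max_degree y n"
proof -
  have "max_degree y n \<in> (\<lambda>i. vdegree (tree_edges y n) i) ` {1..n + 1}"
    unfolding max_degree_def by (intro Max_in) auto
  then show ?thesis using that by auto
qed

text \<open>Expanding the power over sequences of factors. With \<open>f\<close> the sampling
  weights, this is the probability that \<open>k\<close> independent draws all land in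
  \<open>A\<close>; it is applied to the vertices other than a given one.\<close>

lemma sum_prod_list_lists:
  fixes f :: "'b \<Rightarrow> real"
  assumes "finite A"
  shows "(\<Sum>xs | set xs \<subseteq> A \<and> length xs = k. \<Prod>x\<leftarrow>xs. f x) = (\<Sum>x\<in>A. f x) ^ k"
proof (induction k)
  case 0
  have "{xs. set xs \<subseteq> A \<and> length xs = 0} = {[]}" by auto
  then show ?case by simp
next
  case (Suc k)
  have "{xs. set xs \<subseteq> A \<and> length xs = Suc k} =
    (\<lambda>(x, xs). x # xs) ` (A \<times> {xs. set xs \<subseteq> A \<and> length xs = k})"
    by (auto simp: length_Suc_conv image_iff)
  moreover have "inj_on (\<lambda>(x, xs). x # xs) (A \<times> {xs. set xs \<subseteq> A \<and> length xs = k})"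
    by (auto simp: inj_on_def)
  ultimately have "(\<Sum>xs | set xs \<subseteq> A \<and> length xs = Suc k. \<Prod>x\<leftarrow>xs. f x) =
    (\<Sum>(x, xs)\<in>A \<times> {xs. set xs \<subseteq> A \<and> length xs = k}. f x * (\<Prod>x\<leftarrow>xs. f x))"
    by (simp add: sum.reindex case_prod_unfold)
  also have "\<dots> = (\<Sum>x\<in>A. f x) * (\<Sum>xs | set xs \<subseteq> A \<and> length xs = k. \<Prod>x\<leftarrow>xs. f x)"
    by (simp add: sum_product sum.cartesian_product case_prod_unfold)
  finally show ?case using Suc by simp
qed

subsection \<open>The sampling rate\<close>

lemma one_minus_power_bounds:
  fixes q q' :: real
  assumes "0 \<le> q" "q \<le> q'" "q' \<le> 1"
  shows "(1 - q') ^ j \<le> (1 - q) ^ j" "(1 - q) ^ j - (1 - q') ^ j \<le> real j * (q' - q)"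
proof -
  show le: "(1 - q') ^ j \<le> (1 - q) ^ j" for j using assms by (intro power_mono) auto
  show "(1 - q) ^ j - (1 - q') ^ j \<le> real j * (q' - q)"
  proof (induction j)
    case (Suc j)
    have "(1 - q) ^ Suc j - (1 - q') ^ Suc j =
        (1 - q) * ((1 - q) ^ j - (1 - q') ^ j) + (q' - q) * (1 - q') ^ j"
      by (simp add: algebra_simps)
    also have "\<dots> \<le> 1 * ((1 - q) ^ j - (1 - q') ^ j) + (q' - q) * 1"
      using assms le[of j] by (intro add_mono mult_mono mult_left_mono power_le_one) auto
    also have "\<dots> \<le> real (Suc j) * (q' - q)" using Suc by (simp add: algebra_simps)
    finally show ?case .
  qed simp
qed

text \<open>A second-order Bonferroni bound: the inductive step discards only the nonpositive term
  \<open>- real (j choose 2) * q ^ 3\<close>.\<close>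

lemma one_minus_power_le_quadratic:
  fixes q :: real
  assumes "0 \<le> q" "q \<le> 1"
  shows "(1 - q) ^ j \<le> 1 - real j * q + real (j choose 2) * q\<^sup>2"
proof (induction j)
  case (Suc j)
  have "(1 - q) ^ Suc j \<le> (1 - q) * (1 - real j * q + real (j choose 2) * q\<^sup>2)"
    using Suc assms by (simp add: mult_left_mono)
  also have "\<dots> \<le> 1 - real (Suc j) * q + (real j + real (j choose 2)) * q\<^sup>2"
    using assms by (simp add: algebra_simps power2_eq_square)
  finally show ?case by (simp add: numeral_2_eq_2)
qed simp

lemma sum_choose_real: "(\<Sum>j<k. real (j choose m)) = real (k choose Suc m)"
  by (induction k) auto

text \<open>
  A vertex of weight \<open>u / w\<close> is sampled with probability \<open>E (1 - (1 - u/w)^d) = u * sample_rate D w u\<close>.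
\<close>

definition sample_rate :: "nat pmf \<Rightarrow> real \<Rightarrow> real \<Rightarrow> real" where
  "sample_rate D w u = measure_pmf.expectation D (\<lambda>k. \<Sum>j<k. (1 - u / w) ^ j) / w"

locale sampling_law =
  fixes D :: "nat pmf" and w :: real
  assumes w: "w > 1" and D_pos: "set_pmf D \<subseteq> {1..}"
    and integrable_choose: "\<And>j. integrable D (\<lambda>k. real (k choose j))"
begin

abbreviation r where "r \<equiv> sample_rate D w"

definition mean where "mean = measure_pmf.expectation D real"
definition moment where "moment j = measure_pmf.expectation D (\<lambda>k. real (k choose j))"

lemma integrable_real: "integrable D real"
  using integrable_choose[of 1] by simp

lemma moment_nonneg: "moment j \<ge> 0" by (simp add: moment_def)

lemma geometric_sum_le: "0 \<le> u \<Longrightarrow> u \<le> w \<Longrightarrow> (\<Sum>j<k. (1 - u / w) ^ j) \<le> real k"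
  using w sum_bounded_above[of "{..<k}" "\<lambda>j. (1 - u / w) ^ j" 1] by (auto simp: power_le_one)

lemma geometric_sum_nonneg: "0 \<le> u \<Longrightarrow> u \<le> w \<Longrightarrow> 0 \<le> (\<Sum>j<k. (1 - u / w) ^ j)"
  using w by (intro sum_nonneg) auto

lemma integrable_geometric:
  assumes "0 \<le> u" "u \<le> w"
  shows "integrable D (\<lambda>k. \<Sum>j<k. (1 - u / w) ^ j)"
  by (rule Bochner_Integration.integrable_bound[OF integrable_real])
    (use assms in \<open>auto simp: geometric_sum_le geometric_sum_nonneg\<close>)

lemma integrable_power:
  assumes "0 \<le> u" "u \<le> w"
  shows "integrable D (\<lambda>k. (1 - u / w) ^ k)"
  by (rule measure_pmf.integrable_const_bound[where B = 1])
    (use assms w in \<open>auto intro!: power_le_one AE_pmfI\<close>)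

lemma sampling_probability:
  assumes "0 \<le> u" "u \<le> w"
  shows "measure_pmf.expectation D (\<lambda>k. (1 - u / w) ^ k) = 1 - u * r u"
proof -
  have "(1 - u / w) ^ k = 1 - u / w * (\<Sum>j<k. (1 - u / w) ^ j)" for k
    using one_diff_power_eq[of "1 - u / w" k] by simp
  then have "measure_pmf.expectation D (\<lambda>k. (1 - u / w) ^ k) =
      measure_pmf.expectation D (\<lambda>k. 1 - u / w * (\<Sum>j<k. (1 - u / w) ^ j))" by (intro Bochner_Integration.integral_cong refl)
  also have "\<dots> = 1 - u * r u"
    using integrable_geometric[OF assms] by (simp add: sample_rate_def)
  finally show ?thesis .
qed

lemma mult_rate: "w * r u = measure_pmf.expectation D (\<lambda>k. \<Sum>j<k. (1 - u / w) ^ j)"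
  using w by (simp add: sample_rate_def)

lemma rate_zero: "r 0 = mean / w"
  by (simp add: sample_rate_def mean_def)

lemma rate_antimono:
  assumes "0 \<le> u" "u \<le> v" "v \<le> w"
  shows "r v \<le> r u"
proof -
  have "measure_pmf.expectation D (\<lambda>k. \<Sum>j<k. (1 - v / w) ^ j)
      \<le> measure_pmf.expectation D (\<lambda>k. \<Sum>j<k. (1 - u / w) ^ j)"
    using assms w
    by (intro integral_mono integrable_geometric sum_mono power_mono) (auto simp: divide_right_mono)
  then show ?thesis using w by (simp add: sample_rate_def divide_right_mono)
qed

lemma rate_le: "0 \<le> u \<Longrightarrow> u \<le> w \<Longrightarrow> r u \<le> mean / w"
  using rate_antimono[of 0 u] rate_zero by simp

text \<open>Since \<open>d\<close> is at least 1, the summand \<open>j = 0\<close> always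
  contributes 1. This floor makes the heaviest weight grow polynomially however small it is.\<close>

lemma rate_ge:
  assumes "0 \<le> u" "u \<le> w"
  shows "r u \<ge> 1 / w"
proof -
  have "measure_pmf.expectation D (\<lambda>k. 1) \<le> measure_pmf.expectation D (\<lambda>k. \<Sum>j<k. (1 - u / w) ^ j)"
  proof (intro integral_mono_AE integrable_geometric assms)
    show "AE k in D. 1 \<le> (\<Sum>j<k. (1 - u / w) ^ j)"
    proof (rule AE_pmfI)
      fix k assume "k \<in> set_pmf D"
      then have "k \<ge> 1" using D_pos by auto
      then have "(\<Sum>j\<in>{0}. (1 - u / w) ^ j) \<le> (\<Sum>j<k. (1 - u / w) ^ j)"
        using assms w by (intro sum_mono2) auto
      then show "1 \<le> (\<Sum>j<k. (1 - u / w) ^ j)" by simp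
    qed
  qed auto
  then show ?thesis using w by (simp add: sample_rate_def divide_right_mono)
qed

text \<open>Because the sum of \<open>j\<close> over \<open>j < k\<close> is
  \<open>k choose 2\<close>, the constant is exactly minus the slope of \<open>r\<close> at 0. This
  sharpness is needed for the lower half of the critical limit, where a cruder constant would give
  the wrong value.\<close>

lemma rate_lipschitz:
  assumes "0 \<le> u" "u \<le> v" "v \<le> w"
  shows "r u - r v \<le> moment 2 / w\<^sup>2 * (v - u)"
proof -
  have "measure_pmf.expectation D (\<lambda>k. (\<Sum>j<k. (1 - u / w) ^ j) - (\<Sum>j<k. (1 - v / w) ^ j))
      \<le> measure_pmf.expectation D (\<lambda>k. real (k choose 2) * (v / w - u / w))"
  proof (intro integral_mono Bochner_Integration.integrable_diff integrable_geometric
      integrable_mult_left integrable_choose)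
    fix k
    have "(\<Sum>j<k. (1 - u / w) ^ j) - (\<Sum>j<k. (1 - v / w) ^ j) \<le> (\<Sum>j<k. real j * (v / w - u / w))"
      unfolding sum_subtractf[symmetric] using assms w
      by (intro sum_mono one_minus_power_bounds) (auto simp: divide_right_mono)
    also have "\<dots> = real (k choose 2) * (v / w - u / w)"
      using sum_choose_real[of 1 k] by (simp add: sum_distrib_right[symmetric] numeral_2_eq_2)
    finally show "(\<Sum>j<k. (1 - u / w) ^ j) - (\<Sum>j<k. (1 - v / w) ^ j)
      \<le> real (k choose 2) * (v / w - u / w)" .
  qed (use assms in auto)
  also have "\<dots> = moment 2 * (v / w - u / w)"
    by (simp only: moment_def integral_mult_left_zero)
  also have "\<dots> = moment 2 * (v - u) / w"
    by (simp add: diff_divide_distrib right_diff_distrib)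
  also have "measure_pmf.expectation D (\<lambda>k. (\<Sum>j<k. (1 - u / w) ^ j) - (\<Sum>j<k. (1 - v / w) ^ j)) =
     w * (r u - r v)"
    using assms by (subst Bochner_Integration.integral_diff)
      (auto simp: right_diff_distrib mult_rate intro!: integrable_geometric)
  finally have "w * (r u - r v) / w \<le> moment 2 * (v - u) / w / w"
    using w by (intro divide_right_mono) auto
  then show ?thesis using w by (simp add: power2_eq_square)
qed

text \<open>The Bonferroni bound is integrated. Its linear coefficient equals the Lipschitz constant
  of \<open>rate_lipschitz\<close>, so the upper and the lower estimate in the critical regime see
  the same slope and differ only by a quadratic term.\<close>

lemma rate_le_quadratic:
  assumes "0 \<le> u" "u \<le> w"
  shows "r u \<le> mean / w - moment 2 / w\<^sup>2 * u + moment 3 / w ^ 3 * u\<^sup>2"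
proof -
  let ?q = "u / w"
  have "measure_pmf.expectation D (\<lambda>k. \<Sum>j<k. (1 - ?q) ^ j)
      \<le> measure_pmf.expectation D (\<lambda>k. real k - real (k choose 2) * ?q + real (k choose 3) * ?q\<^sup>2)"
  proof (intro integral_mono integrable_geometric Bochner_Integration.integrable_add
      Bochner_Integration.integrable_diff integrable_mult_left integrable_choose integrable_real)
    fix k
    have "(\<Sum>j<k. (1 - ?q) ^ j) \<le> (\<Sum>j<k. 1 - real j * ?q + real (j choose 2) * ?q\<^sup>2)"
      using assms w by (intro sum_mono one_minus_power_le_quadratic) auto
    also have "\<dots> = real k - real (k choose 2) * ?q + real (k choose 3) * ?q\<^sup>2"
      using sum_choose_real[of 1 k] sum_choose_real[of 2 k]
      by (simp add: sum.distrib sum_subtractf flip: sum_distrib_right times_divide_eq_right power_divide)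
        (simp add: eval_nat_numeral)
    finally show "(\<Sum>j<k. (1 - ?q) ^ j) \<le> real k - real (k choose 2) * ?q + real (k choose 3) * ?q\<^sup>2" .
  qed (use assms in auto)
  also have "\<dots> = mean - moment 2 * ?q + moment 3 * ?q\<^sup>2"
    using integrable_choose integrable_real by (simp add: moment_def mean_def)
  finally have "w * r u / w \<le> (mean - moment 2 * ?q + moment 3 * ?q\<^sup>2) / w"
    using w by (intro divide_right_mono) (auto simp: mult_rate)
  also have "\<dots> = mean / w - moment 2 / w\<^sup>2 * u + moment 3 / w ^ 3 * u\<^sup>2"
    using w by (simp add: field_simps power2_eq_square power3_eq_cube)
  finally show ?thesis using w by simp
qed

text \<open>A mean above 1 forces \<open>d \<ge> 2\<close> with positive probability, and then
  already the summand \<open>j = 1\<close> decreases strictly in \<open>u\<close>.\<close>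

lemma rate_strict_antimono:
  assumes "0 \<le> u" "u < v" "v \<le> w" and "mean > 1"
  shows "r v < r u"
proof -
  have "\<exists>k\<in>set_pmf D. k \<ge> 2"
  proof (rule ccontr)
    assume "\<not> (\<exists>k\<in>set_pmf D. k \<ge> 2)"
    then have "mean \<le> measure_pmf.expectation D (\<lambda>k. 1)"
      unfolding mean_def by (intro integral_mono_AE integrable_real) (auto intro!: AE_pmfI)
    then show False using \<open>mean > 1\<close> by simp
  qed
  then obtain k0 where k0: "k0 \<in> set_pmf D" "k0 \<ge> 2" by auto
  let ?f = "\<lambda>k. (\<Sum>j<k. (1 - u / w) ^ j) - (\<Sum>j<k. (1 - v / w) ^ j)"
  have f_nonneg: "?f k \<ge> 0" for k
    using assms w by (simp add: divide_right_mono sum_mono power_mono)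
  have int: "integrable D ?f"
    using assms by (intro Bochner_Integration.integrable_diff integrable_geometric) auto
  have "?f k0 \<ge> (\<Sum>j\<in>{1}. (1 - u / w) ^ j - (1 - v / w) ^ j)"
    unfolding sum_subtractf[symmetric] using assms w k0(2)
    by (intro sum_mono2) (auto simp: divide_right_mono power_mono)
  moreover have "v / w - u / w > 0" using assms w by (simp add: divide_strict_right_mono)
  ultimately have f_pos: "?f k0 > 0" by simp
  have "0 \<noteq> measure_pmf.expectation D ?f"
  proof
    assume "0 = measure_pmf.expectation D ?f"
    then have "AE k in D. ?f k = 0"
      using integral_nonneg_eq_0_iff_AE[OF int] f_nonneg by auto
    then show False using k0(1) f_pos by (auto simp: AE_measure_pmf_iff)
  qed
  moreover have "0 \<le> measure_pmf.expectation D ?f" using f_nonneg by simp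
  moreover have "measure_pmf.expectation D ?f = w * (r u - r v)"
    using assms by (subst Bochner_Integration.integral_diff)
      (auto simp: right_diff_distrib mult_rate intro!: integrable_geometric)
  ultimately have "w * (r u - r v) > 0" by linarith
  then show ?thesis using w by (simp add: zero_less_mult_iff)
qed

lemma continuous_on_rate: "continuous_on {0..w} r"
proof -
  have "(moment 2 / w\<^sup>2)-lipschitz_on {0..w} r"
  proof (rule lipschitz_onI)
    fix u v assume "u \<in> {0..w}" "v \<in> {0..w}"
    then show "dist (r u) (r v) \<le> moment 2 / w\<^sup>2 * dist u v"
      using rate_lipschitz[of u v] rate_lipschitz[of v u] rate_antimono[of u v] rate_antimono[of v u]
      by (cases "u \<le> v") (auto simp: dist_real_def abs_if)
  qed (simp add: moment_nonneg)
  then show ?thesis by (rule lipschitz_on_continuous_on)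
qed

text \<open>\<open>1 - r 1\<close> is the probability that all draws miss a vertex of sampling
  weight \<open>1 / w\<close>, which is positive because \<open>w > 1\<close>.\<close>

lemma rate_1_less: "r 1 < 1"
proof -
  have int: "integrable D (\<lambda>k. (1 - 1 / w) ^ k)" using integrable_power[of 1] w by simp
  have "measure_pmf.expectation D (\<lambda>k. (1 - 1 / w) ^ k) > 0"
  proof -
    have "measure_pmf.expectation D (\<lambda>k. (1 - 1 / w) ^ k) \<noteq> 0"
      using integral_nonneg_eq_0_iff_AE[OF int] w set_pmf_not_empty[of D]
      by (auto simp: AE_measure_pmf_iff)
    moreover have "measure_pmf.expectation D (\<lambda>k. (1 - 1 / w) ^ k) \<ge> 0" using w by simp
    ultimately show ?thesis by simp
  qed
  then show ?thesis using sampling_probability[of 1] w by simp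
qed

text \<open>For \<open>u > 0\<close> the equation \<open>u * r u = u\<close> defining the
  supercritical limit reduces to \<open>r u = 1\<close>. A mean above \<open>w\<close> means
  \<open>r 0 > 1\<close>, while \<open>r 1 < 1\<close>, so continuity gives a root.\<close>

lemma rate_eq_1_ex:
  assumes "mean > w"
  obtains x where "0 < x" "x < 1" "r x = 1"
proof -
  have "\<exists>x. 0 \<le> x \<and> x \<le> 1 \<and> r x = 1"
  proof (rule IVT2')
    show "r 1 \<le> 1" using rate_1_less by simp
    show "1 \<le> r 0" using assms w by (simp add: rate_zero)
    show "continuous_on {0..1} r" by (rule continuous_on_subset[OF continuous_on_rate]) (use w in auto)
  qed simp
  then obtain x where x: "0 \<le> x" "x \<le> 1" "r x = 1" by auto
  moreover have "x \<noteq> 0" using x assms w by (auto simp: rate_zero)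
  moreover have "x \<noteq> 1" using x rate_1_less by auto
  ultimately show ?thesis by (intro that[of x]) auto
qed

end

subsection \<open>One-step conditional probabilities\<close>

lemma measurable_map_count_space:
  fixes f :: "'i \<Rightarrow> 'a \<Rightarrow> 'b :: countable"
  assumes "\<And>k. k \<in> set ks \<Longrightarrow> f k \<in> M \<rightarrow>\<^sub>M count_space UNIV"
  shows "(\<lambda>\<omega>. map (\<lambda>k. f k \<omega>) ks) \<in> M \<rightarrow>\<^sub>M count_space UNIV"
  using assms
proof (induction ks)
  case (Cons k ks)
  have "(\<lambda>\<omega>. c # map (\<lambda>k. f k \<omega>) ks) \<in> M \<rightarrow>\<^sub>M count_space UNIV" for c
    by (rule measurable_compose[where f = "\<lambda>\<omega>. map (\<lambda>k. f k \<omega>) ks" and N = "count_space UNIV"])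
      (use Cons in auto)
  from measurable_compose_countable[where f = "\<lambda>c \<omega>. c # map (\<lambda>k. f k \<omega>) ks", OF this, of "f k"] Cons
  show ?case by simp
qed simp

lemma subalgebra_sigma_of:
  assumes "g \<in> M \<rightarrow>\<^sub>M count_space UNIV"
  shows "subalgebra M (sigma_of M g)"
proof -
  have "sets (vimage_algebra (space M) g (count_space UNIV)) \<subseteq> sets M"
    using assms by (auto simp: sets_vimage_algebra2 dest: measurable_sets)
  then show ?thesis by (auto simp: subalgebra_def sigma_of_def)
qed

text \<open>Integrating the conditional expectation over the event
  \<open>g \<omega> \<in> Q\<close>, which belongs to the generated sigma-algebra. The conditional
  laws of the model thereby become product formulas for ordinary probabilities.\<close>

lemma (in prob_space) prob_eq_of_cond_exp_const:
  fixes c :: real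
  assumes g: "g \<in> M \<rightarrow>\<^sub>M count_space UNIV" and B: "B \<in> events"
    and ae: "AE \<omega> in M. real_cond_exp M (sigma_of M g) (indicator B) \<omega> = \<phi> \<omega>"
    and const: "\<And>\<omega>. \<omega> \<in> space M \<Longrightarrow> g \<omega> \<in> Q \<Longrightarrow> \<phi> \<omega> = c"
  shows "prob {\<omega> \<in> space M. g \<omega> \<in> Q \<and> \<omega> \<in> B} = prob {\<omega> \<in> space M. g \<omega> \<in> Q} * c"
proof -
  interpret S: finite_measure_subalgebra M "sigma_of M g"
    by unfold_locales (rule subalgebra_sigma_of[OF g])
  define A where "A = {\<omega> \<in> space M. g \<omega> \<in> Q}"
  have "A = g -` Q \<inter> space M" by (auto simp: A_def)
  then have A: "A \<in> sets (sigma_of M g)"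
    by (auto simp: sigma_of_def sets_vimage_algebra2)
  have Am: "A \<in> events" using A subalgebra_sigma_of[OF g] by (auto simp: subalgebra_def)
  have "prob {\<omega> \<in> space M. g \<omega> \<in> Q \<and> \<omega> \<in> B} = prob (A \<inter> B)"
    using sets.sets_into_space[OF B] by (intro arg_cong[where f = prob]) (auto simp: A_def)
  also have "\<dots> = (\<integral>\<omega>. indicator (A \<inter> B) \<omega> \<partial>M)"
    using Am B by simp
  also have "\<dots> = (\<integral>\<omega>\<in>A. indicator B \<omega> \<partial>M)"
    by (simp add: set_lebesgue_integral_def indicator_inter_arith)
  also have "\<dots> = (\<integral>\<omega>\<in>A. real_cond_exp M (sigma_of M g) (indicator B) \<omega> \<partial>M)"
    by (rule S.real_cond_exp_intA) (use A B in \<open>auto simp: integrable_indicator_iff less_top[symmetric]\<close>)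
  also have "\<dots> = (\<integral>\<omega>. indicator A \<omega> * c \<partial>M)"
    unfolding set_lebesgue_integral_def
  proof (rule integral_cong_AE)
    show "AE \<omega> in M. indicator A \<omega> *\<^sub>R real_cond_exp M (sigma_of M g) (indicator B) \<omega> = indicator A \<omega> * c"
      using ae AE_space by eventually_elim (auto simp: A_def const indicator_def)
  qed (use Am in auto)
  also have "\<dots> = prob A * c" using Am by simp
  finally show ?thesis by (simp add: A_def)
qed

section \<open>Measurability of histories and the almost sure structure of the samples\<close>

locale mori_tree = max_choice_mori +
  assumes beta: "\<beta> > -1" and D_pos: "set_pmf D \<subseteq> {1..}"
begin

abbreviation tree where "tree n \<omega> \<equiv> tree_edges (\<lambda>k. Y k \<omega>) n"
abbreviation hist where "hist n \<omega> \<equiv> edge_history (\<lambda>k. Y k \<omega>) n"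

lemma nth_hist: "1 \<le> k \<Longrightarrow> k \<le> n \<Longrightarrow> hist n \<omega> ! (k - 1) = tree k \<omega>"
  unfolding edge_history_def by (subst nth_map) (auto simp del: upt_Suc)

lemma last_hist: "n \<ge> 1 \<Longrightarrow> last (hist n \<omega>) = tree n \<omega>"
  by (simp add: edge_history_def)

lemma measurable_hist [measurable]: "hist n \<in> M \<rightarrow>\<^sub>M count_space UNIV"
proof -
  have 1: "(\<lambda>\<omega>. map (\<lambda>k. Y k \<omega>) [1..<n]) \<in> M \<rightarrow>\<^sub>M count_space UNIV"
    by (rule measurable_map_count_space) (auto intro: measurable_Y)
  \<comment> \<open>The type of edge histories is uncountable, so measurability into its discrete
    sigma-algebra is obtained by factoring through the list of the first \<open>n - 1\<close>
    attachment vertices, a countable type. The shift \<open>k - 1\<close> appears because position 0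
    of that list holds \<open>Y 1\<close>.\<close>
  have "hist n \<omega> = edge_history (\<lambda>k. map (\<lambda>k. Y k \<omega>) [1..<n] ! (k - 1)) n" for \<omega>
    unfolding edge_history_def
    by (intro map_cong tree_edges_cong refl) (subst nth_map, auto simp del: upt_Suc)
  then show ?thesis
    using measurable_compose[OF 1, of "\<lambda>l. edge_history (\<lambda>k. l ! (k - 1)) n" "count_space UNIV"]
    by simp
qed

lemma measurable_hist_d:
  assumes "n \<ge> 1"
  shows "(\<lambda>\<omega>. (hist n \<omega>, d n \<omega>)) \<in> M \<rightarrow>\<^sub>M count_space UNIV"
proof (rule measurable_compose_countable[where f = "\<lambda>k \<omega>. (hist n \<omega>, k)" and g = "d n"])
  fix k
  show "(\<lambda>\<omega>. (hist n \<omega>, k)) \<in> M \<rightarrow>\<^sub>M count_space UNIV"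
    by (rule measurable_compose[OF measurable_hist, where g = "\<lambda>h. (h, k)"]) simp
qed (rule measurable_d[OF assms])

lemma measurable_hist_d_X:
  assumes "n \<ge> 1"
  shows "(\<lambda>\<omega>. (hist n \<omega>, d n \<omega>, X n \<omega>)) \<in> M \<rightarrow>\<^sub>M count_space UNIV"
proof (rule measurable_compose_countable[where f = "\<lambda>xs \<omega>. (hist n \<omega>, d n \<omega>, xs)" and g = "X n"])
  fix xs
  have "(\<lambda>\<omega>. (\<lambda>(h, k). (h, k, xs)) (hist n \<omega>, d n \<omega>)) \<in> M \<rightarrow>\<^sub>M count_space UNIV"
    by (rule measurable_compose[OF measurable_hist_d[OF assms], where g = "\<lambda>(h, k). (h, k, xs)"]) simp
  then show "(\<lambda>\<omega>. (hist n \<omega>, d n \<omega>, xs)) \<in> M \<rightarrow>\<^sub>M count_space UNIV" by simp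
qed (rule measurable_X[OF assms])

lemma prob_sample:
  assumes n: "n \<ge> 1"
  shows "prob {\<omega> \<in> space M. hist n \<omega> = h \<and> d n \<omega> = k \<and> X n \<omega> = xs} =
     prob {\<omega> \<in> space M. hist n \<omega> = h \<and> d n \<omega> = k} *
     (if length xs = k then \<Prod>x\<leftarrow>xs. mori_weight \<beta> n (last h) x else 0)"
proof -
  have "{\<omega> \<in> space M. X n \<omega> = xs} \<in> events"
    using measurable_sets[OF measurable_X[OF n], of "{xs}"] by (simp add: vimage_def Int_def conj_commute)
  from prob_eq_of_cond_exp_const[OF measurable_hist_d[OF n] this cond_X[OF n],
      of "{(h, k)}" "if length xs = k then \<Prod>x\<leftarrow>xs. mori_weight \<beta> n (last h) x else 0"]
  show ?thesis using last_hist[OF n] by (fastforce simp: conj_ac)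
qed

text \<open>\<open>mori_weight\<close> vanishes outside the current vertex set, so each list with a
  foreign entry has probability 0, and there are only countably many lists.\<close>

lemma AE_sample_subset:
  assumes n: "n \<ge> 1"
  shows "AE \<omega> in M. set (X n \<omega>) \<subseteq> {1..n + 1}"
proof -
  have "AE \<omega> in M. X n \<omega> = xs \<longrightarrow> set xs \<subseteq> {1..n + 1}" for xs
  proof (cases "set xs \<subseteq> {1..n + 1}")
    case False
    have B: "{\<omega> \<in> space M. X n \<omega> = xs} \<in> events"
      using measurable_sets[OF measurable_X[OF n], of "{xs}"] by (simp add: vimage_def Int_def conj_commute)
    have "(\<Prod>x\<leftarrow>xs. mori_weight \<beta> n E x) = 0" for E
      using False by (auto simp: prod_list_zero_iff mori_weight_def)
    from prob_eq_of_cond_exp_const[OF measurable_hist_d[OF n] B cond_X[OF n], of UNIV 0] this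
    have "prob {\<omega> \<in> space M. X n \<omega> = xs} = 0" by (simp cong: if_cong)
    with B have "AE \<omega> in M. \<omega> \<notin> {\<omega> \<in> space M. X n \<omega> = xs}" by (simp add: prob_eq_0)
    with AE_space show ?thesis by eventually_elim auto
  qed auto
  then have "AE \<omega> in M. \<forall>xs. X n \<omega> = xs \<longrightarrow> set xs \<subseteq> {1..n + 1}" by (subst AE_all_countable) auto
  then show ?thesis by eventually_elim auto
qed

lemma AE_top_sampled:
  assumes n: "n \<ge> 1"
  shows "AE \<omega> in M. Y n \<omega> \<in> top_sampled (tree n \<omega>) (X n \<omega>)"
proof -
  have "AE \<omega> in M. Y n \<omega> = y \<longrightarrow> y \<in> top_sampled (tree n \<omega>) (X n \<omega>)" for y
  proof -
    have B: "{\<omega> \<in> space M. Y n \<omega> = y} \<in> events"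
      using measurable_sets[OF measurable_Y[OF n], of "{y}"] by (simp add: vimage_def Int_def conj_commute)
    \<comment> \<open>On \<open>?Q\<close> the conditional law of \<open>Y n\<close> gives
      \<open>y\<close> the constant probability 0, the form required by
      \<open>prob_eq_of_cond_exp_const\<close>.\<close>
    let ?Q = "{(h, k, xs). y \<notin> top_sampled (last h) xs}" 
    have A: "{\<omega> \<in> space M. (hist n \<omega>, d n \<omega>, X n \<omega>) \<in> ?Q} \<in> events"
      using measurable_sets[OF measurable_hist_d_X[OF n], of ?Q] by (simp add: vimage_def Int_def conj_commute)
    have "prob {\<omega> \<in> space M. (hist n \<omega>, d n \<omega>, X n \<omega>) \<in> ?Q \<and> \<omega> \<in> {\<omega> \<in> space M. Y n \<omega> = y}} = 0"
      using prob_eq_of_cond_exp_const[OF measurable_hist_d_X[OF n] B cond_Y[OF n], of ?Q 0]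
      by (simp add: last_hist[OF n])
    then have "AE \<omega> in M. \<omega> \<notin> {\<omega> \<in> space M. (hist n \<omega>, d n \<omega>, X n \<omega>) \<in> ?Q \<and> \<omega> \<in> {\<omega> \<in> space M. Y n \<omega> = y}}"
      using sets.Int[OF A B] by (subst (asm) prob_eq_0) (auto simp: Int_def conj_ac)
    with AE_space show ?thesis by eventually_elim (auto simp: last_hist[OF n])
  qed
  then have "AE \<omega> in M. \<forall>y. Y n \<omega> = y \<longrightarrow> y \<in> top_sampled (tree n \<omega>) (X n \<omega>)"
    by (subst AE_all_countable) auto
  then show ?thesis by eventually_elim auto
qed

text \<open>The model prescribes only conditional laws, so the tree structure is available outside a
  null set and not at every \<open>\<omega>\<close>. This is why the combinatorial facts carry
  validity as a hypothesis.\<close>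

lemma AE_valid: "AE \<omega> in M. valid_attachment (\<lambda>k. Y k \<omega>)"
proof -
  have "AE \<omega> in M. n \<ge> 1 \<longrightarrow> Y n \<omega> \<in> {1..n + 1}" for n
  proof (cases "n \<ge> 1")
    case True
    from AE_top_sampled[OF True] AE_sample_subset[OF True] show ?thesis
      by eventually_elim (auto simp: top_sampled_def)
  qed auto
  then have "AE \<omega> in M. \<forall>n. n \<ge> 1 \<longrightarrow> Y n \<omega> \<in> {1..n + 1}" by (subst AE_all_countable) auto
  then show ?thesis by (auto simp: valid_attachment_def)
qed

end

section \<open>Vertex weights and the probability of being sampled\<close>

context mori_tree
begin

definition w where "w = 2 + \<beta>"
definition \<tau> :: "nat \<Rightarrow> real" where "\<tau> n = real n + \<beta> / w"

lemma w_gt_1: "w > 1" using beta by (simp add: w_def)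

lemma \<tau>_pos: "n \<ge> 1 \<Longrightarrow> \<tau> n > 0"
  and \<tau>_Suc: "\<tau> (Suc n) = \<tau> n + 1"
proof -
  have "\<beta> / w > -1" using beta w_gt_1 by (simp add: field_simps w_def)
  then show "n \<ge> 1 \<Longrightarrow> \<tau> n > 0" by (simp add: \<tau>_def)
qed (simp add: \<tau>_def)

lemma w_mult_\<tau>: "w * \<tau> n = w * real n + \<beta>"
  using w_gt_1 by (simp add: \<tau>_def algebra_simps)

definition weight :: "nat set set \<Rightarrow> nat \<Rightarrow> real" where
  "weight E v = real (vdegree E v) + \<beta>"

lemma mori_weight_eq:
  "v \<in> {1..n + 1} \<Longrightarrow> mori_weight \<beta> n E v = weight E v / \<tau> n / w"
  using w_mult_\<tau>[of n] by (simp add: mori_weight_def weight_def w_def mult.commute)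

lemma weight_ge: "n \<ge> 1 \<Longrightarrow> v \<in> {1..n + 1} \<Longrightarrow> weight (tree n \<omega>) v \<ge> 1 + \<beta>"
  using vdegree_pos[of n v "\<lambda>k. Y k \<omega>"] by (simp add: weight_def)

lemma weight_pos: "n \<ge> 1 \<Longrightarrow> v \<in> {1..n + 1} \<Longrightarrow> weight (tree n \<omega>) v > 0"
  using weight_ge[of n v \<omega>] beta by simp

lemma sum_weight:
  assumes "valid_attachment (\<lambda>k. Y k \<omega>)" "n \<ge> 1"
  shows "(\<Sum>v\<in>{1..n + 1}. weight (tree n \<omega>) v) = w * \<tau> n"
proof -
  have "(\<Sum>v\<in>{1..n + 1}. weight (tree n \<omega>) v) =
      real (\<Sum>v\<in>{1..n + 1}. vdegree (tree n \<omega>) v) + (real n + 1) * \<beta>"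
    by (simp add: weight_def sum.distrib)
  also have "\<dots> = w * \<tau> n"
    unfolding sum_vdegree[OF assms] w_mult_\<tau> by (simp add: w_def algebra_simps)
  finally show ?thesis .
qed

lemma weight_le:
  assumes "valid_attachment (\<lambda>k. Y k \<omega>)" "n \<ge> 1" "v \<in> {1..n + 1}"
  shows "weight (tree n \<omega>) v / \<tau> n \<le> w"
proof -
  have "weight (tree n \<omega>) v \<le> (\<Sum>v\<in>{1..n + 1}. weight (tree n \<omega>) v)"
    using assms weight_pos[of n _ \<omega>] by (intro member_le_sum) (auto simp: less_imp_le)
  then show ?thesis using sum_weight[OF assms(1,2)] \<tau>_pos[OF assms(2)] by (simp add: field_simps)
qed

lemma hist_sets: "{\<omega> \<in> space M. P (hist n \<omega>)} \<in> events"
  using measurable_sets[OF measurable_hist, of "{h. P h}" n] by (simp add: vimage_def Int_def conj_commute)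

lemma X_sets: "n \<ge> 1 \<Longrightarrow> {\<omega> \<in> space M. P (X n \<omega>)} \<in> events"
  using measurable_sets[OF measurable_X, of n "{h. P h}"] by (simp add: vimage_def Int_def conj_commute)

lemma hist_d_X_sets: "n \<ge> 1 \<Longrightarrow> {\<omega> \<in> space M. P (hist n \<omega>) (d n \<omega>) (X n \<omega>)} \<in> events"
  using measurable_sets[OF measurable_hist_d_X, of n "{(h, k, x). P h k x}"]
  by (simp add: vimage_def Int_def conj_commute)

lemma prob_d: "n \<ge> 1 \<Longrightarrow> prob {\<omega> \<in> space M. hist n \<omega> = h \<and> d n \<omega> = k} =
   prob {\<omega> \<in> space M. hist n \<omega> = h} * pmf D k"
proof -
  assume n: "n \<ge> 1"
  have "prob ({\<omega> \<in> space M. d n \<omega> = k} \<inter> {\<omega> \<in> space M. hist n \<omega> = h}) =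
      prob {\<omega> \<in> space M. d n \<omega> = k} * prob {\<omega> \<in> space M. hist n \<omega> = h}"
  proof (rule indep_setD[OF indep_d_history[OF n]])
    have "{\<omega> \<in> space M. d n \<omega> = k} = d n -` {k} \<inter> space M"
      "{\<omega> \<in> space M. hist n \<omega> = h} = hist n -` {h} \<inter> space M" by auto
    then show "{\<omega> \<in> space M. d n \<omega> = k} \<in> sets (sigma_of M (d n))"
      "{\<omega> \<in> space M. hist n \<omega> = h} \<in> sets (sigma_of M (hist n))"
      by (auto simp: sigma_of_def sets_vimage_algebra2)
  qed
  moreover have "prob {\<omega> \<in> space M. d n \<omega> = k} = pmf D k"
  proof -
    have "pmf D k = measure (distr M (count_space UNIV) (d n)) {k}"
      by (simp add: distr_d[OF n] measure_pmf_single)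
    also have "\<dots> = prob (d n -` {k} \<inter> space M)"
      by (rule measure_distr[OF measurable_d[OF n]]) simp
    also have "d n -` {k} \<inter> space M = {\<omega> \<in> space M. d n \<omega> = k}" by auto
    finally show ?thesis ..
  qed
  ultimately show ?thesis by (simp add: Int_def conj_ac mult.commute Collect_conj_eq[symmetric])
qed

lemma pmf_sums_expectation:
  fixes g :: "nat \<Rightarrow> real"
  assumes "integrable (measure_pmf D) g"
  shows "(\<lambda>k. pmf D k * g k) sums measure_pmf.expectation D g"
proof -
  have "integrable (count_space UNIV) (\<lambda>k. pmf D k * g k)"
    using assms unfolding measure_pmf_eq_density by (subst (asm) integrable_density) auto
  from sums_integral_count_space_nat[OF this] show ?thesis
    unfolding measure_pmf_eq_density by (subst integral_density) auto
qed

text \<open>Given the history and \<open>d n = k\<close>, the samples avoiding \<open>v\<close> have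
  total probability \<open>(1 - q) ^ k\<close> with \<open>q\<close> the sampling weight of
  \<open>v\<close>. Since \<open>d n\<close> is independent of the history, summing over
  \<open>k\<close> gives the expectation under \<open>D\<close>.\<close>

lemma prob_not_sampled:
  assumes n: "n \<ge> 1" and v: "v \<in> {1..n + 1}"
  shows "prob {\<omega> \<in> space M. hist n \<omega> = h \<and> v \<notin> set (X n \<omega>)} =
    prob {\<omega> \<in> space M. hist n \<omega> = h} *
    measure_pmf.expectation D (\<lambda>k. (1 - weight (last h) v / \<tau> n / w) ^ k)"
proof (cases "prob {\<omega> \<in> space M. hist n \<omega> = h} = 0")
  case True
  have "prob {\<omega> \<in> space M. hist n \<omega> = h \<and> v \<notin> set (X n \<omega>)} \<le> prob {\<omega> \<in> space M. hist n \<omega> = h}"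
    by (intro finite_measure_mono) auto
  then show ?thesis using True by (simp add: measure_le_0_iff)
next
  case False
  let ?q = "weight (last h) v / \<tau> n / w"
  \<comment> \<open>A history of positive probability is realised by some valid path. Only through
    such a path is \<open>last h\<close> known to be an attachment tree, whose sampling weights lie
    in [0, 1] and add up to 1.\<close>
  have "\<exists>\<omega>\<in>space M. valid_attachment (\<lambda>k. Y k \<omega>) \<and> hist n \<omega> = h"
  proof (rule ccontr)
    assume *: "\<not> ?thesis"
    from AE_valid AE_space have "AE \<omega> in M. \<omega> \<notin> {\<omega> \<in> space M. hist n \<omega> = h}"
      by eventually_elim (use * in auto)
    then show False using False by (subst (asm) prob_eq_0[symmetric]) auto
  qed
  then obtain \<omega>\<^sub>0 where \<omega>0: "valid_attachment (\<lambda>k. Y k \<omega>\<^sub>0)" "hist n \<omega>\<^sub>0 = h" by auto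
  have lh: "last h = tree n \<omega>\<^sub>0" using last_hist[OF n, of \<omega>\<^sub>0] \<omega>0 by simp
  have q: "0 \<le> ?q" "?q \<le> 1"
    using weight_le[OF \<omega>0(1) n v] weight_pos[OF n v, of \<omega>\<^sub>0] w_gt_1 \<tau>_pos[OF n]
    by (auto simp: lh field_simps)
  have "(\<Sum>x\<in>{1..n + 1}. mori_weight \<beta> n (last h) x) = (\<Sum>x\<in>{1..n + 1}. weight (last h) x) / \<tau> n / w"
    unfolding sum_divide_distrib by (intro sum.cong refl mori_weight_eq)
  also have "\<dots> = 1" unfolding lh sum_weight[OF \<omega>0(1) n] using w_gt_1 \<tau>_pos[OF n] by simp
  finally have sum1: "(\<Sum>x\<in>{1..n + 1}. mori_weight \<beta> n (last h) x) = 1" .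
  have sum2: "(\<Sum>x\<in>{1..n + 1} - {v}. mori_weight \<beta> n (last h) x) = 1 - ?q"
    by (subst sum_diff1) (simp_all only: finite_atLeastAtMost sum1 v if_True mori_weight_eq[OF v])
  have level: "prob {\<omega> \<in> space M. hist n \<omega> = h \<and> d n \<omega> = k \<and> v \<notin> set (X n \<omega>)} =
      prob {\<omega> \<in> space M. hist n \<omega> = h} * (pmf D k * (1 - ?q) ^ k)" for k
  proof -
    let ?L = "{xs. set xs \<subseteq> {1..n + 1} - {v} \<and> length xs = k}"
    have fin: "finite ?L" by (rule finite_lists_length_eq) simp
    have "prob {\<omega> \<in> space M. hist n \<omega> = h \<and> d n \<omega> = k \<and> v \<notin> set (X n \<omega>)} =
      prob (\<Union>xs\<in>?L. {\<omega> \<in> space M. hist n \<omega> = h \<and> d n \<omega> = k \<and> X n \<omega> = xs})"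
    proof (rule measure_eq_AE)
      show "AE \<omega> in M. (\<omega> \<in> {\<omega> \<in> space M. hist n \<omega> = h \<and> d n \<omega> = k \<and> v \<notin> set (X n \<omega>)}) =
        (\<omega> \<in> (\<Union>xs\<in>?L. {\<omega> \<in> space M. hist n \<omega> = h \<and> d n \<omega> = k \<and> X n \<omega> = xs}))"
        using AE_sample_subset[OF n] AE_space
        by eventually_elim (auto simp: length_X[OF n])
      show "{\<omega> \<in> space M. hist n \<omega> = h \<and> d n \<omega> = k \<and> v \<notin> set (X n \<omega>)} \<in> events"
        by (rule hist_d_X_sets[OF n, of "\<lambda>h' k' x. h' = h \<and> k' = k \<and> v \<notin> set x"])
    qed (intro sets.finite_UN[OF fin] hist_d_X_sets[OF n, of "\<lambda>h' k' x. h' = h \<and> k' = k \<and> x = _"])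
    also have "\<dots> = (\<Sum>xs\<in>?L. prob {\<omega> \<in> space M. hist n \<omega> = h \<and> d n \<omega> = k \<and> X n \<omega> = xs})"
      by (intro measure_finite_Union fin image_subsetI
            hist_d_X_sets[OF n, of "\<lambda>h' k' x. h' = h \<and> k' = k \<and> x = _"])
        (auto simp: disjoint_family_on_def)
    also have "\<dots> = (\<Sum>xs\<in>?L. prob {\<omega> \<in> space M. hist n \<omega> = h} * pmf D k *
        (\<Prod>x\<leftarrow>xs. mori_weight \<beta> n (last h) x))"
      by (intro sum.cong refl) (simp add: prob_sample[OF n] prob_d[OF n])
    also have "\<dots> = prob {\<omega> \<in> space M. hist n \<omega> = h} * pmf D k * (1 - ?q) ^ k"
      unfolding sum_distrib_left[symmetric] by (subst sum_prod_list_lists) (simp_all only: finite_Diff finite_atLeastAtMost sum2)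
    finally show ?thesis by simp
  qed
  have "(\<lambda>k. prob {\<omega> \<in> space M. hist n \<omega> = h \<and> d n \<omega> = k \<and> v \<notin> set (X n \<omega>)}) sums
      prob (\<Union>k. {\<omega> \<in> space M. hist n \<omega> = h \<and> d n \<omega> = k \<and> v \<notin> set (X n \<omega>)})"
    by (rule finite_measure_UNION)
      (auto simp: disjoint_family_on_def intro!: hist_d_X_sets[OF n, of "\<lambda>h' k' x. h' = h \<and> k' = _ \<and> v \<notin> set x"])
  also have "(\<Union>k. {\<omega> \<in> space M. hist n \<omega> = h \<and> d n \<omega> = k \<and> v \<notin> set (X n \<omega>)}) =
      {\<omega> \<in> space M. hist n \<omega> = h \<and> v \<notin> set (X n \<omega>)}" by auto
  finally have S1: "(\<lambda>k. prob {\<omega> \<in> space M. hist n \<omega> = h} * (pmf D k * (1 - ?q) ^ k)) sums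
      prob {\<omega> \<in> space M. hist n \<omega> = h \<and> v \<notin> set (X n \<omega>)}" by (simp only: level)
  have "integrable (measure_pmf D) (\<lambda>k. (1 - ?q) ^ k)"
    by (rule measure_pmf.integrable_const_bound[where B = 1]) (use q in \<open>auto intro!: power_le_one AE_pmfI\<close>)
  from sums_mult[OF pmf_sums_expectation[OF this], of "prob {\<omega> \<in> space M. hist n \<omega> = h}"]
  show ?thesis using sums_unique2[OF S1] by blast
qed

end

locale mori_tree_moments = mori_tree +
  assumes integrable_choose: "\<And>j. integrable (measure_pmf D) (\<lambda>k. real (k choose j))"

sublocale mori_tree_moments \<subseteq> L: sampling_law D w
  by unfold_locales (use w_gt_1 D_pos integrable_choose in auto)

context mori_tree_moments
begin

abbreviation r where "r \<equiv> sample_rate D w"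

text \<open>The probability that a vertex of weight \<open>z\<close> is among the vertices sampled from a tree with \<open>n\<close> edges.\<close>

definition hit :: "nat \<Rightarrow> real \<Rightarrow> real" where
  "hit n z = z / \<tau> n * r (z / \<tau> n)"

lemma prob_sampled:
  assumes n: "n \<ge> 1" and v: "v \<in> {1..n + 1}"
  shows "prob {\<omega> \<in> space M. hist n \<omega> = h \<and> v \<in> set (X n \<omega>)} =
    prob {\<omega> \<in> space M. hist n \<omega> = h} * hit n (weight (last h) v)"
proof (cases "\<exists>\<omega>\<in>space M. valid_attachment (\<lambda>k. Y k \<omega>) \<and> hist n \<omega> = h")
  case True
  then obtain \<omega>\<^sub>0 where \<omega>0: "valid_attachment (\<lambda>k. Y k \<omega>\<^sub>0)" "hist n \<omega>\<^sub>0 = h" by auto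
  have lh: "last h = tree n \<omega>\<^sub>0" using last_hist[OF n, of \<omega>\<^sub>0] \<omega>0 by simp
  let ?A = "{\<omega> \<in> space M. hist n \<omega> = h}"
  let ?B = "{\<omega> \<in> space M. hist n \<omega> = h \<and> v \<notin> set (X n \<omega>)}"
  have "?B \<in> events" by (rule hist_d_X_sets[OF n, of "\<lambda>h' k x. h' = h \<and> v \<notin> set x"])
  then have "prob (?A - ?B) = prob ?A - prob ?B"
    by (intro finite_measure_Diff[OF hist_sets[of "\<lambda>h'. h' = h" n]]) blast+
  also have "?A - ?B = {\<omega> \<in> space M. hist n \<omega> = h \<and> v \<in> set (X n \<omega>)}" by auto
  finally have "prob {\<omega> \<in> space M. hist n \<omega> = h \<and> v \<in> set (X n \<omega>)} =
      prob ?A - prob ?A * measure_pmf.expectation D (\<lambda>k. (1 - weight (last h) v / \<tau> n / w) ^ k)"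
    by (simp only: prob_not_sampled[OF n v])
  also have "measure_pmf.expectation D (\<lambda>k. (1 - weight (last h) v / \<tau> n / w) ^ k) =
      1 - hit n (weight (last h) v)"
    unfolding hit_def using weight_le[OF \<omega>0(1) n v] weight_pos[OF n v, of \<omega>\<^sub>0] \<tau>_pos[OF n]
    by (intro L.sampling_probability) (auto simp: lh)
  finally show ?thesis by (simp add: right_diff_distrib)
next
  case False
  from AE_valid have "AE \<omega> in M. \<omega> \<notin> {\<omega> \<in> space M. hist n \<omega> = h}"
    by eventually_elim (use False in auto)
  then have 0: "prob {\<omega> \<in> space M. hist n \<omega> = h} = 0" by (subst prob_eq_0) auto
  moreover have "prob {\<omega> \<in> space M. hist n \<omega> = h \<and> v \<in> set (X n \<omega>)} \<le> prob {\<omega> \<in> space M. hist n \<omega> = h}"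
    by (intro finite_measure_mono) auto
  ultimately show ?thesis by (simp add: measure_le_0_iff)
qed

end

subsection \<open>One step of the weights, and almost supermartingales\<close>

context mori_tree_moments
begin

text \<open>A finite set that almost surely contains the history. Finiteness makes every real
  function of the history integrable and turns its integral into a finite sum.\<close>

definition histories :: "nat \<Rightarrow> nat set set list set" where
  "histories n = {h. set h \<subseteq> Pow (Pow {1..n + 1}) \<and> length h = n}"

lemma finite_histories: "finite (histories n)"
  unfolding histories_def by (intro finite_lists_length_eq) simp

lemma hist_in_histories:
  assumes "valid_attachment (\<lambda>k. Y k \<omega>)"
  shows "hist n \<omega> \<in> histories n"
proof -
  have *: "tree k \<omega> \<subseteq> Pow {1..n + 1}" if "k \<le> n" for k
    using tree_edges_subset[OF assms, of _ k] that by fastforce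
  show ?thesis unfolding histories_def edge_history_def mem_Collect_eq set_map
    by (intro conjI image_subsetI PowI *) auto
qed

lemma AE_histories: "AE \<omega> in M. hist n \<omega> \<in> histories n"
  using AE_valid by eventually_elim (rule hist_in_histories)

lemma borel_measurable_hist: "(\<lambda>\<omega>. f (hist n \<omega>) :: real) \<in> borel_measurable M"
  using measurable_compose[OF measurable_hist, of f borel n] by simp

lemma integrable_hist: "integrable M (\<lambda>\<omega>. f (hist n \<omega>) :: real)"
proof (rule integrable_const_bound[where B = "Max ((\<lambda>h. norm (f h)) ` histories n)"])
  show "AE \<omega> in M. norm (f (hist n \<omega>)) \<le> Max ((\<lambda>h. norm (f h)) ` histories n)"
    using AE_histories by eventually_elim (auto intro!: Max_ge simp: finite_histories)
qed (rule borel_measurable_hist)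

lemma integrable_hist_indicator:
  assumes "B \<in> events"
  shows "integrable M (\<lambda>\<omega>. f (hist n \<omega>) * indicator B \<omega> :: real)"
  using integrable_mult_indicator[OF assms integrable_hist[of f n]] by (simp add: mult.commute)

text \<open>Conditioning on \<open>\<F>\<^sub>n\<close> amounts to a finite sum over the possible histories.\<close>

lemma integral_hist_indicator:
  assumes B: "B \<in> events"
  shows "(\<integral>\<omega>. f (hist n \<omega>) * indicator B \<omega> \<partial>M) =
    (\<Sum>h\<in>histories n. f h * prob {\<omega> \<in> space M. hist n \<omega> = h \<and> \<omega> \<in> B})"
proof -
  have ev: "{\<omega> \<in> space M. hist n \<omega> = h \<and> \<omega> \<in> B} \<in> events" for h
  proof -
    have "{\<omega> \<in> space M. hist n \<omega> = h \<and> \<omega> \<in> B} = {\<omega> \<in> space M. hist n \<omega> = h} \<inter> B"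
      using sets.sets_into_space[OF B] by auto
    then show ?thesis using hist_sets[of "\<lambda>h'. h' = h" n] B by simp
  qed
  have "(\<integral>\<omega>. f (hist n \<omega>) * indicator B \<omega> \<partial>M) =
    (\<integral>\<omega>. (\<Sum>h\<in>histories n. f h * indicator {\<omega> \<in> space M. hist n \<omega> = h \<and> \<omega> \<in> B} \<omega>) \<partial>M)"
  proof (rule integral_cong_AE)
    show "AE \<omega> in M. f (hist n \<omega>) * indicator B \<omega> =
      (\<Sum>h\<in>histories n. f h * indicator {\<omega> \<in> space M. hist n \<omega> = h \<and> \<omega> \<in> B} \<omega>)"
      using AE_histories[of n] AE_space
    proof eventually_elim
      case (elim \<omega>)
      have "(\<Sum>h\<in>histories n. f h * indicator {\<omega> \<in> space M. hist n \<omega> = h \<and> \<omega> \<in> B} \<omega>) =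
        (\<Sum>h\<in>histories n. if h = hist n \<omega> then f h * indicator B \<omega> else 0)"
        using elim by (intro sum.cong) (auto simp: indicator_def)
      also have "\<dots> = f (hist n \<omega>) * indicator B \<omega>"
        using elim finite_histories by simp
      finally show ?case ..
    qed
    show "(\<lambda>\<omega>. f (hist n \<omega>) * indicator B \<omega>) \<in> borel_measurable M"
      using integrable_hist_indicator[OF B] by (rule borel_measurable_integrable)
    show "(\<lambda>\<omega>. \<Sum>h\<in>histories n. f h * indicator {\<omega> \<in> space M. hist n \<omega> = h \<and> \<omega> \<in> B} \<omega>)
      \<in> borel_measurable M"
      by (intro borel_measurable_sum borel_measurable_times borel_measurable_const borel_measurable_indicator ev)
  qed
  also have "\<dots> = (\<Sum>h\<in>histories n. f h * prob {\<omega> \<in> space M. hist n \<omega> = h \<and> \<omega> \<in> B})"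
    using ev by (subst Bochner_Integration.integral_sum)
      (auto simp: integrable_indicator_iff less_top[symmetric] intro!: integrable_mult_right)
  finally show ?thesis .
qed

lemma integral_hist:
  "(\<integral>\<omega>. f (hist n \<omega>) \<partial>M) = (\<Sum>h\<in>histories n. f h * prob {\<omega> \<in> space M. hist n \<omega> = h})"
proof -
  have "(\<integral>\<omega>. f (hist n \<omega>) \<partial>M) = (\<integral>\<omega>. f (hist n \<omega>) * indicator (space M) \<omega> \<partial>M)"
    by (intro Bochner_Integration.integral_cong) auto
  also have "\<dots> = (\<Sum>h\<in>histories n. f h * prob {\<omega> \<in> space M. hist n \<omega> = h})"
    by (subst integral_hist_indicator) (auto intro!: sum.cong arg_cong[where f = prob])
  finally show ?thesis .
qed

text \<open>The vertex may depend on the history, so that both a fixed vertex and the currently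
  heaviest vertex are covered.\<close>

lemma integral_sampled:
  assumes n: "n \<ge> 1" and v: "\<And>h. v h \<in> {1..n + 1}"
  shows "(\<integral>\<omega>. f (hist n \<omega>) * indicator {\<omega> \<in> space M. v (hist n \<omega>) \<in> set (X n \<omega>)} \<omega> \<partial>M) =
    (\<integral>\<omega>. f (hist n \<omega>) * hit n (weight (tree n \<omega>) (v (hist n \<omega>))) \<partial>M)"
proof -
  have "{\<omega> \<in> space M. v (hist n \<omega>) \<in> set (X n \<omega>)} \<in> events"
    by (rule hist_d_X_sets[OF n, of "\<lambda>h k x. v h \<in> set x"])
  then have "(\<integral>\<omega>. f (hist n \<omega>) * indicator {\<omega> \<in> space M. v (hist n \<omega>) \<in> set (X n \<omega>)} \<omega> \<partial>M) =
    (\<Sum>h\<in>histories n. f h * prob {\<omega> \<in> space M. hist n \<omega> = h \<and> \<omega> \<in> {\<omega> \<in> space M. v (hist n \<omega>) \<in> set (X n \<omega>)}})"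
    by (rule integral_hist_indicator)
  also have "\<dots> = (\<Sum>h\<in>histories n. f h * prob {\<omega> \<in> space M. hist n \<omega> = h \<and> v h \<in> set (X n \<omega>)})"
    by (intro sum.cong refl arg_cong2[where f = "(*)"] arg_cong[where f = prob]) auto
  also have "\<dots> = (\<Sum>h\<in>histories n. f h * hit n (weight (last h) (v h)) * prob {\<omega> \<in> space M. hist n \<omega> = h})"
    by (intro sum.cong refl) (simp only: prob_sampled[OF n v] mult_ac)
  also have "\<dots> = (\<integral>\<omega>. f (hist n \<omega>) * hit n (weight (last (hist n \<omega>)) (v (hist n \<omega>))) \<partial>M)"
    by (rule integral_hist[symmetric])
  finally show ?thesis by (simp only: last_hist[OF n])
qed

lemma borel_measurable_tree: "(\<lambda>\<omega>. f (tree n \<omega>) :: real) \<in> borel_measurable M"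
proof (cases "n \<ge> 1")
  case True
  then show ?thesis using borel_measurable_hist[of "\<lambda>h. f (last h)" n] by (simp add: last_hist)
next
  case False
  then have "n = 0" by simp
  then show ?thesis by simp
qed

lemma integrable_hist_tree:
  assumes "n \<ge> 1"
  shows "integrable M (\<lambda>\<omega>. f (hist n \<omega>) * g (tree n \<omega>) :: real)"
  using integrable_hist[of "\<lambda>h. f h * g (last h)" n] by (simp add: last_hist[OF assms])

lemma integrable_tree: "n \<ge> 1 \<Longrightarrow> integrable M (\<lambda>\<omega>. g (tree n \<omega>) :: real)"
  using integrable_hist_tree[of n "\<lambda>_. 1" g] by simp

lemma hist_Suc: "n \<ge> 1 \<Longrightarrow> butlast (hist (Suc n) \<omega>) = hist n \<omega>"
  by (simp add: edge_history_def butlast_append)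

lemma integrable_hist_tree_Suc:
  assumes "n \<ge> 1"
  shows "integrable M (\<lambda>\<omega>. f (hist n \<omega>) * g (tree (Suc n) \<omega>) :: real)"
  using integrable_hist[of "\<lambda>h. f (butlast h) * g (last h)" "Suc n"]
  by (simp add: last_hist hist_Suc[OF assms])

definition max_weight :: "nat \<Rightarrow> 'a \<Rightarrow> real" where
  "max_weight n \<omega> = real (max_degree (\<lambda>k. Y k \<omega>) n) + \<beta>"

text \<open>The maximal weight as a function of \<open>n\<close> and the edge set alone, the form
  that the integrability lemmas and \<open>almost_supermartingale_bounded\<close> accept.\<close>

definition top_weight :: "nat \<Rightarrow> nat set set \<Rightarrow> real" where
  "top_weight n E = real (Max ((\<lambda>v. vdegree E v) ` {1..n + 1})) + \<beta>"

lemma max_weight_eq: "max_weight n \<omega> = top_weight n (tree n \<omega>)"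
  by (simp add: max_weight_def top_weight_def max_degree_def)

lemma weight_Suc:
  assumes "valid_attachment (\<lambda>k. Y k \<omega>)" "n \<ge> 1" "v \<in> {1..n + 1}"
  shows "weight (tree (Suc n) \<omega>) v = weight (tree n \<omega>) v + of_bool (Y n \<omega> = v)"
  using vdegree_tree_edges_Suc[OF assms(1,2), of v] assms(3) by (auto simp: weight_def)

lemma weight_new:
  assumes "valid_attachment (\<lambda>k. Y k \<omega>)" "n \<ge> 1"
  shows "weight (tree (Suc n) \<omega>) (n + 2) = 1 + \<beta>"
  using vdegree_tree_edges_Suc[OF assms, of "n + 2"] vdegree_fresh[OF assms(1), of n "n + 2"]
  by (simp add: weight_def)

text \<open>The chosen vertex is one of the sampled ones and the increments of \<open>F\<close> are
  nonnegative, so replacing "chosen" by "sampled" only enlarges the sum. The new vertex contributes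
  \<open>F (1 + \<beta>)\<close>. Testing against nonnegative \<open>f\<close> of the history
  expresses the inequality conditionally on the past.\<close>

lemma sum_weights_step:
  fixes F :: "real \<Rightarrow> real"
  assumes n: "n \<ge> 1" and mono: "\<And>z. z > 0 \<Longrightarrow> F z \<le> F (z + 1)" and f: "\<And>h. f h \<ge> 0"
  shows "(\<integral>\<omega>. f (hist n \<omega>) * (\<Sum>v\<in>{1..n + 2}. F (weight (tree (Suc n) \<omega>) v)) \<partial>M)
    \<le> (\<integral>\<omega>. f (hist n \<omega>) * (F (1 + \<beta>) + (\<Sum>v\<in>{1..n + 1}. F (weight (tree n \<omega>) v) +
         hit n (weight (tree n \<omega>) v) * (F (weight (tree n \<omega>) v + 1) - F (weight (tree n \<omega>) v)))) \<partial>M)"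
proof -
  let ?W = "\<lambda>\<omega> v. weight (tree n \<omega>) v"
  let ?\<Delta> = "\<lambda>\<omega> v. F (?W \<omega> v + 1) - F (?W \<omega> v)"
  let ?S = "\<lambda>v. {\<omega> \<in> space M. v \<in> set (X n \<omega>)}"
  have S: "?S v \<in> events" for v by (rule X_sets[OF n])
  have i1: "integrable M (\<lambda>\<omega>. f (hist n \<omega>) * (F (1 + \<beta>) + (\<Sum>v\<in>{1..n + 1}. F (?W \<omega> v))))"
    by (rule integrable_hist_tree[OF n])
  have i2: "integrable M (\<lambda>\<omega>. f (hist n \<omega>) * ?\<Delta> \<omega> v * indicator (?S v) \<omega>)" for v
    using integrable_hist_indicator[OF S, of "\<lambda>h. f h * (F (weight (last h) v + 1) - F (weight (last h) v))" n]
    by (simp add: last_hist[OF n])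
  have "(\<integral>\<omega>. f (hist n \<omega>) * (\<Sum>v\<in>{1..n + 2}. F (weight (tree (Suc n) \<omega>) v)) \<partial>M)
    \<le> (\<integral>\<omega>. f (hist n \<omega>) * (F (1 + \<beta>) + (\<Sum>v\<in>{1..n + 1}. F (?W \<omega> v))) +
        (\<Sum>v\<in>{1..n + 1}. f (hist n \<omega>) * ?\<Delta> \<omega> v * indicator (?S v) \<omega>) \<partial>M)"
  proof (rule integral_mono_AE)
    show "integrable M (\<lambda>\<omega>. f (hist n \<omega>) * (\<Sum>v\<in>{1..n + 2}. F (weight (tree (Suc n) \<omega>) v)))"
      by (rule integrable_hist_tree_Suc[OF n])
    show "integrable M (\<lambda>\<omega>. f (hist n \<omega>) * (F (1 + \<beta>) + (\<Sum>v\<in>{1..n + 1}. F (?W \<omega> v))) +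
        (\<Sum>v\<in>{1..n + 1}. f (hist n \<omega>) * ?\<Delta> \<omega> v * indicator (?S v) \<omega>))"
      by (intro Bochner_Integration.integrable_add i1 Bochner_Integration.integrable_sum i2)
    show "AE \<omega> in M. f (hist n \<omega>) * (\<Sum>v\<in>{1..n + 2}. F (weight (tree (Suc n) \<omega>) v))
      \<le> f (hist n \<omega>) * (F (1 + \<beta>) + (\<Sum>v\<in>{1..n + 1}. F (?W \<omega> v))) +
        (\<Sum>v\<in>{1..n + 1}. f (hist n \<omega>) * ?\<Delta> \<omega> v * indicator (?S v) \<omega>)"
      using AE_valid AE_top_sampled[OF n] AE_space
    proof eventually_elim
      case (elim \<omega>)
      have "(\<Sum>v\<in>{1..n + 2}. F (weight (tree (Suc n) \<omega>) v)) =
          F (1 + \<beta>) + (\<Sum>v\<in>{1..n + 1}. F (weight (tree (Suc n) \<omega>) v))"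
        using weight_new[OF elim(1) n] by simp
      also have "(\<Sum>v\<in>{1..n + 1}. F (weight (tree (Suc n) \<omega>) v)) \<le>
          (\<Sum>v\<in>{1..n + 1}. F (?W \<omega> v) + ?\<Delta> \<omega> v * indicator (?S v) \<omega>)"
      proof (rule sum_mono)
        fix v assume v: "v \<in> {1..n + 1}"
        show "F (weight (tree (Suc n) \<omega>) v) \<le> F (?W \<omega> v) + ?\<Delta> \<omega> v * indicator (?S v) \<omega>"
          using weight_Suc[OF elim(1) n v] elim mono[OF weight_pos[OF n v, of \<omega>]]
          by (auto simp: indicator_def top_sampled_def)
      qed
      finally have "(\<Sum>v\<in>{1..n + 2}. F (weight (tree (Suc n) \<omega>) v)) \<le>
          F (1 + \<beta>) + (\<Sum>v\<in>{1..n + 1}. F (?W \<omega> v)) + (\<Sum>v\<in>{1..n + 1}. ?\<Delta> \<omega> v * indicator (?S v) \<omega>)"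
        by (simp only: sum.distrib) simp
      from mult_left_mono[OF this f] show ?case
        by (simp only: distrib_left sum_distrib_left mult.assoc)
    qed
  qed
  also have "\<dots> = (\<integral>\<omega>. f (hist n \<omega>) * (F (1 + \<beta>) + (\<Sum>v\<in>{1..n + 1}. F (?W \<omega> v))) \<partial>M) +
        (\<Sum>v\<in>{1..n + 1}. \<integral>\<omega>. f (hist n \<omega>) * ?\<Delta> \<omega> v * indicator (?S v) \<omega> \<partial>M)"
    by (simp only: Bochner_Integration.integral_add[OF i1 Bochner_Integration.integrable_sum[OF i2]]
        Bochner_Integration.integral_sum[OF i2])
  also have "(\<Sum>v\<in>{1..n + 1}. \<integral>\<omega>. f (hist n \<omega>) * ?\<Delta> \<omega> v * indicator (?S v) \<omega> \<partial>M) =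
      (\<Sum>v\<in>{1..n + 1}. \<integral>\<omega>. f (hist n \<omega>) * (?\<Delta> \<omega> v * hit n (?W \<omega> v)) \<partial>M)"
  proof (rule sum.cong[OF refl])
    fix v assume "v \<in> {1..n + 1}"
    from integral_sampled[OF n this, of "\<lambda>h. f h * (F (weight (last h) v + 1) - F (weight (last h) v))"]
    show "(\<integral>\<omega>. f (hist n \<omega>) * ?\<Delta> \<omega> v * indicator (?S v) \<omega> \<partial>M) =
      (\<integral>\<omega>. f (hist n \<omega>) * (?\<Delta> \<omega> v * hit n (?W \<omega> v)) \<partial>M)"
      by (simp add: last_hist[OF n] mult.assoc)
  qed
  also have "(\<integral>\<omega>. f (hist n \<omega>) * (F (1 + \<beta>) + (\<Sum>v\<in>{1..n + 1}. F (?W \<omega> v))) \<partial>M) + \<dots> =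
    (\<integral>\<omega>. f (hist n \<omega>) * (F (1 + \<beta>) + (\<Sum>v\<in>{1..n + 1}. F (?W \<omega> v))) +
        (\<Sum>v\<in>{1..n + 1}. f (hist n \<omega>) * (?\<Delta> \<omega> v * hit n (?W \<omega> v))) \<partial>M)"
  proof -
    have i3: "integrable M (\<lambda>\<omega>. f (hist n \<omega>) * (?\<Delta> \<omega> v * hit n (?W \<omega> v)))" for v
      by (rule integrable_hist_tree[OF n])
    show ?thesis
      by (simp only: Bochner_Integration.integral_add[OF i1 Bochner_Integration.integrable_sum[OF i3]]
          Bochner_Integration.integral_sum[OF i3])
  qed
  also have "\<dots> = (\<integral>\<omega>. f (hist n \<omega>) * (F (1 + \<beta>) + (\<Sum>v\<in>{1..n + 1}. F (?W \<omega> v) +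
         hit n (?W \<omega> v) * ?\<Delta> \<omega> v)) \<partial>M)"
    by (simp only: sum.distrib sum_distrib_left[symmetric] distrib_left[symmetric] mult.commute add.assoc)
  finally show ?thesis .
qed

text \<open>If one designated heaviest vertex is sampled, then the winner has the same degree, even
  if a tie elects another vertex, and the maximum grows by 1. For decreasing \<open>F\<close> this
  one-sided information gives an upper bound.\<close>

lemma max_weight_step:
  fixes F :: "real \<Rightarrow> real"
  assumes n: "n \<ge> 1" and anti: "\<And>y z. 0 < y \<Longrightarrow> y \<le> z \<Longrightarrow> F z \<le> F y" and f: "\<And>h. f h \<ge> 0"
  shows "(\<integral>\<omega>. f (hist n \<omega>) * F (max_weight (Suc n) \<omega>) \<partial>M)
    \<le> (\<integral>\<omega>. f (hist n \<omega>) * (F (max_weight n \<omega>) +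
         hit n (max_weight n \<omega>) * (F (max_weight n \<omega> + 1) - F (max_weight n \<omega>))) \<partial>M)"
proof -
  \<comment> \<open>Fixing the heaviest vertex as a function of the history allows
    \<open>integral_sampled\<close> to supply its sampling probability.\<close>
  define v where "v h = (SOME v. v \<in> {1..n + 1} \<and> weight (last h) v = top_weight n (last h))" for h
  have v: "v h \<in> {1..n + 1} \<and> weight (last h) (v h) = top_weight n (last h)" for h
    unfolding v_def
  proof (rule someI_ex)
    have "Max ((\<lambda>i. vdegree (last h) i) ` {1..n + 1}) \<in> (\<lambda>i. vdegree (last h) i) ` {1..n + 1}"
      by (intro Max_in) auto
    then show "\<exists>v. v \<in> {1..n + 1} \<and> weight (last h) v = top_weight n (last h)"
      unfolding weight_def top_weight_def by (metis imageE)
  qed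
  let ?Z = "max_weight n"
  let ?S = "{\<omega> \<in> space M. v (hist n \<omega>) \<in> set (X n \<omega>)}"
  let ?\<Delta> = "\<lambda>\<omega>. F (?Z \<omega> + 1) - F (?Z \<omega>)"
  have S: "?S \<in> events" by (rule hist_d_X_sets[OF n, of "\<lambda>h k x. v h \<in> set x"])
  have i1: "integrable M (\<lambda>\<omega>. f (hist n \<omega>) * F (?Z \<omega>))"
    unfolding max_weight_eq by (rule integrable_hist_tree[OF n])
  have i2: "integrable M (\<lambda>\<omega>. f (hist n \<omega>) * ?\<Delta> \<omega> * indicator ?S \<omega>)"
    using integrable_hist_indicator[OF S, of "\<lambda>h. f h * (F (top_weight n (last h) + 1) - F (top_weight n (last h)))" n]
    by (simp add: last_hist[OF n] max_weight_eq)
  have i3: "integrable M (\<lambda>\<omega>. f (hist n \<omega>) * (hit n (?Z \<omega>) * ?\<Delta> \<omega>))"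
    unfolding max_weight_eq by (rule integrable_hist_tree[OF n])
  have "(\<integral>\<omega>. f (hist n \<omega>) * F (max_weight (Suc n) \<omega>) \<partial>M) \<le>
      (\<integral>\<omega>. f (hist n \<omega>) * F (?Z \<omega>) + f (hist n \<omega>) * ?\<Delta> \<omega> * indicator ?S \<omega> \<partial>M)"
  proof (rule integral_mono_AE)
    show "integrable M (\<lambda>\<omega>. f (hist n \<omega>) * F (max_weight (Suc n) \<omega>))"
      unfolding max_weight_eq by (rule integrable_hist_tree_Suc[OF n])
    show "AE \<omega> in M. f (hist n \<omega>) * F (max_weight (Suc n) \<omega>)
        \<le> f (hist n \<omega>) * F (?Z \<omega>) + f (hist n \<omega>) * ?\<Delta> \<omega> * indicator ?S \<omega>"
      using AE_valid AE_top_sampled[OF n] AE_sample_subset[OF n] AE_space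
    proof eventually_elim
      case (elim \<omega>)
      let ?v = "v (hist n \<omega>)"
      have wv: "?v \<in> {1..n + 1}" "weight (tree n \<omega>) ?v = ?Z \<omega>"
        using v[of "hist n \<omega>"] by (auto simp: last_hist[OF n] max_weight_eq)
      have pos: "?Z \<omega> > 0" using weight_pos[OF n wv(1), of \<omega>] wv(2) by simp
      have ge: "max_weight (Suc n) \<omega> \<ge> weight (tree (Suc n) \<omega>) x" if "x \<in> {1..n + 1}" for x
        using max_degree_ge[of x "Suc n" "\<lambda>k. Y k \<omega>"] that by (auto simp: max_weight_def weight_def)
      have "F (max_weight (Suc n) \<omega>) \<le> F (?Z \<omega>) + ?\<Delta> \<omega> * indicator ?S \<omega>"
      proof (cases "?v \<in> set (X n \<omega>)")
        case True
        have y: "Y n \<omega> \<in> {1..n + 1}" "weight (tree n \<omega>) (Y n \<omega>) \<ge> weight (tree n \<omega>) ?v"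
          using elim True by (auto simp: top_sampled_def weight_def)
        then have "max_weight (Suc n) \<omega> \<ge> ?Z \<omega> + 1"
          using ge[OF y(1)] weight_Suc[OF elim(1) n y(1)] wv by simp
        then have "F (max_weight (Suc n) \<omega>) \<le> F (?Z \<omega> + 1)" using pos by (intro anti) auto
        then show ?thesis using True elim by simp
      next
        case False
        have "max_weight (Suc n) \<omega> \<ge> ?Z \<omega>"
          using ge[OF wv(1)] weight_Suc[OF elim(1) n wv(1)] wv
          by (cases "Y n \<omega> = ?v") auto
        then show ?thesis using False pos by (auto intro!: anti)
      qed
      from mult_left_mono[OF this f] show ?case by (simp only: distrib_left mult.assoc)
    qed
  qed (intro Bochner_Integration.integrable_add i1 i2)
  also have "\<dots> = (\<integral>\<omega>. f (hist n \<omega>) * F (?Z \<omega>) \<partial>M) + (\<integral>\<omega>. f (hist n \<omega>) * ?\<Delta> \<omega> * indicator ?S \<omega> \<partial>M)"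
    by (rule Bochner_Integration.integral_add[OF i1 i2])
  also have "(\<integral>\<omega>. f (hist n \<omega>) * ?\<Delta> \<omega> * indicator ?S \<omega> \<partial>M) =
      (\<integral>\<omega>. f (hist n \<omega>) * (hit n (?Z \<omega>) * ?\<Delta> \<omega>) \<partial>M)"
    using integral_sampled[OF n, of v "\<lambda>h. f h * (F (top_weight n (last h) + 1) - F (top_weight n (last h)))"]
      v[of "hist n _"] v
    by (simp add: last_hist[OF n] max_weight_eq mult.assoc mult.commute[of "hit n _"])
  also have "(\<integral>\<omega>. f (hist n \<omega>) * F (?Z \<omega>) \<partial>M) + (\<integral>\<omega>. f (hist n \<omega>) * (hit n (?Z \<omega>) * ?\<Delta> \<omega>) \<partial>M) =
      (\<integral>\<omega>. f (hist n \<omega>) * (F (?Z \<omega>) + hit n (?Z \<omega>) * ?\<Delta> \<omega>) \<partial>M)"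
    by (simp only: Bochner_Integration.integral_add[OF i1 i3, symmetric] distrib_left)
  finally show ?thesis .
qed


text \<open>The proof is the maximal inequality, with \<open>W n\<close> the process stopped on reaching level \<open>b\<close>.\<close>

lemma almost_supermartingale_bounded:
  fixes s :: "nat \<Rightarrow> nat set set \<Rightarrow> real" and c :: "nat \<Rightarrow> real"
  assumes n0: "n0 \<ge> 1" and s_nonneg: "\<And>n E. s n E \<ge> 0"
    and c: "summable c" "\<And>n. c n \<ge> 0"
    and step: "\<And>n f. n \<ge> n0 \<Longrightarrow> (\<And>h. 0 \<le> f h \<and> f h \<le> 1) \<Longrightarrow>
      (\<integral>\<omega>. f (hist n \<omega>) * s (Suc n) (tree (Suc n) \<omega>) \<partial>M)
        \<le> (\<integral>\<omega>. f (hist n \<omega>) * s n (tree n \<omega>) \<partial>M) + c n"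
  shows "AE \<omega> in M. \<exists>B. \<forall>n\<ge>n0. s n (tree n \<omega>) \<le> B"
proof -
  define K where "K = (\<integral>\<omega>. s n0 (tree n0 \<omega>) \<partial>M) + suminf c"
  have maximal: "prob {\<omega> \<in> space M. \<exists>k\<in>{n0..n}. s k (tree k \<omega>) \<ge> b} \<le> K / b"
    if "b > 0" "n \<ge> n0" for b n
  proof -
    \<comment> \<open>The indicator that level \<open>b\<close> has not been reached up to time
      \<open>n\<close>, written as a function of the history. Index \<open>k - 1\<close> is used
      because the list starts with the edge set of time 1.\<close>
    define f where "f n h = (of_bool (\<forall>k\<in>{n0..n}. s k (h ! (k - 1)) < b) :: real)" for n h
    have f: "f n (hist n \<omega>) = of_bool (\<forall>k\<in>{n0..n}. s k (tree k \<omega>) < b)" for n \<omega>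
      unfolding f_def using n0
      by (intro arg_cong[where f = of_bool] ball_cong refl) (subst nth_hist, auto)
    have f01: "0 \<le> f n h \<and> f n h \<le> 1" for n h by (simp add: f_def)
    \<comment> \<open>After the crossing, \<open>W\<close> takes the value \<open>b\<close> itself
      and not the possibly larger value at which \<open>s\<close> crossed. Crossing therefore never
      increases \<open>W\<close> beyond \<open>s\<close>, and \<open>W\<close> dominates
      \<open>b\<close> times the indicator of having crossed.\<close>
    define W where "W n \<omega> = b * (1 - f n (hist n \<omega>)) + f n (hist n \<omega>) * s n (tree n \<omega>)" for n \<omega>
    have i1: "integrable M (\<lambda>\<omega>. b * (1 - f n (hist n \<omega>)))" for n
      by (rule integrable_hist[of "\<lambda>h. b * (1 - f n h)"])
    have i2: "integrable M (\<lambda>\<omega>. f n (hist n \<omega>) * s n (tree n \<omega>))" if "n \<ge> n0" for n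
      using n0 that by (intro integrable_hist_tree) auto
    have i3: "integrable M (\<lambda>\<omega>. f n (hist n \<omega>) * s (Suc n) (tree (Suc n) \<omega>))" if "n \<ge> n0" for n
      using n0 that by (intro integrable_hist_tree_Suc) auto
    have iW: "integrable M (W n)" if "n \<ge> n0" for n
      unfolding W_def using i1 i2[OF that] by (rule Bochner_Integration.integrable_add)
    have "(\<integral>\<omega>. W n \<omega> \<partial>M) \<le> (\<integral>\<omega>. s n0 (tree n0 \<omega>) \<partial>M) + sum c {n0..<n}"
      using \<open>n \<ge> n0\<close>
    proof (induction n rule: nat_induct_at_least)
      case base
      have "(\<integral>\<omega>. W n0 \<omega> \<partial>M) \<le> (\<integral>\<omega>. s n0 (tree n0 \<omega>) \<partial>M)"
        by (intro integral_mono iW integrable_tree n0) (auto simp: W_def f not_less)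
      then show ?case by simp
    next
      case (Suc n)
      have "W (Suc n) \<omega> \<le> b * (1 - f n (hist n \<omega>)) + f n (hist n \<omega>) * s (Suc n) (tree (Suc n) \<omega>)" for \<omega>
      proof -
        have eq: "(\<forall>k\<in>{n0..Suc n}. s k (tree k \<omega>) < b) \<longleftrightarrow>
           (\<forall>k\<in>{n0..n}. s k (tree k \<omega>) < b) \<and> s (Suc n) (tree (Suc n) \<omega>) < b"
          using Suc(1) by (auto simp: le_Suc_eq)
        show ?thesis unfolding W_def f eq
          by (cases "\<forall>k\<in>{n0..n}. s k (tree k \<omega>) < b"; cases "s (Suc n) (tree (Suc n) \<omega>) < b") simp_all
      qed
      then have "(\<integral>\<omega>. W (Suc n) \<omega> \<partial>M) \<le>
          (\<integral>\<omega>. b * (1 - f n (hist n \<omega>)) + f n (hist n \<omega>) * s (Suc n) (tree (Suc n) \<omega>) \<partial>M)"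
        using Suc(1) by (intro integral_mono iW Bochner_Integration.integrable_add i1 i3) auto
      also have "\<dots> = (\<integral>\<omega>. b * (1 - f n (hist n \<omega>)) \<partial>M) + (\<integral>\<omega>. f n (hist n \<omega>) * s (Suc n) (tree (Suc n) \<omega>) \<partial>M)"
        by (rule Bochner_Integration.integral_add[OF i1 i3[OF Suc(1)]])
      also have "\<dots> \<le> (\<integral>\<omega>. b * (1 - f n (hist n \<omega>)) \<partial>M) + ((\<integral>\<omega>. f n (hist n \<omega>) * s n (tree n \<omega>) \<partial>M) + c n)"
        by (intro add_left_mono step Suc(1) f01)
      also have "\<dots> = (\<integral>\<omega>. W n \<omega> \<partial>M) + c n"
        unfolding W_def by (subst Bochner_Integration.integral_add[OF i1 i2[OF Suc(1)]]) simp
      finally show ?case using Suc by simp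
    qed
    also have "\<dots> \<le> K"
      using sum_le_suminf[OF c(1), of "{n0..<n}"] c(2) by (simp add: K_def)
    finally have W_le: "(\<integral>\<omega>. W n \<omega> \<partial>M) \<le> K" .
    let ?A = "{\<omega> \<in> space M. \<exists>k\<in>{n0..n}. s k (tree k \<omega>) \<ge> b}"
    have "?A = {\<omega> \<in> space M. f n (hist n \<omega>) = 0}" by (auto simp: f not_less)
    then have A: "?A \<in> events" using hist_sets[of "\<lambda>h. f n h = 0" n] by simp
    have "b * prob ?A = (\<integral>\<omega>. b * indicator ?A \<omega> \<partial>M)" using A by simp
    also have "\<dots> \<le> (\<integral>\<omega>. W n \<omega> \<partial>M)"
    proof (intro integral_mono iW \<open>n \<ge> n0\<close> integrable_mult_right)
      fix \<omega> assume "\<omega> \<in> space M"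
      then show "b * indicator ?A \<omega> \<le> W n \<omega>"
        using s_nonneg[of n "tree n \<omega>"] unfolding W_def f
        by (cases "\<forall>k\<in>{n0..n}. s k (tree k \<omega>) < b") (auto simp: indicator_def not_less)
    qed (use A in \<open>auto simp: integrable_indicator_iff less_top[symmetric]\<close>)
    finally show ?thesis using W_le \<open>b > 0\<close> by (simp add: field_simps)
  qed
  have ev: "{\<omega> \<in> space M. \<exists>k\<in>{n0..n}. s k (tree k \<omega>) \<ge> b} \<in> events" for n b
  proof -
    have "{\<omega> \<in> space M. s k (tree k \<omega>) \<ge> b} \<in> events" for k
      using borel_measurable_le[OF borel_measurable_const borel_measurable_tree[of "s k" k], of b] by simp
    then show ?thesis by (intro sets.sets_Collect_finite_Ex) auto
  qed
  define U where "U b = (\<Union>n. {\<omega> \<in> space M. \<exists>k\<in>{n0..n}. s k (tree k \<omega>) \<ge> b})" for b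
  have U_ev: "U b \<in> events" for b unfolding U_def using ev by (intro sets.countable_UN) auto
  have U_le: "prob (U b) \<le> K / b" if "b > 0" for b
  proof (rule LIMSEQ_le_const2)
    show "(\<lambda>n. prob {\<omega> \<in> space M. \<exists>k\<in>{n0..n}. s k (tree k \<omega>) \<ge> b}) \<longlonglongrightarrow> prob (U b)"
      unfolding U_def
    proof (rule finite_Lim_measure_incseq)
      show "incseq (\<lambda>n. {\<omega> \<in> space M. \<exists>k\<in>{n0..n}. s k (tree k \<omega>) \<ge> b})"
        by (rule incseq_SucI) force
    qed (use ev in blast)
    show "\<exists>N. \<forall>n\<ge>N. prob {\<omega> \<in> space M. \<exists>k\<in>{n0..n}. s k (tree k \<omega>) \<ge> b} \<le> K / b"
      using maximal[OF that] by blast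
  qed
  \<comment> \<open>A path on which \<open>s\<close> is unbounded reaches every level, so it lies in
    this intersection, and \<open>K / b\<close> tends to 0 as the level grows.\<close>
  have "prob (\<Inter>m. U (real (Suc m))) \<le> 0"
  proof (rule LIMSEQ_le_const)
    show "(\<lambda>m. K / real (Suc m)) \<longlonglongrightarrow> 0"
      by (rule LIMSEQ_Suc[OF lim_const_over_n])
    show "\<exists>N. \<forall>m\<ge>N. prob (\<Inter>m. U (real (Suc m))) \<le> K / real (Suc m)"
    proof (intro exI allI impI)
      fix m
      have "prob (\<Inter>m. U (real (Suc m))) \<le> prob (U (real (Suc m)))"
        by (intro finite_measure_mono U_ev) auto
      also have "\<dots> \<le> K / real (Suc m)" by (rule U_le) simp
      finally show "prob (\<Inter>m. U (real (Suc m))) \<le> K / real (Suc m)" .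
    qed
  qed
  then have "prob (\<Inter>m. U (real (Suc m))) = 0" using measure_nonneg[of M] by (simp add: antisym)
  moreover have "(\<Inter>m. U (real (Suc m))) \<in> events" using U_ev by (intro sets.countable_INT) auto
  ultimately have "AE \<omega> in M. \<omega> \<notin> (\<Inter>m. U (real (Suc m)))" by (simp add: prob_eq_0)
  with AE_space show ?thesis
  proof eventually_elim
    case (elim \<omega>)
    then obtain m where m: "\<omega> \<notin> U (real (Suc m))" by auto
    have "s n (tree n \<omega>) \<le> real (Suc m)" if "n \<ge> n0" for n
    proof (rule ccontr)
      assume "\<not> s n (tree n \<omega>) \<le> real (Suc m)"
      then have "\<exists>k\<in>{n0..n}. s k (tree k \<omega>) \<ge> real (Suc m)"
        using that by (intro bexI[of _ n]) auto
      with m elim(1) show False unfolding U_def by blast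
    qed
    then show ?case by (intro exI[of _ "real (Suc m)"]) blast
  qed
qed

end

subsection \<open>Upper bounds for the maximal weight\<close>

lemma max_square_add_le:
  fixes A h :: real
  shows "(max 0 (A + h))\<^sup>2 \<le> (max 0 A)\<^sup>2 + 2 * max 0 A * h + h\<^sup>2"
proof -
  have "(max 0 (A + h))\<^sup>2 \<le> (max 0 A + h)\<^sup>2"
  proof (cases "A + h \<le> 0")
    case False
    then show ?thesis by (intro power_mono) auto
  qed (simp add: max_absorb1)
  then show ?thesis by (simp add: power2_sum)
qed

text \<open>
  One step at time \<open>t\<close> of a weight \<open>u * t\<close> that grows by \<open>1\<close> with probability \<open>u * q\<close>, while the threshold
  for the relative weight \<open>u\<close> moves from \<open>x\<close> to \<open>x'\<close>.
\<close>

lemma truncated_square_drift_above: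
  fixes u x x' \<sigma> t q :: real
  assumes "t > 0" "u \<ge> 0" "x > 0" "q \<ge> 0" "x \<le> u \<Longrightarrow> q \<le> 1 - \<sigma>" "\<sigma> \<le> 1"
    and x': "(1 - \<sigma> / (t + 1)) * x \<le> x'"
  shows "(max 0 (u * t / (t + 1) - x'))\<^sup>2 + u * q * ((max 0 ((u * t + 1) / (t + 1) - x'))\<^sup>2 -
      (max 0 (u * t / (t + 1) - x'))\<^sup>2)
    \<le> ((1 - \<sigma> / (t + 1)) * max 0 (u - x))\<^sup>2 + u * q / (t + 1)\<^sup>2"
proof -
  define h where "h = 1 / (t + 1)"
  define A where "A = u * t / (t + 1) - x'"
  have h: "0 < h" "h < 1" using assms by (auto simp: h_def)
  have A: "A = u - u * h - x'" using assms by (simp add: A_def h_def field_simps)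
  have Ah: "(u * t + 1) / (t + 1) - x' = A + h" by (simp add: A_def h_def add_divide_distrib)
  have p: "u * q \<ge> 0" using assms by simp
  have x'h: "(1 - \<sigma> * h) * x \<le> x'" using x' by (simp add: h_def)
  have "(max 0 A)\<^sup>2 + u * q * ((max 0 (A + h))\<^sup>2 - (max 0 A)\<^sup>2)
      \<le> (max 0 A)\<^sup>2 + u * q * (2 * max 0 A * h + h\<^sup>2)"
    using max_square_add_le[of A h] h p by (intro add_left_mono mult_left_mono) auto
  also have "\<dots> = (max 0 A)\<^sup>2 + 2 * max 0 A * (u * q * h) + u * q * h\<^sup>2"
    by (simp add: algebra_simps)
  \<comment> \<open>\<open>A + u * q * h\<close> is the mean excess after one step. Completing the
    square bounds the left side by the square of this mean, and the drift bound
    \<open>q \<le> 1 - \<sigma>\<close> bounds the mean by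
    \<open>(1 - \<sigma> * h) * (u - x)\<close>.\<close>
  also have "(max 0 A)\<^sup>2 + 2 * max 0 A * (u * q * h) \<le> ((1 - \<sigma> * h) * max 0 (u - x))\<^sup>2"
  proof (cases "A \<le> 0")
    case True
    then show ?thesis by (simp add: max_def)
  next
    case False
    \<comment> \<open>A vertex below the threshold that does not grow shrinks by the factor
      \<open>1 - h\<close>, and the threshold keeps at least the factor
      \<open>1 - \<sigma> * h\<close>; as \<open>\<sigma> \<le> 1\<close>, it cannot end above the
      threshold.\<close>
    have ux: "x \<le> u"
    proof (rule ccontr)
      assume "\<not> x \<le> u"
      then have "u * (1 - h) \<le> x * (1 - h)" using h by (intro mult_right_mono) auto
      also have "\<dots> \<le> x * (1 - \<sigma> * h)" using assms h by (intro mult_left_mono) auto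
      also have "\<dots> \<le> x'" using x'h by (simp add: mult.commute)
      finally show False using False by (simp add: A algebra_simps)
    qed
    have "u * q \<le> u * (1 - \<sigma>)" using assms ux by (intro mult_left_mono) auto
    then have "u * q * h \<le> u * (1 - \<sigma>) * h" using h by (intro mult_right_mono) auto
    then have "A + u * q * h \<le> (1 - \<sigma> * h) * (u - x)"
      using x'h by (simp add: A algebra_simps)
    moreover have "0 \<le> u * q * h" using p h by simp
    ultimately have "(A + u * q * h)\<^sup>2 \<le> ((1 - \<sigma> * h) * (u - x))\<^sup>2"
      using False by (intro power_mono) auto
    moreover have "A\<^sup>2 + 2 * A * (u * q * h) \<le> (A + u * q * h)\<^sup>2"
      by (simp add: power2_sum)
    ultimately show ?thesis using False ux by simp
  qed
  finally show ?thesis by (simp add: Ah A_def[symmetric] h_def power_divide)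
qed

context mori_tree_moments
begin

lemma hit_ge: "n \<ge> 1 \<Longrightarrow> 0 \<le> z \<Longrightarrow> z / \<tau> n \<le> w \<Longrightarrow> hit n z \<ge> z / \<tau> n / w"
  using L.rate_ge[of "z / \<tau> n"] \<tau>_pos[of n] mult_left_mono[of "1 / w" "r (z / \<tau> n)" "z / \<tau> n"]
  by (simp add: hit_def)

lemma hit_le: "n \<ge> 1 \<Longrightarrow> 0 \<le> z \<Longrightarrow> z / \<tau> n \<le> w \<Longrightarrow> hit n z \<le> z / \<tau> n * (L.mean / w)"
  using L.rate_le[of "z / \<tau> n"] \<tau>_pos[of n] unfolding hit_def by (intro mult_left_mono) auto

lemma hit_le_1:
  assumes "n \<ge> 1" "0 \<le> z" "z / \<tau> n \<le> w"
  shows "hit n z \<le> 1"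
proof -
  have "0 \<le> z / \<tau> n" using assms \<tau>_pos[of n] by simp
  then have "0 \<le> measure_pmf.expectation D (\<lambda>k. (1 - z / \<tau> n / w) ^ k)"
  proof -
    have "z / \<tau> n / w \<le> 1" using assms(3) w_gt_1 by (subst pos_divide_le_eq) auto
    then show ?thesis by (intro Bochner_Integration.integral_nonneg zero_le_power) simp
  qed
  then show ?thesis
    using L.sampling_probability[of "z / \<tau> n"] assms \<open>0 \<le> z / \<tau> n\<close> by (simp add: hit_def)
qed

lemma weight_le_max:
  "v \<in> {1..n + 1} \<Longrightarrow> weight (tree n \<omega>) v \<le> max_weight n \<omega>"
  using max_degree_ge[of v n "\<lambda>k. Y k \<omega>"] by (simp add: weight_def max_weight_def)

lemma max_weight_attained:
  obtains v where "v \<in> {1..n + 1}" "weight (tree n \<omega>) v = max_weight n \<omega>"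
  using max_degree_attained[of n "\<lambda>k. Y k \<omega>"] by (auto simp: weight_def max_weight_def)

lemma max_weight_ge: "n \<ge> 1 \<Longrightarrow> max_weight n \<omega> \<ge> 1 + \<beta>"
  using weight_ge[of n 1 \<omega>] weight_le_max[of 1 n \<omega>] by simp

lemma max_weight_pos: "n \<ge> 1 \<Longrightarrow> max_weight n \<omega> > 0"
  using max_weight_ge[of n \<omega>] beta by simp

lemma max_weight_le:
  assumes "valid_attachment (\<lambda>k. Y k \<omega>)" "n \<ge> 1"
  shows "max_weight n \<omega> / \<tau> n \<le> w"
proof -
  obtain v where "v \<in> {1..n + 1}" "weight (tree n \<omega>) v = max_weight n \<omega>"
    by (rule max_weight_attained)
  then show ?thesis using weight_le[OF assms, of v] by simp
qed

text \<open>The error allowed per vertex is proportional to its relative weight. Since the relative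
  weights sum to \<open>w\<close>, all vertices together cost only \<open>b n * w\<close>, however
  many there are, and the heaviest one is controlled because its potential is a summand of the
  total.\<close>

lemma sum_potential_bounded:
  fixes F :: "nat \<Rightarrow> real \<Rightarrow> real" and b c :: "nat \<Rightarrow> real"
  assumes n0: "n0 \<ge> 1" and F_nonneg: "\<And>n z. F n z \<ge> 0" 
    and F_mono: "\<And>n z. n \<ge> n0 \<Longrightarrow> z > 0 \<Longrightarrow> F n z \<le> F n (z + 1)"
    and c: "summable c" "\<And>n. c n \<ge> 0"
    and step: "\<And>n z. n \<ge> n0 \<Longrightarrow> z > 0 \<Longrightarrow> z / \<tau> n \<le> w \<Longrightarrow>
        F (Suc n) z + hit n z * (F (Suc n) (z + 1) - F (Suc n) z) \<le> F n z + b n * (z / \<tau> n)"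
    and c_ge: "\<And>n. n \<ge> n0 \<Longrightarrow> F (Suc n) (1 + \<beta>) + b n * w \<le> c n"
  shows "AE \<omega> in M. \<exists>B. \<forall>n\<ge>n0. F n (max_weight n \<omega>) \<le> B"
proof -
  define s where "s n E = (\<Sum>v\<in>{1..n + 1}. F n (weight E v))" for n E
  have "AE \<omega> in M. \<exists>B. \<forall>n\<ge>n0. s n (tree n \<omega>) \<le> B"
  proof (rule almost_supermartingale_bounded[OF n0 _ c])
    show "s n E \<ge> 0" for n E unfolding s_def by (intro sum_nonneg F_nonneg)
    fix n and f :: "nat set set list \<Rightarrow> real"
    assume n: "n \<ge> n0" and f: "\<And>h. 0 \<le> f h \<and> f h \<le> 1"
    have n1: "n \<ge> 1" using n n0 by simp
    have "(\<integral>\<omega>. f (hist n \<omega>) * s (Suc n) (tree (Suc n) \<omega>) \<partial>M)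
      \<le> (\<integral>\<omega>. f (hist n \<omega>) * (F (Suc n) (1 + \<beta>) + (\<Sum>v\<in>{1..n + 1}. F (Suc n) (weight (tree n \<omega>) v) +
         hit n (weight (tree n \<omega>) v) *
           (F (Suc n) (weight (tree n \<omega>) v + 1) - F (Suc n) (weight (tree n \<omega>) v)))) \<partial>M)"
      using sum_weights_step[OF n1, of "F (Suc n)" f] F_mono[of "Suc n"] n f by (simp add: s_def)
    also have "\<dots> \<le> (\<integral>\<omega>. f (hist n \<omega>) * s n (tree n \<omega>) + c n \<partial>M)"
    proof (rule integral_mono_AE)
      show "AE \<omega> in M. f (hist n \<omega>) * (F (Suc n) (1 + \<beta>) + (\<Sum>v\<in>{1..n + 1}. F (Suc n) (weight (tree n \<omega>) v) +
         hit n (weight (tree n \<omega>) v) *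
           (F (Suc n) (weight (tree n \<omega>) v + 1) - F (Suc n) (weight (tree n \<omega>) v))))
         \<le> f (hist n \<omega>) * s n (tree n \<omega>) + c n"
        using AE_valid
      proof eventually_elim
        case (elim \<omega>)
        let ?W = "weight (tree n \<omega>)"
        have "(\<Sum>v\<in>{1..n + 1}. F (Suc n) (?W v) + hit n (?W v) * (F (Suc n) (?W v + 1) - F (Suc n) (?W v)))
          \<le> (\<Sum>v\<in>{1..n + 1}. F n (?W v) + b n * (?W v / \<tau> n))"
          by (intro sum_mono step n weight_pos n1 weight_le elim)
        also have "\<dots> = s n (tree n \<omega>) + b n * w"
          using sum_weight[OF elim n1] \<tau>_pos[OF n1]
          by (simp only: sum.distrib s_def sum_distrib_left[symmetric] sum_divide_distrib[symmetric]) simp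
        finally have "F (Suc n) (1 + \<beta>) + (\<Sum>v\<in>{1..n + 1}. F (Suc n) (?W v) +
            hit n (?W v) * (F (Suc n) (?W v + 1) - F (Suc n) (?W v))) \<le> s n (tree n \<omega>) + c n"
          using c_ge[OF n] by linarith
        then have "f (hist n \<omega>) * (F (Suc n) (1 + \<beta>) + (\<Sum>v\<in>{1..n + 1}. F (Suc n) (?W v) +
            hit n (?W v) * (F (Suc n) (?W v + 1) - F (Suc n) (?W v))))
            \<le> f (hist n \<omega>) * (s n (tree n \<omega>) + c n)"
          using f by (intro mult_left_mono) auto
        also have "\<dots> \<le> f (hist n \<omega>) * s n (tree n \<omega>) + c n"
          using mult_right_mono[of "f (hist n \<omega>)" 1 "c n"] f c(2)[of n] by (simp add: distrib_left)
        finally show ?case .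
      qed
    qed (intro Bochner_Integration.integrable_add integrable_hist_tree n1 integrable_const)+
    also have "\<dots> = (\<integral>\<omega>. f (hist n \<omega>) * s n (tree n \<omega>) \<partial>M) + c n"
      by (subst Bochner_Integration.integral_add) (auto intro!: integrable_hist_tree n1 simp: prob_space)
    finally show "(\<integral>\<omega>. f (hist n \<omega>) * s (Suc n) (tree (Suc n) \<omega>) \<partial>M)
        \<le> (\<integral>\<omega>. f (hist n \<omega>) * s n (tree n \<omega>) \<partial>M) + c n" .
  qed
  then show ?thesis
  proof eventually_elim
    case (elim \<omega>)
    then obtain B where B: "\<And>n. n \<ge> n0 \<Longrightarrow> s n (tree n \<omega>) \<le> B" by auto
    have "F n (max_weight n \<omega>) \<le> B" if "n \<ge> n0" for n
    proof -
      obtain v where v: "v \<in> {1..n + 1}" "weight (tree n \<omega>) v = max_weight n \<omega>"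
        by (rule max_weight_attained)
      have "F n (weight (tree n \<omega>) v) \<le> s n (tree n \<omega>)"
        unfolding s_def using v(1) F_nonneg by (intro member_le_sum) auto
      then show ?thesis using B[OF that] v(2) by simp
    qed
    then show ?case by blast
  qed
qed

text \<open>The potential is the squared excess over \<open>x\<close>, in units of
  \<open>\<rho>\<close>. Both sequences decay no faster than the contraction at the threshold;
  vertices above \<open>x\<close> contract at least as strongly because \<open>r\<close> decreases.
  By \<open>new\<close>, an entering vertex lies below the threshold and contributes
  nothing.\<close>

lemma max_weight_upper:
  fixes x \<rho> :: "nat \<Rightarrow> real"
  assumes n0: "n0 \<ge> 1"
    and x: "\<And>n. n \<ge> n0 \<Longrightarrow> 0 < x n" and \<rho>: "\<And>n. n \<ge> n0 \<Longrightarrow> 0 < \<rho> n"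
    and x_step: "\<And>n. n \<ge> n0 \<Longrightarrow> (1 - (1 - r (x n)) / (\<tau> n + 1)) * x n \<le> x (Suc n)"
    and \<rho>_step: "\<And>n. n \<ge> n0 \<Longrightarrow> (1 - (1 - r (x n)) / (\<tau> n + 1)) * \<rho> n \<le> \<rho> (Suc n)"
    and x_le: "\<And>n. n \<ge> n0 \<Longrightarrow> x n \<le> w"
    and new: "\<And>n. n \<ge> n0 \<Longrightarrow> (1 + \<beta>) / (\<tau> n + 1) \<le> x (Suc n)"
    and summable: "summable (\<lambda>n. 1 / (\<rho> (Suc n) * (\<tau> n + 1))\<^sup>2)"
  shows "AE \<omega> in M. \<exists>B. \<forall>n\<ge>n0. max_weight n \<omega> / \<tau> n \<le> x n + B * \<rho> n"
proof -
  define F where "F n z = (max 0 (z / \<tau> n - x n) / \<rho> n)\<^sup>2" for n z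
  define b where "b n = L.mean / w / (\<rho> (Suc n) * (\<tau> n + 1))\<^sup>2" for n
  have mean0: "L.mean \<ge> 0" by (simp add: L.mean_def)
  have "AE \<omega> in M. \<exists>B. \<forall>n\<ge>n0. F n (max_weight n \<omega>) \<le> B"
  proof (rule sum_potential_bounded[OF n0, where b = b and c = "\<lambda>n. b n * w"])
    show "summable (\<lambda>n. b n * w)"
      using summable_mult[OF summable, of "L.mean"] w_gt_1 by (simp add: b_def)
    show "b n * w \<ge> 0" for n using mean0 w_gt_1 by (simp add: b_def)
    show "F n z \<ge> 0" for n z by (simp add: F_def)
    show "F n z \<le> F n (z + 1)" if "n \<ge> n0" "z > 0" for n z
      unfolding F_def using \<rho>[OF that(1)] \<tau>_pos[of n] that n0
      by (intro power_mono divide_right_mono max.mono diff_right_mono) auto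
    show "F (Suc n) (1 + \<beta>) + b n * w \<le> b n * w" if "n \<ge> n0" for n
      using new[OF that] by (simp add: F_def \<tau>_Suc)
  next
    fix n z assume n: "n \<ge> n0" and z: "z > 0" "z / \<tau> n \<le> w"
    have t: "\<tau> n > 0" using \<tau>_pos n n0 by simp
    define u where "u = z / \<tau> n"
    have zu: "z = u * \<tau> n" using t by (simp add: u_def)
    have u: "u > 0" using t z by (simp add: u_def)
    have uw: "u \<le> w" using z by (simp add: u_def)
    define k where "k = 1 - (1 - r (x n)) / (\<tau> n + 1)"
    have rx: "0 \<le> r (x n)" "r (x n) \<ge> 1 / w"
      using L.rate_ge[of "x n"] x[OF n] x_le[OF n] w_gt_1 order_trans[of 0 "1 / w" "r (x n)"] by auto
    have ru: "0 \<le> r u" "r u \<le> L.mean / w" 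
      using L.rate_ge[of u] L.rate_le[of u] u uw w_gt_1 order_trans[of 0 "1 / w" "r u"] by auto
    have k0: "k \<ge> 0" unfolding k_def using t rx(1) by (simp add: field_simps)
    have drift: "(max 0 (u * \<tau> n / (\<tau> n + 1) - x (Suc n)))\<^sup>2 +
        u * r u * ((max 0 ((u * \<tau> n + 1) / (\<tau> n + 1) - x (Suc n)))\<^sup>2 -
          (max 0 (u * \<tau> n / (\<tau> n + 1) - x (Suc n)))\<^sup>2)
      \<le> (k * max 0 (u - x n))\<^sup>2 + u * r u / (\<tau> n + 1)\<^sup>2"
      unfolding k_def using x[OF n] t u ru uw x_step[OF n] rx L.rate_antimono[of "x n" u]
      by (intro truncated_square_drift_above) auto
    have "F (Suc n) z + hit n z * (F (Suc n) (z + 1) - F (Suc n) z) =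
      ((max 0 (u * \<tau> n / (\<tau> n + 1) - x (Suc n)))\<^sup>2 +
        u * r u * ((max 0 ((u * \<tau> n + 1) / (\<tau> n + 1) - x (Suc n)))\<^sup>2 -
          (max 0 (u * \<tau> n / (\<tau> n + 1) - x (Suc n)))\<^sup>2)) / (\<rho> (Suc n))\<^sup>2"
      using t by (simp add: F_def hit_def zu \<tau>_Suc power_divide add_divide_distrib
          right_diff_distrib diff_divide_distrib)
    also have "\<dots> \<le> ((k * max 0 (u - x n))\<^sup>2 + u * r u / (\<tau> n + 1)\<^sup>2) / (\<rho> (Suc n))\<^sup>2"
      by (intro divide_right_mono drift) simp
    also have "\<dots> = (k * max 0 (u - x n))\<^sup>2 / (\<rho> (Suc n))\<^sup>2 + u * r u / (\<tau> n + 1)\<^sup>2 / (\<rho> (Suc n))\<^sup>2"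
      by (rule add_divide_distrib)
    also have "(k * max 0 (u - x n))\<^sup>2 / (\<rho> (Suc n))\<^sup>2 \<le> F n z"
    proof -
      have "k * max 0 (u - x n) / \<rho> (Suc n) \<le> max 0 (u - x n) / \<rho> n"
      proof -
        have "k * \<rho> n * max 0 (u - x n) \<le> \<rho> (Suc n) * max 0 (u - x n)"
          using \<rho>_step[OF n] by (intro mult_right_mono) (auto simp: k_def)
        then show ?thesis using \<rho>[OF n] \<rho>[of "Suc n"] n by (simp add: field_simps)
      qed
      then have "(k * max 0 (u - x n) / \<rho> (Suc n))\<^sup>2 \<le> (max 0 (u - x n) / \<rho> n)\<^sup>2"
        using k0 \<rho>[of "Suc n"] n by (intro power_mono) (auto intro!: divide_nonneg_pos mult_nonneg_nonneg)
      then show ?thesis by (simp add: F_def u_def power_divide)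
    qed
    also have "u * r u / (\<tau> n + 1)\<^sup>2 / (\<rho> (Suc n))\<^sup>2 \<le> b n * (z / \<tau> n)"
    proof -
      have "u * r u / (\<rho> (Suc n) * (\<tau> n + 1))\<^sup>2 \<le> u * (L.mean / w) / (\<rho> (Suc n) * (\<tau> n + 1))\<^sup>2"
        using ru u by (intro divide_right_mono mult_left_mono) auto
      moreover have "b n * (z / \<tau> n) = u * (L.mean / w) / (\<rho> (Suc n) * (\<tau> n + 1))\<^sup>2"
        by (simp add: b_def u_def mult_ac)
      moreover have "u * r u / (\<tau> n + 1)\<^sup>2 / (\<rho> (Suc n))\<^sup>2 = u * r u / (\<rho> (Suc n) * (\<tau> n + 1))\<^sup>2"
        by (simp add: power_mult_distrib)
      ultimately show ?thesis by (simp only:)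
    qed
    finally show "F (Suc n) z + hit n z * (F (Suc n) (z + 1) - F (Suc n) z) \<le> F n z + b n * (z / \<tau> n)"
      by simp
  qed
  then show ?thesis
  proof eventually_elim
    case (elim \<omega>)
    then obtain B where B: "\<And>n. n \<ge> n0 \<Longrightarrow> F n (max_weight n \<omega>) \<le> B" by auto
    have "max_weight n \<omega> / \<tau> n \<le> x n + sqrt B * \<rho> n" if n: "n \<ge> n0" for n
    proof -
      have "max 0 (max_weight n \<omega> / \<tau> n - x n) / \<rho> n \<le> sqrt B"
        using B[OF n] by (intro real_le_rsqrt) (simp add: F_def)
      then show ?thesis using \<rho>[OF n] by (simp add: field_simps max_def split: if_splits)
    qed
    then show ?case by blast
  qed
qed

end

subsection \<open>Lower bounds for the maximal weight\<close>

lemma powr_le_affine: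
  fixes x s :: real
  assumes "x > 0" "0 \<le> s" "s \<le> 1"
  shows "x powr s \<le> 1 + s * (x - 1)"
  using Youngs_inequality_0[of s "1 - s" x 1] assms by (simp add: algebra_simps)

lemma affine_le_powr:
  fixes t \<alpha> :: real
  assumes "t \<ge> 0" "\<alpha> \<ge> 1"
  shows "1 + \<alpha> * t \<le> (1 + t) powr \<alpha>"
proof -
  have pos: "1 + \<alpha> * t > 0" using assms by (simp add: add_pos_nonneg)
  have "(1 + \<alpha> * t) powr (1 / \<alpha>) \<le> 1 + t"
    using powr_le_affine[OF pos, of "1 / \<alpha>"] assms by simp
  then have "((1 + \<alpha> * t) powr (1 / \<alpha>)) powr \<alpha> \<le> (1 + t) powr \<alpha>"
    using assms by (intro powr_mono2) auto
  then show ?thesis using assms pos by (simp add: powr_powr)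
qed

text \<open>Both squares are expanded about the mean \<open>m\<close> of a variable with values
  \<open>A\<close> and \<open>B\<close>. The first-order terms cancel, and the variance
  \<open>p * (1 - p) * (B - A)\<^sup>2\<close> remains.\<close>

lemma max_square_average_le:
  fixes A B p :: real
  assumes "0 \<le> p" "p \<le> 1"
  shows "(max 0 A)\<^sup>2 + p * ((max 0 B)\<^sup>2 - (max 0 A)\<^sup>2)
    \<le> (max 0 (A + p * (B - A)))\<^sup>2 + p * (B - A)\<^sup>2"
proof -
  define m where "m = A + p * (B - A)"
  have "(1 - p) * (max 0 A)\<^sup>2 \<le> (1 - p) * ((max 0 m)\<^sup>2 + 2 * max 0 m * (A - m) + (A - m)\<^sup>2)"
    using max_square_add_le[of m "A - m"] assms by (intro mult_left_mono) auto
  moreover have "p * (max 0 B)\<^sup>2 \<le> p * ((max 0 m)\<^sup>2 + 2 * max 0 m * (B - m) + (B - m)\<^sup>2)"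
    using max_square_add_le[of m "B - m"] assms by (intro mult_left_mono) auto
  moreover have "(1 - p) * ((max 0 m)\<^sup>2 + 2 * max 0 m * (A - m) + (A - m)\<^sup>2) +
      p * ((max 0 m)\<^sup>2 + 2 * max 0 m * (B - m) + (B - m)\<^sup>2) =
      (max 0 m)\<^sup>2 + p * (1 - p) * (B - A)\<^sup>2"
    by (simp add: m_def algebra_simps power2_eq_square)
  moreover have "p * (1 - p) * (B - A)\<^sup>2 \<le> p * (B - A)\<^sup>2"
    using assms by (intro mult_right_mono) (auto simp: mult_left_le)
  ultimately show ?thesis by (simp add: m_def algebra_simps)
qed

text \<open>The analogue for a weight \<open>z\<close>, with \<open>B'\<close> the new threshold for the power \<open>-s\<close> of the relative weight.\<close>

lemma truncated_square_drift_below: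
  fixes z t s x a L q \<sigma> B' :: real
  defines "u \<equiv> z / t" and "c \<equiv> 1 + s * \<sigma> / t"
  assumes t: "t \<ge> 1" and s: "0 < s" "s \<le> 1" and z: "z \<ge> z\<^sub>0" "z\<^sub>0 > 0" and x: "x > 0"
    and q: "0 \<le> q" "q \<le> a" "u * q \<le> 1" and \<sigma>: "\<sigma> \<le> 1" and c: "c \<ge> 1 / 2"
    and below: "u \<le> x \<Longrightarrow> 1 - q \<le> \<sigma>" and above: "x \<le> u \<Longrightarrow> 1 - q \<le> \<sigma> + L * (u - x)"
    and L: "2 * L * u \<le> t" and B': "c * x powr -s \<le> B'"
  shows "(max 0 (((t + 1) / z) powr s - B'))\<^sup>2 + u * q * ((max 0 (((t + 1) / (z + 1)) powr s - B'))\<^sup>2 -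
      (max 0 (((t + 1) / z) powr s - B'))\<^sup>2)
    \<le> (c * max 0 ((t / z) powr s - x powr -s))\<^sup>2 + (8 * a + a\<^sup>2 / z\<^sub>0) * ((t / z) powr s)\<^sup>2 / (z * t)"
proof -
  define G where "G = (t / z) powr s"
  define G0 where "G0 = ((t + 1) / z) powr s"
  define y where "y = (z / (z + 1)) powr s"
  have zp: "z > 0" using z by simp
  have u: "u > 0" using t zp by (simp add: u_def)
  have a: "a \<ge> 0" using q by simp
  have G: "G > 0" using t zp by (simp add: G_def)
  have "(t + 1) / z = t / z * (1 + 1 / t)" using t zp by (simp add: field_simps)
  then have G0_eq: "G0 = G * (1 + 1 / t) powr s"
    unfolding G0_def G_def by (simp only: powr_mult)
  have "(1 + 1 / t) powr s \<le> 1 + s * (1 / t)"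
    using powr_le_affine[of "1 + 1 / t" s] t s by (simp add: add_pos_pos)
  then have G0_le: "G0 \<le> G * (1 + s / t)" using G by (simp add: G0_eq)
  have "s / t \<le> 1" using s t by simp
  then have "G * (1 + s / t) \<le> G * 2" using G by (intro mult_left_mono) auto
  then have G0_2: "G0 \<le> 2 * G" using G0_le by simp
  have G0: "G0 \<ge> 0" by (simp add: G0_def)
  have G1: "((t + 1) / (z + 1)) powr s = G0 * y"
    using t zp by (simp add: G0_def y_def powr_mult[symmetric])
  have "y \<le> 1 + s * (z / (z + 1) - 1)"
    unfolding y_def using zp s by (intro powr_le_affine) auto
  moreover have "z / (z + 1) - 1 = - (1 / (z + 1))" using zp by (simp add: field_simps)
  ultimately have y_le: "1 - y \<ge> s / (z + 1)" by simp
  have "y \<ge> (z / (z + 1)) powr 1"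
    unfolding y_def using zp s by (intro powr_mono') auto
  then have "y \<ge> z / (z + 1)" using zp by simp
  moreover have "1 - z / (z + 1) \<le> 1 / z" using zp by (simp add: field_simps)
  ultimately have y_ge: "1 - y \<le> 1 / z" by simp
  have y1: "0 \<le> 1 - y" using y_le s zp order_trans[of 0 "s / (z + 1)" "1 - y"] by simp
  have uq: "u * q \<ge> 0" using u q by simp

  define e where "e = a * G / (z * t)"
  have e: "e \<ge> 0" using a G zp t by (simp add: e_def)
  \<comment> \<open>Passing from \<open>t\<close> to \<open>t + 1\<close> raises the power by the
    factor \<open>1 + s / t\<close>. Growth of the weight removes about
    \<open>u * q * s / z = s * q / t\<close>, leaving the drift \<open>s * (1 - q) / t\<close>. The
    error \<open>e\<close> comes from having \<open>z + 1\<close> in place of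
    \<open>z\<close>.\<close>
  have mean: "G0 + u * q * (G0 * y - G0) \<le> G * (1 + s * (1 - q) / t) + e"
  proof -
    have "G0 + u * q * (G0 * y - G0) = G0 * (1 - u * q * (1 - y))" by (simp add: algebra_simps)
    also have "\<dots> \<le> G * (1 + s / t) * (1 - u * q * (1 - y))"
    proof -
      have "u * q * (1 - y) \<le> 1 * 1"
        using uq q y1 by (intro mult_mono) (auto simp: y_def)
      then show ?thesis using G0_le by (intro mult_right_mono) auto
    qed
    also have "\<dots> \<le> G * (1 + s / t) * (1 - u * q * (s / (z + 1)))"
      using G s t y_le uq by (intro mult_left_mono diff_left_mono) auto
    also have "\<dots> = G * ((1 + s / t) * (1 - u * q * (s / (z + 1))))" by simp
    also have "\<dots> \<le> G * (1 + s * (1 - q) / t + a / (z * t))"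
    proof (rule mult_left_mono)
      have 1: "u * q * (s / (z + 1)) = s * q / t - s * q / t / (z + 1)"
      proof -
        have "u * q * (s / (z + 1)) = s * q / t * (z / (z + 1))" by (simp add: u_def mult_ac)
        also have "z / (z + 1) = 1 - 1 / (z + 1)" using zp by (simp add: field_simps)
        finally show ?thesis by (simp add: right_diff_distrib)
      qed
      have "0 \<le> s / t * (u * q * (s / (z + 1)))" using uq s t zp by simp
      then have "(1 + s / t) * (1 - u * q * (s / (z + 1))) \<le> 1 + s / t - u * q * (s / (z + 1))"
        by (simp only: distrib_right right_diff_distrib mult_1_left mult_1_right)
      also have "\<dots> = 1 + s * (1 - q) / t + s * q / t / (z + 1)"
        unfolding 1 by (simp add: right_diff_distrib diff_divide_distrib)
      also have "s * q / t / (z + 1) \<le> a / t / z"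
      proof (rule frac_le)
        have "s * q \<le> 1 * a" using s q by (intro mult_mono) auto
        then show "s * q / t \<le> a / t" using t by (simp add: divide_right_mono)
        show "0 \<le> a / t" using a t by simp
      qed (use zp in auto)
      finally show "(1 + s / t) * (1 - u * q * (s / (z + 1))) \<le> 1 + s * (1 - q) / t + a / (z * t)"
        by (simp add: mult.commute)
    qed (use G in auto)
    finally show ?thesis by (simp add: e_def distrib_left mult.commute)
  qed
  define y0 where "y0 = max 0 (G - x powr -s)"
  have y0: "0 \<le> y0" "y0 \<le> G" using G by (auto simp: y0_def)
  \<comment> \<open>For \<open>u \<le> x\<close> the drift is at most \<open>\<sigma>\<close>. For
    \<open>u > x\<close> put \<open>\<epsilon> = s * (1 - x / u)\<close>: \<open>G\<close> lies
    below \<open>x powr -s\<close> by the factor \<open>1 - \<epsilon>\<close>, while the bound on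
    \<open>L\<close> limits the additional drift to the factor \<open>1 + \<epsilon>\<close>. Their
    product is at most 1, so the left side is not positive.\<close>
  have dich: "G * (1 + s * (1 - q) / t) - c * x powr -s \<le> c * y0"
  proof (cases "u \<le> x")
    case True
    have "1 + s * (1 - q) / t \<le> c"
      unfolding c_def using below[OF True] s t by (intro add_left_mono divide_right_mono mult_left_mono) auto
    then have "G * (1 + s * (1 - q) / t) \<le> G * c" using G by (intro mult_left_mono) auto
    then have "G * (1 + s * (1 - q) / t) - c * x powr -s \<le> c * (G - x powr -s)"
      by (simp add: algebra_simps)
    also have "\<dots> \<le> c * y0" using c by (intro mult_left_mono) (auto simp: y0_def)
    finally show ?thesis .
  next
    case False
    have G_eq: "G = x powr -s * (x / u) powr s"
      using u x zp t by (simp add: G_def u_def powr_divide powr_minus powr_mult field_simps)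
    define \<epsilon> where "\<epsilon> = s * (1 - x / u)"
    have \<epsilon>: "0 \<le> \<epsilon>" using False s u by (simp add: \<epsilon>_def)
    have "s * (1 - q) / t \<le> s * (\<sigma> + L * (u - x)) / t"
      using above False s t by (intro divide_right_mono mult_left_mono) auto
    also have "\<dots> = s * \<sigma> / t + s * (L * (u - x) / t)"
      by (simp add: distrib_left add_divide_distrib)
    also have "s * (L * (u - x) / t) \<le> s * (c * (1 - x / u))"
    proof (intro mult_left_mono)
      have "L * (u - x) / t = (2 * L * u) / t * ((1 / 2) * (1 - x / u))"
        using u t by (simp add: field_simps)
      also have "\<dots> \<le> 1 * (c * (1 - x / u))"
        using L t c False u by (intro mult_mono) auto
      finally show "L * (u - x) / t \<le> c * (1 - x / u)" by simp
    qed (use s in auto)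
    finally have "s * (1 - q) / t \<le> s * \<sigma> / t + s * (c * (1 - x / u))" by simp
    moreover have "c * (1 + \<epsilon>) = c + s * (c * (1 - x / u))"
      by (simp add: \<epsilon>_def distrib_left mult.left_commute)
    moreover have "c = 1 + s * \<sigma> / t" by (simp add: c_def)
    ultimately have "1 + s * (1 - q) / t \<le> c * (1 + \<epsilon>)" by linarith
    then have "G * (1 + s * (1 - q) / t) \<le> G * (c * (1 + \<epsilon>))" using G by (intro mult_left_mono) auto
    also have "\<dots> = x powr -s * (x / u) powr s * (c * (1 + \<epsilon>))" by (simp only: G_eq)
    also have "\<dots> \<le> x powr -s * (1 - \<epsilon>) * (c * (1 + \<epsilon>))"
    proof (intro mult_right_mono mult_left_mono)
      show "(x / u) powr s \<le> 1 - \<epsilon>"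
        using powr_le_affine[of "x / u" s] x u s by (simp add: \<epsilon>_def algebra_simps)
    qed (use c \<epsilon> in auto)
    also have "\<dots> = x powr -s * c * (1 - \<epsilon>\<^sup>2)" by (simp add: algebra_simps power2_eq_square)
    also have "\<dots> \<le> x powr -s * c * 1" using c by (intro mult_left_mono) auto
    finally have "G * (1 + s * (1 - q) / t) - c * x powr -s \<le> 0" by (simp add: mult.commute)
    also have "\<dots> \<le> c * y0" using c y0 by simp
    finally show ?thesis .
  qed
  have c2: "c \<le> 2"
  proof -
    have "s * \<sigma> \<le> s * 1" using s \<sigma> by (intro mult_left_mono) auto
    also have "\<dots> \<le> 1 * t" using s t by simp
    finally have "s * \<sigma> \<le> 1 * t" .
    then have "s * \<sigma> / t \<le> 1" using t by (subst pos_divide_le_eq) auto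
    then show ?thesis by (simp add: c_def)
  qed
  have "(max 0 (G0 - B'))\<^sup>2 + u * q * ((max 0 (G0 * y - B'))\<^sup>2 - (max 0 (G0 - B'))\<^sup>2)
    \<le> (max 0 ((G0 - B') + u * q * ((G0 * y - B') - (G0 - B'))))\<^sup>2 + u * q * ((G0 * y - B') - (G0 - B'))\<^sup>2"
    by (intro max_square_average_le uq q)
  also have "\<dots> = (max 0 (G0 + u * q * (G0 * y - G0) - B'))\<^sup>2 + u * q * (G0 * (1 - y))\<^sup>2"
    by (simp add: algebra_simps power2_commute)
  also have "(max 0 (G0 + u * q * (G0 * y - G0) - B'))\<^sup>2 \<le> (c * y0 + e)\<^sup>2"
    using mean dich B' c y0 e by (intro power_mono) auto
  also have "(c * y0 + e)\<^sup>2 \<le> (c * y0)\<^sup>2 + (4 * a + a\<^sup>2 / z\<^sub>0) * G\<^sup>2 / (z * t)"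
  proof -
    have "2 * (c * y0) * e \<le> 2 * (2 * G) * e"
      using c c2 y0 e G by (intro mult_right_mono mult_left_mono mult_mono) auto
    also have "\<dots> = 4 * a * G\<^sup>2 / (z * t)" by (simp add: e_def power2_eq_square)
    finally have 1: "2 * (c * y0) * e \<le> 4 * a * G\<^sup>2 / (z * t)" .
    have "z\<^sub>0 * 1 \<le> z * t" using z t by (intro mult_mono) auto
    then have "a\<^sup>2 * G\<^sup>2 / (z * t) / (z * t) \<le> a\<^sup>2 * G\<^sup>2 / (z * t) / z\<^sub>0"
      using z t zp by (intro divide_left_mono) auto
    then have 2: "e\<^sup>2 \<le> a\<^sup>2 / z\<^sub>0 * G\<^sup>2 / (z * t)"
      by (simp add: e_def power2_eq_square mult_ac)
    have "(c * y0 + e)\<^sup>2 = (c * y0)\<^sup>2 + 2 * (c * y0) * e + e\<^sup>2" by (simp add: power2_sum)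
    with 1 2 show ?thesis by (simp add: distrib_right add_divide_distrib)
  qed
  also have "u * q * (G0 * (1 - y))\<^sup>2 \<le> 4 * a * G\<^sup>2 / (z * t)"
  proof -
    have "G0 * (1 - y) \<le> 2 * G * (1 / z)" using G0 G0_2 y1 y_ge by (intro mult_mono) auto
    then have "(G0 * (1 - y))\<^sup>2 \<le> (2 * G * (1 / z))\<^sup>2" using G0 y1 by (intro power_mono) auto
    then have "u * q * (G0 * (1 - y))\<^sup>2 \<le> u * a * (2 * G * (1 / z))\<^sup>2"
      using u q a by (intro mult_mono) auto
    also have "\<dots> = 4 * a * G\<^sup>2 / (z * t)"
      using zp t by (simp add: u_def power2_eq_square field_simps)
    finally show ?thesis .
  qed
  finally have final: "(max 0 (G0 - B'))\<^sup>2 + u * q * ((max 0 (G0 * y - B'))\<^sup>2 - (max 0 (G0 - B'))\<^sup>2)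
    \<le> (c * y0)\<^sup>2 + (4 * a + a\<^sup>2 / z\<^sub>0) * G\<^sup>2 / (z * t) + 4 * a * G\<^sup>2 / (z * t)" by simp
  have collect: "(4 * a + k) * g / b + 4 * a * g / b = (8 * a + k) * g / b" for k g b :: real
    by (cases "b = 0") (auto simp: field_simps)
  show ?thesis unfolding G1 G0_def[symmetric] G_def[symmetric] y0_def[symmetric]
    using final unfolding add.assoc collect .
qed

context mori_tree_moments
begin

text \<open>Rising factorials are exact eigenfunctions of the growth: multiplying
  \<open>pochhammer (z + 1) k - pochhammer z k\<close> by \<open>z\<close> gives \<open>k\<close>
  times \<open>pochhammer z k\<close>. With sampling probability at most
  \<open>z / \<tau> n * (L.mean / w)\<close>, division by the matching power of
  \<open>\<tau> n\<close> leaves only the new vertices as error, and these are summable because the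
  exponent is at least 2.\<close>

lemma max_weight_le_powr:
  fixes k :: nat
  assumes k: "real k * (L.mean / w) \<ge> 2"
  shows "AE \<omega> in M. \<exists>B. \<forall>n\<ge>1. pochhammer (max_weight n \<omega>) k / \<tau> n powr (real k * (L.mean / w)) \<le> B"
proof -
  define \<alpha> where "\<alpha> = real k * (L.mean / w)"
  \<comment> \<open>The truncation at 0 serves only to make \<open>F\<close> nonnegative at all real
    \<open>z\<close>; for positive \<open>z\<close> it has no effect.\<close>
  define F where "F n z = max 0 (pochhammer z k / \<tau> n powr \<alpha>)" for n z
  define c where "c n = pochhammer (1 + \<beta>) k / \<tau> (Suc n) powr \<alpha>" for n
  have \<alpha>: "\<alpha> \<ge> 2" using k by (simp add: \<alpha>_def)
  have poch: "pochhammer z k > 0" if "z > 0" for z :: real using that by (rule pochhammer_pos)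
  have F_pos: "F n z = pochhammer z k / \<tau> n powr \<alpha>" if "z > 0" for n z
    using poch[OF that] by (simp add: F_def)
  have poch_mono: "z * (pochhammer (z + 1) k - pochhammer z k) = real k * pochhammer z k" for z :: real
    using pochhammer_rec[of z k] by (simp add: pochhammer_Suc algebra_simps)
  have "AE \<omega> in M. \<exists>B. \<forall>n\<ge>1. F n (max_weight n \<omega>) \<le> B"
  proof (rule sum_potential_bounded[where b = "\<lambda>_. 0" and c = c])
    have "summable (\<lambda>n. 1 / (real n + (1 + \<beta> / w)) powr \<alpha>)"
    proof (rule summable_comparison_test_bigo)
      show "summable (\<lambda>n. norm (real n powr - \<alpha>))" using \<alpha> by (simp add: summable_real_powr_iff)
      show "(\<lambda>n. 1 / (real n + (1 + \<beta> / w)) powr \<alpha>) \<in> O(\<lambda>n. real n powr - \<alpha>)"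
        by real_asymp
    qed
    then show "summable c"
      unfolding c_def using summable_mult[of "\<lambda>n. 1 / (real n + (1 + \<beta> / w)) powr \<alpha>" "pochhammer (1 + \<beta>) k"]
      by (simp add: \<tau>_def add_ac)
    show "c n \<ge> 0" for n
      using poch[of "1 + \<beta>"] beta by (simp add: c_def)
    show "F n z \<ge> 0" for n z by (simp add: F_def)
    show "F n z \<le> F n (z + 1)" if "n \<ge> 1" "z > 0" for n z
    proof -
      have "z * (pochhammer (z + 1) k - pochhammer z k) \<ge> 0"
        using poch[OF that(2)] by (simp add: poch_mono)
      then have "pochhammer z k \<le> pochhammer (z + 1) k" using that by (simp add: zero_le_mult_iff)
      then show ?thesis using that by (simp add: F_pos divide_right_mono)
    qed
    show "F (Suc n) (1 + \<beta>) + 0 * w \<le> c n" for n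
      using beta by (simp add: c_def F_pos)
  next
    fix n :: nat and z :: real
    assume n: "n \<ge> 1" and z: "z > 0" "z / \<tau> n \<le> w"
    have t: "\<tau> n > 0" using \<tau>_pos n by simp
    have "pochhammer z k + hit n z * (pochhammer (z + 1) k - pochhammer z k)
      \<le> pochhammer z k + z / \<tau> n * (L.mean / w) * (pochhammer (z + 1) k - pochhammer z k)"
    proof -
      have "z * (pochhammer (z + 1) k - pochhammer z k) \<ge> 0"
        using poch[OF z(1)] by (simp add: poch_mono)
      then have "pochhammer (z + 1) k - pochhammer z k \<ge> 0" using z by (simp add: zero_le_mult_iff)
      then show ?thesis using hit_le[OF n _ z(2)] z by (intro add_left_mono mult_right_mono) auto
    qed
    also have "\<dots> = pochhammer z k * (1 + \<alpha> * (1 / \<tau> n))"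
    proof -
      have "z / \<tau> n * (L.mean / w) * (pochhammer (z + 1) k - pochhammer z k) =
          (z * (pochhammer (z + 1) k - pochhammer z k)) * (L.mean / w) / \<tau> n" by (simp add: mult_ac)
      also have "\<dots> = pochhammer z k * (\<alpha> * (1 / \<tau> n))"
        by (simp only: poch_mono \<alpha>_def) simp
      finally show ?thesis by (simp add: distrib_left)
    qed
    also have "\<dots> \<le> pochhammer z k * (1 + 1 / \<tau> n) powr \<alpha>"
      using poch[OF z(1)] \<alpha> t by (intro mult_left_mono affine_le_powr) auto
    also have "1 + 1 / \<tau> n = \<tau> (Suc n) / \<tau> n" using t by (simp add: \<tau>_Suc field_simps)
    finally have "(pochhammer z k + hit n z * (pochhammer (z + 1) k - pochhammer z k)) / \<tau> (Suc n) powr \<alpha>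
        \<le> pochhammer z k * (\<tau> (Suc n) / \<tau> n) powr \<alpha> / \<tau> (Suc n) powr \<alpha>"
      by (intro divide_right_mono) auto
    also have "\<dots> = pochhammer z k / \<tau> n powr \<alpha>"
      using t by (simp add: powr_divide \<tau>_Suc)
    finally show "F (Suc n) z + hit n z * (F (Suc n) (z + 1) - F (Suc n) z) \<le> F n z + 0 * (z / \<tau> n)"
      using z by (simp add: F_pos add_divide_distrib flip: diff_divide_distrib)
  qed simp
  then show ?thesis unfolding \<alpha>_def[symmetric]
    by eventually_elim (use max_weight_pos in \<open>auto simp: F_pos\<close>)
qed

text \<open>Growth by 1 lowers \<open>1 / z\<close> by the fraction \<open>1 / (z + 1)\<close> and
  happens with probability at least \<open>z / (\<tau> n * w)\<close>. As \<open>z / (z + 1)\<close>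
  increases and equals \<open>(1 + \<beta>) / w\<close> at the least possible weight
  \<open>1 + \<beta>\<close>, the mean contracts by
  \<open>1 - (1 + \<beta>) / w\<^sup>2 / \<tau> n\<close>, which gives the exponent.\<close>

lemma integral_inverse_max_weight_le:
  obtains C where "C \<ge> 0" "\<And>n. n \<ge> 1 \<Longrightarrow>
    (\<integral>\<omega>. 1 / max_weight n \<omega> \<partial>M) \<le> C * \<tau> n powr - ((1 + \<beta>) / w\<^sup>2)"
proof -
  define a where "a = (1 + \<beta>) / w\<^sup>2"
  have a: "a > 0" using beta w_gt_1 by (simp add: a_def)
  define C where "C = (\<integral>\<omega>. 1 / max_weight 1 \<omega> \<partial>M) * \<tau> 1 powr a"
  have int_nonneg: "(\<integral>\<omega>. 1 / max_weight n \<omega> \<partial>M) \<ge> 0" if "n \<ge> 1" for n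
    by (intro Bochner_Integration.integral_nonneg) (use max_weight_pos[OF that] in \<open>simp add: less_imp_le\<close>)
  have "(\<integral>\<omega>. 1 / max_weight n \<omega> \<partial>M) * \<tau> n powr a \<le> C" if "n \<ge> 1" for n
    using that
  proof (induction n rule: nat_induct_at_least)
    case base
    then show ?case by (simp add: C_def)
  next
    case (Suc n)
    have t: "\<tau> n > 0" using \<tau>_pos Suc(1) by simp
    have "(\<integral>\<omega>. 1 * (1 / max_weight (Suc n) \<omega>) \<partial>M) \<le>
       (\<integral>\<omega>. 1 * (1 / max_weight n \<omega> + hit n (max_weight n \<omega>) *
         (1 / (max_weight n \<omega> + 1) - 1 / max_weight n \<omega>)) \<partial>M)"
      using max_weight_step[OF Suc(1), of "\<lambda>z. 1 / z" "\<lambda>_. 1"] by (simp add: frac_le)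
    also have "\<dots> \<le> (\<integral>\<omega>. (1 - a / \<tau> n) * (1 / max_weight n \<omega>) \<partial>M)"
    proof (rule integral_mono_AE)
      show "AE \<omega> in M. 1 * (1 / max_weight n \<omega> + hit n (max_weight n \<omega>) *
         (1 / (max_weight n \<omega> + 1) - 1 / max_weight n \<omega>)) \<le> (1 - a / \<tau> n) * (1 / max_weight n \<omega>)"
        using AE_valid
      proof eventually_elim
        case (elim \<omega>)
        let ?z = "max_weight n \<omega>"
        have z: "?z > 0" "?z \<ge> 1 + \<beta>" using max_weight_pos max_weight_ge Suc(1) by auto
        have "1 / (?z + 1) - 1 / ?z = - (1 / (?z * (?z + 1)))" using z by (simp add: field_simps)
        then have "1 / ?z + hit n ?z * (1 / (?z + 1) - 1 / ?z) = 1 / ?z - hit n ?z * (1 / (?z * (?z + 1)))"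
          by simp
        also have "\<dots> \<le> 1 / ?z - ?z / \<tau> n / w * (1 / (?z * (?z + 1)))"
          using hit_ge[OF Suc(1) _ max_weight_le[OF elim Suc(1)]] z
          by (intro diff_left_mono mult_right_mono) auto
        also have "\<dots> = 1 / ?z - ?z / (?z + 1) / w / \<tau> n * (1 / ?z)" using z by simp
        also have "\<dots> \<le> 1 / ?z - (1 + \<beta>) / w / w / \<tau> n * (1 / ?z)"
        proof -
          have "(1 + \<beta>) / w \<le> ?z / (?z + 1)"
            using z beta by (simp add: w_def field_simps)
          then show ?thesis using z t w_gt_1
            by (intro diff_left_mono mult_right_mono divide_right_mono) auto
        qed
        also have "\<dots> = (1 - a / \<tau> n) * (1 / ?z)"
          by (simp only: a_def power2_eq_square left_diff_distrib mult_1_left divide_divide_eq_left)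
        finally show ?case by simp
      qed
      show "integrable M (\<lambda>\<omega>. (1 - a / \<tau> n) * (1 / max_weight n \<omega>))"
        unfolding max_weight_eq by (rule integrable_tree[OF Suc(1)])
      show "integrable M (\<lambda>\<omega>. 1 * (1 / max_weight n \<omega> + hit n (max_weight n \<omega>) *
         (1 / (max_weight n \<omega> + 1) - 1 / max_weight n \<omega>)))"
        unfolding max_weight_eq by (rule integrable_tree[OF Suc(1)])
    qed
    finally have *: "(\<integral>\<omega>. 1 / max_weight (Suc n) \<omega> \<partial>M) \<le> (1 - a / \<tau> n) * (\<integral>\<omega>. 1 / max_weight n \<omega> \<partial>M)"
      by (simp only: integral_mult_right_zero mult_1_left)
    have "(1 - a / \<tau> n) * (\<tau> (Suc n) / \<tau> n) powr a \<le> exp (- (a / \<tau> n)) * exp (a / \<tau> n)"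
    proof (rule mult_mono)
      show "1 - a / \<tau> n \<le> exp (- (a / \<tau> n))" using exp_ge_add_one_self[of "- (a / \<tau> n)"] by simp
      have "ln (\<tau> (Suc n) / \<tau> n) \<le> \<tau> (Suc n) / \<tau> n - 1"
        using t by (intro ln_le_minus_one) (simp add: \<tau>_Suc)
      also have "\<dots> = 1 / \<tau> n" using t by (simp add: \<tau>_Suc field_simps)
      finally have "a * ln (\<tau> (Suc n) / \<tau> n) \<le> a * (1 / \<tau> n)" using a by (intro mult_left_mono) auto
      then show "(\<tau> (Suc n) / \<tau> n) powr a \<le> exp (a / \<tau> n)" using t by (simp add: powr_def \<tau>_Suc)
    qed auto
    then have "(1 - a / \<tau> n) * (\<tau> (Suc n) / \<tau> n) powr a \<le> 1" by (simp add: exp_minus)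
    then have "(1 - a / \<tau> n) * (\<tau> (Suc n) / \<tau> n) powr a * \<tau> n powr a \<le> 1 * \<tau> n powr a"
      by (intro mult_right_mono) auto
    then have step: "(1 - a / \<tau> n) * \<tau> (Suc n) powr a \<le> \<tau> n powr a"
      using t by (simp add: powr_divide \<tau>_Suc)
    have "(\<integral>\<omega>. 1 / max_weight (Suc n) \<omega> \<partial>M) * \<tau> (Suc n) powr a
      \<le> (1 - a / \<tau> n) * (\<integral>\<omega>. 1 / max_weight n \<omega> \<partial>M) * \<tau> (Suc n) powr a"
      using * by (intro mult_right_mono) auto
    also have "\<dots> = (\<integral>\<omega>. 1 / max_weight n \<omega> \<partial>M) * ((1 - a / \<tau> n) * \<tau> (Suc n) powr a)" by simp
    also have "\<dots> \<le> (\<integral>\<omega>. 1 / max_weight n \<omega> \<partial>M) * \<tau> n powr a"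
      using step int_nonneg[OF Suc(1)] by (intro mult_left_mono) auto
    finally show ?case using Suc(2) by simp
  qed
  then have "(\<integral>\<omega>. 1 / max_weight n \<omega> \<partial>M) \<le> C * \<tau> n powr - a" if "n \<ge> 1" for n
    using that \<tau>_pos[OF that] by (simp add: powr_minus field_simps)
  moreover have "C \<ge> 0" using int_nonneg[of 1] by (simp add: C_def)
  ultimately show ?thesis using that unfolding a_def by blast
qed

text \<open>The potential is the squared excess of the inverse power over \<open>x powr -s\<close>,
  in units of \<open>\<rho> powr s\<close>. The condition \<open>large\<close> provides the time and
  Lipschitz conditions of \<open>truncated_square_drift_below\<close> and its
  \<open>c \<ge> 1 / 2\<close>; \<open>\<rho>_ge\<close> limits how much division by
  \<open>\<rho>\<close> can magnify the noise.\<close>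

lemma max_weight_lower:
  fixes x \<rho> :: "nat \<Rightarrow> real"
  assumes n0: "n0 \<ge> 1"
    and large: "\<And>n. n \<ge> n0 \<Longrightarrow> 1 \<le> \<tau> n \<and> 2 * (L.moment 2 / w\<^sup>2) * w \<le> \<tau> n \<and> 2 * (L.mean / w) \<le> \<tau> n"
    and x: "\<And>n. n \<ge> n0 \<Longrightarrow> 0 < x n" and x_le: "\<And>n. n \<ge> n0 \<Longrightarrow> x n \<le> w"
    and \<rho>: "\<And>n. n \<ge> n0 \<Longrightarrow> 0 < \<rho> n"
    and x_step: "\<And>n. n \<ge> n0 \<Longrightarrow> x (Suc n) * exp ((1 - r (x n)) / \<tau> n) \<le> x n"
    and \<rho>_step: "\<And>n. n \<ge> n0 \<Longrightarrow> \<rho> n * exp ((1 - r (x n)) / \<tau> n) \<le> \<rho> (Suc n)"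
    and \<rho>_ge: "\<And>n. n \<ge> n0 \<Longrightarrow> 1 / \<tau> n \<le> \<rho> n"
  obtains s where "s > 0"
    "AE \<omega> in M. \<exists>B. \<forall>n\<ge>n0. (max_weight n \<omega> / \<tau> n) powr -s \<le> x n powr -s + B * \<rho> n powr s"
proof -
  define a1 where "a1 = (1 + \<beta>) / w\<^sup>2"
  have "1 + \<beta> \<le> w" using w_def by simp
  also have "\<dots> \<le> w\<^sup>2" using w_gt_1 by (simp add: power2_eq_square)
  finally have a1: "0 < a1" "a1 \<le> 1" using beta w_gt_1 by (auto simp: a1_def)
  \<comment> \<open>The error per step is of order \<open>\<tau> n powr (4 * s - 1) / z\<close>, and
    the mean of \<open>1 / z\<close> is of order \<open>\<tau> n powr - a1\<close>. With
    \<open>s = a1 / 8\<close> the total exponent is \<open>- 1 - a1 / 2\<close>, which is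
    summable.\<close>
  define s where "s = a1 / 8"
  have s: "0 < s" "s \<le> 1" using a1 by (auto simp: s_def)
  define a where "a = L.mean / w"
  define z\<^sub>0 where "z\<^sub>0 = 1 + \<beta>"
  have z0: "z\<^sub>0 > 0" using beta by (simp add: z\<^sub>0_def)
  define F where "F n z = (max 0 ((\<tau> n / z) powr s - x n powr -s) / \<rho> n powr s)\<^sup>2" for n z
  have a_pos: "a \<ge> 0" using w_gt_1 by (simp add: a_def L.mean_def)
  \<comment> \<open>The factor \<open>z\<^sub>0 powr (-2 * s)\<close> comes from
    \<open>z \<ge> z\<^sub>0\<close> in the bound on \<open>G\<^sup>2\<close>, and 4 bounds
    \<open>2 powr (2 * s)\<close>, which arises from
    \<open>\<rho> (Suc n) \<ge> 1 / (t + 1) \<ge> 1 / (2 * t)\<close>.\<close>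
  define K where "K = (8 * a + a\<^sup>2 / z\<^sub>0) * z\<^sub>0 powr (-2 * s) * 4"
  have K: "K \<ge> 0" using a_pos z0 by (simp add: K_def)
  have drift: "F (Suc n) z + hit n z * (F (Suc n) (z + 1) - F (Suc n) z)
      \<le> F n z + K * \<tau> n powr (4 * s - 1) / z"
    if n: "n \<ge> n0" and z: "z \<ge> z\<^sub>0" "z / \<tau> n \<le> w" for n z
  proof -
    have n1: "n \<ge> 1" using n n0 by simp
    define t where "t = \<tau> n"
    have t: "t \<ge> 1" using large[OF n] by (simp add: t_def)
    have zp: "z > 0" using z z0 by simp
    define u where "u = z / t"
    have u: "u > 0" "u \<le> w" using zp t z by (auto simp: u_def t_def)
    define \<sigma> where "\<sigma> = 1 - r (x n)"
    define c where "c = 1 + s * \<sigma> / t"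
    have rx: "r (x n) \<ge> 0" "r (x n) \<le> a"
      using L.rate_ge[of "x n"] L.rate_le[of "x n"] x[OF n] x_le[OF n] w_gt_1
        order_trans[of 0 "1 / w" "r (x n)"] by (auto simp: a_def)
    have ru: "r u \<ge> 0" "r u \<le> a"
      using L.rate_ge[of u] L.rate_le[of u] u w_gt_1 order_trans[of 0 "1 / w" "r u"] by (auto simp: a_def)
    have c_ge: "c \<ge> 1 / 2"
    proof -
      have "s * (r (x n) - 1) \<le> s * a" using s rx by (intro mult_left_mono) auto
      also have "s * a \<le> 1 * a" using s a_pos by (intro mult_right_mono) auto
      also have "1 * a \<le> t / 2" using large[OF n] by (simp add: a_def t_def mult.commute)
      finally have "- (s * \<sigma>) \<le> t * (1 / 2)" by (simp add: \<sigma>_def algebra_simps)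
      then have "- (s * \<sigma>) / t \<le> 1 / 2" using t by (subst pos_divide_le_eq) (auto simp: mult.commute)
      then show ?thesis by (simp add: c_def)
    qed
    have exp_ge: "exp (\<sigma> / t) powr s \<ge> c"
      using exp_ge_add_one_self[of "s * (\<sigma> / t)"] by (simp add: c_def powr_def)
    have hit: "hit n z = u * r u" by (simp add: hit_def u_def t_def)
    have B': "c * x n powr -s \<le> x (Suc n) powr -s"
    proof -
      have "x n powr -s \<le> (x (Suc n) * exp (\<sigma> / t)) powr -s"
        using x_step[OF n] x[of "Suc n"] n s by (intro powr_mono2') (auto simp: \<sigma>_def t_def)
      also have "\<dots> = x (Suc n) powr -s * exp (\<sigma> / t) powr -s" by (simp add: powr_mult)
      finally have "x n powr -s * exp (\<sigma> / t) powr s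
          \<le> x (Suc n) powr -s * exp (\<sigma> / t) powr -s * exp (\<sigma> / t) powr s"
        by (intro mult_right_mono) auto
      also have "\<dots> = x (Suc n) powr -s" by (simp add: mult.assoc flip: powr_add)
      finally have "x n powr -s * exp (\<sigma> / t) powr s \<le> x (Suc n) powr -s" .
      moreover have "c * x n powr -s \<le> x n powr -s * exp (\<sigma> / t) powr s"
        using mult_right_mono[OF exp_ge, of "x n powr -s"] by (simp only: mult.commute powr_ge_zero)
      ultimately show ?thesis by linarith
    qed
    define G where "G = (t / z) powr s"
    define \<delta> where "\<delta> = (8 * a + a\<^sup>2 / z\<^sub>0) * G\<^sup>2 / (z * t)"
    define \<rho>' where "\<rho>' = \<rho> (Suc n)"
    have \<rho>': "\<rho>' > 0" using \<rho>[of "Suc n"] n by (simp add: \<rho>'_def)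
    have main: "(max 0 (((t + 1) / z) powr s - x (Suc n) powr -s))\<^sup>2 +
        u * r u * ((max 0 (((t + 1) / (z + 1)) powr s - x (Suc n) powr -s))\<^sup>2 -
          (max 0 (((t + 1) / z) powr s - x (Suc n) powr -s))\<^sup>2)
      \<le> (c * max 0 (G - x n powr -s))\<^sup>2 + \<delta>"
      unfolding c_def G_def \<delta>_def u_def
    proof (rule truncated_square_drift_below[where L = "L.moment 2 / w\<^sup>2"])
      show "z / t * r (z / t) \<le> 1" using hit_le_1[OF n1 _ z(2)] zp by (simp add: hit_def t_def)
      show "\<sigma> \<le> 1" using rx by (simp add: \<sigma>_def)
      show "1 - r (z / t) \<le> \<sigma>" if "z / t \<le> x n"
        using L.rate_antimono[of "z / t" "x n"] that x_le[OF n] u by (simp add: u_def \<sigma>_def)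
      show "1 - r (z / t) \<le> \<sigma> + L.moment 2 / w\<^sup>2 * (z / t - x n)" if "x n \<le> z / t"
        using L.rate_lipschitz[of "x n" "z / t"] that x[OF n] u by (simp add: u_def \<sigma>_def)
      have "2 * (L.moment 2 / w\<^sup>2) * (z / t) \<le> 2 * (L.moment 2 / w\<^sup>2) * w"
        using u L.moment_nonneg[of 2] by (intro mult_left_mono) (auto simp: u_def)
      then show "2 * (L.moment 2 / w\<^sup>2) * (z / t) \<le> t" using large[OF n] by (simp add: t_def)
    qed (use t s z z0 x[OF n] ru c_ge B' in \<open>auto simp: c_def u_def\<close>)
    have "F (Suc n) z + hit n z * (F (Suc n) (z + 1) - F (Suc n) z) =
       ((max 0 (((t + 1) / z) powr s - x (Suc n) powr -s))\<^sup>2 +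
        u * r u * ((max 0 (((t + 1) / (z + 1)) powr s - x (Suc n) powr -s))\<^sup>2 -
          (max 0 (((t + 1) / z) powr s - x (Suc n) powr -s))\<^sup>2)) / (\<rho>' powr s)\<^sup>2"
      by (simp add: F_def hit t_def \<rho>'_def \<tau>_Suc power_divide add_divide_distrib
          right_diff_distrib diff_divide_distrib)
    also have "\<dots> \<le> ((c * max 0 (G - x n powr -s))\<^sup>2 + \<delta>) / (\<rho>' powr s)\<^sup>2"
      by (intro divide_right_mono main) simp
    also have "\<dots> = (c * max 0 (G - x n powr -s) / \<rho>' powr s)\<^sup>2 + \<delta> / (\<rho>' powr s)\<^sup>2"
      by (simp only: add_divide_distrib power_divide)
    also have "(c * max 0 (G - x n powr -s) / \<rho>' powr s)\<^sup>2 \<le> F n z"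
    proof -
      have "(\<rho> n * exp (\<sigma> / t)) powr s \<le> \<rho>' powr s"
        using \<rho>_step[OF n] \<rho>[OF n] s by (intro powr_mono2) (auto simp: \<sigma>_def t_def \<rho>'_def)
      then have "\<rho> n powr s * exp (\<sigma> / t) powr s \<le> \<rho>' powr s" by (simp add: powr_mult)
      moreover have "\<rho> n powr s * c \<le> \<rho> n powr s * exp (\<sigma> / t) powr s"
        using exp_ge by (intro mult_left_mono) auto
      ultimately have *: "c * \<rho> n powr s \<le> \<rho>' powr s" by (simp add: mult.commute)
      have "c * \<rho> n powr s * max 0 (G - x n powr -s) \<le> \<rho>' powr s * max 0 (G - x n powr -s)"
        using * by (intro mult_right_mono) auto
      then have "c * max 0 (G - x n powr -s) / \<rho>' powr s \<le> max 0 (G - x n powr -s) / \<rho> n powr s"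
        using \<rho>[OF n] \<rho>' by (simp add: field_simps)
      then have "(c * max 0 (G - x n powr -s) / \<rho>' powr s)\<^sup>2 \<le> (max 0 (G - x n powr -s) / \<rho> n powr s)\<^sup>2"
        using c_ge by (intro power_mono divide_nonneg_nonneg mult_nonneg_nonneg) auto
      then show ?thesis by (simp add: F_def G_def t_def)
    qed
    also have "\<delta> / (\<rho>' powr s)\<^sup>2 \<le> K * t powr (4 * s - 1) / z"
    proof -
      have G2: "G\<^sup>2 \<le> t powr (2 * s) * z\<^sub>0 powr (-2 * s)"
      proof -
        have "G\<^sup>2 = (t / z) powr (2 * s)"
          using zp t by (simp add: G_def powr_power)
        also have "\<dots> \<le> (t / z\<^sub>0) powr (2 * s)"
          using z z0 t s by (intro powr_mono2 divide_left_mono) auto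
        also have "\<dots> = t powr (2 * s) * z\<^sub>0 powr (-2 * s)"
          using t z0 by (simp add: powr_divide powr_minus_divide)
        finally show ?thesis .
      qed
      have "1 / (2 * t) \<le> 1 / (t + 1)" using t by (intro divide_left_mono) auto
      also have "\<dots> \<le> \<rho>'" using \<rho>_ge[of "Suc n"] n by (simp add: \<rho>'_def \<tau>_Suc t_def)
      finally have "(1 / (2 * t)) powr (2 * s) \<le> \<rho>' powr (2 * s)" using s t by (intro powr_mono2) auto
      moreover have "(1 / (2 * t)) powr (2 * s) = 1 / (2 powr (2 * s) * t powr (2 * s))"
        using t by (simp add: powr_divide powr_mult)
      moreover have "(\<rho>' powr s)\<^sup>2 = \<rho>' powr (2 * s)" using \<rho>' by (simp add: powr_power)
      ultimately have "1 / (2 powr (2 * s) * t powr (2 * s)) \<le> (\<rho>' powr s)\<^sup>2" by simp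
      moreover have "1 / R \<le> P" if "1 / P \<le> R" "P > 0" "R > 0" for P R :: real
        using that by (simp add: field_simps)
      ultimately have "1 / (\<rho>' powr s)\<^sup>2 \<le> 2 powr (2 * s) * t powr (2 * s)"
        using \<rho>' t by simp
      also have "\<dots> \<le> 2 powr 2 * t powr (2 * s)"
        using s by (intro mult_right_mono powr_mono) auto
      finally have rho2: "1 / (\<rho>' powr s)\<^sup>2 \<le> 4 * t powr (2 * s)" by simp
      have "\<delta> / (\<rho>' powr s)\<^sup>2 = (8 * a + a\<^sup>2 / z\<^sub>0) / (z * t) * (G\<^sup>2 * (1 / (\<rho>' powr s)\<^sup>2))"
        by (simp add: \<delta>_def)
      also have "\<dots> \<le> (8 * a + a\<^sup>2 / z\<^sub>0) / (z * t) *
          (t powr (2 * s) * z\<^sub>0 powr (-2 * s) * (4 * t powr (2 * s)))"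
        using G2 rho2 a_pos z0 zp t by (intro mult_left_mono mult_mono) auto
      also have "\<dots> = K / z * ((t powr (2 * s) * t powr (2 * s)) / t)"
        by (simp add: K_def)
      also have "(t powr (2 * s) * t powr (2 * s)) / t = t powr (4 * s - 1)"
        using t by (simp add: powr_add[symmetric] powr_diff)
      finally show ?thesis by simp
    qed
    finally show ?thesis by (simp add: t_def)
  qed
  obtain C where C: "C \<ge> 0" "\<And>n. n \<ge> 1 \<Longrightarrow> (\<integral>\<omega>. 1 / max_weight n \<omega> \<partial>M) \<le> C * \<tau> n powr - a1"
    using integral_inverse_max_weight_le[folded a1_def] by blast
  define cc where "cc n = K * C * \<tau> n powr (- 1 - a1 / 2)" for n
  have "AE \<omega> in M. \<exists>B. \<forall>n\<ge>n0. F n (top_weight n (tree n \<omega>)) \<le> B"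
  proof (rule almost_supermartingale_bounded[OF n0, of "\<lambda>n E. F n (top_weight n E)" cc])
    show "0 \<le> F n (top_weight n E)" for n E by (simp add: F_def)
    show "0 \<le> cc n" for n using K C by (simp add: cc_def)
    have "summable (\<lambda>n. (real n + \<beta> / w) powr (- 1 - a1 / 2))"
    proof (rule summable_comparison_test_bigo)
      show "summable (\<lambda>n. norm (real n powr (- 1 - a1 / 2)))" using a1 by (simp add: summable_real_powr_iff)
      show "(\<lambda>n. (real n + \<beta> / w) powr (- 1 - a1 / 2)) \<in> O(\<lambda>n. real n powr (- 1 - a1 / 2))"
        by real_asymp
    qed
    then show "summable cc" unfolding cc_def \<tau>_def by (rule summable_mult)
  next
    fix n and f :: "nat set set list \<Rightarrow> real"
    assume n: "n \<ge> n0" and f: "\<And>h. 0 \<le> f h \<and> f h \<le> 1"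
    have n1: "n \<ge> 1" using n n0 by simp
    let ?Z = "max_weight n"
    have "(\<integral>\<omega>. f (hist n \<omega>) * F (Suc n) (max_weight (Suc n) \<omega>) \<partial>M)
        \<le> (\<integral>\<omega>. f (hist n \<omega>) * (F (Suc n) (?Z \<omega>) + hit n (?Z \<omega>) * (F (Suc n) (?Z \<omega> + 1) - F (Suc n) (?Z \<omega>))) \<partial>M)"
    proof (rule max_weight_step[OF n1])
      fix y z :: real assume "0 < y" "y \<le> z"
      then show "F (Suc n) z \<le> F (Suc n) y"
        unfolding F_def using s \<tau>_pos[of "Suc n"]
        by (intro power_mono divide_right_mono max.mono diff_right_mono powr_mono2 divide_left_mono) auto
    qed (use f in auto)
    also have "\<dots> \<le> (\<integral>\<omega>. f (hist n \<omega>) * F n (?Z \<omega>) + K * \<tau> n powr (4 * s - 1) * (1 / ?Z \<omega>) \<partial>M)"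
    proof (rule integral_mono_AE)
      show "integrable M (\<lambda>\<omega>. f (hist n \<omega>) * (F (Suc n) (?Z \<omega>) +
          hit n (?Z \<omega>) * (F (Suc n) (?Z \<omega> + 1) - F (Suc n) (?Z \<omega>))))"
        unfolding max_weight_eq by (rule integrable_hist_tree[OF n1])
      show "integrable M (\<lambda>\<omega>. f (hist n \<omega>) * F n (?Z \<omega>) + K * \<tau> n powr (4 * s - 1) * (1 / ?Z \<omega>))"
        unfolding max_weight_eq
        by (rule Bochner_Integration.integrable_add[OF integrable_hist_tree[OF n1] integrable_tree[OF n1]])
      show "AE \<omega> in M. f (hist n \<omega>) * (F (Suc n) (?Z \<omega>) +
          hit n (?Z \<omega>) * (F (Suc n) (?Z \<omega> + 1) - F (Suc n) (?Z \<omega>)))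
          \<le> f (hist n \<omega>) * F n (?Z \<omega>) + K * \<tau> n powr (4 * s - 1) * (1 / ?Z \<omega>)"
        using AE_valid
      proof eventually_elim
        case (elim \<omega>)
        let ?e = "K * \<tau> n powr (4 * s - 1) * (1 / ?Z \<omega>)"
        have e: "?e \<ge> 0" using K max_weight_pos[OF n1, of \<omega>] by simp
        have "F (Suc n) (?Z \<omega>) + hit n (?Z \<omega>) * (F (Suc n) (?Z \<omega> + 1) - F (Suc n) (?Z \<omega>)) \<le> F n (?Z \<omega>) + ?e"
          using drift[OF n _ max_weight_le[OF elim n1]] max_weight_ge[OF n1, of \<omega>] by (simp add: z\<^sub>0_def)
        then have "f (hist n \<omega>) * (F (Suc n) (?Z \<omega>) +
          hit n (?Z \<omega>) * (F (Suc n) (?Z \<omega> + 1) - F (Suc n) (?Z \<omega>))) \<le> f (hist n \<omega>) * (F n (?Z \<omega>) + ?e)"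
          using f by (intro mult_left_mono) auto
        also have "\<dots> \<le> f (hist n \<omega>) * F n (?Z \<omega>) + ?e"
          using mult_right_mono[of "f (hist n \<omega>)" 1 ?e] f e by (simp only: distrib_left) simp
        finally show ?case .
      qed
    qed
    also have "\<dots> = (\<integral>\<omega>. f (hist n \<omega>) * F n (?Z \<omega>) \<partial>M) + (\<integral>\<omega>. K * \<tau> n powr (4 * s - 1) * (1 / ?Z \<omega>) \<partial>M)"
      unfolding max_weight_eq
      by (rule Bochner_Integration.integral_add[OF integrable_hist_tree[OF n1] integrable_tree[OF n1]])
    also have "(\<integral>\<omega>. K * \<tau> n powr (4 * s - 1) * (1 / ?Z \<omega>) \<partial>M) =
        K * \<tau> n powr (4 * s - 1) * (\<integral>\<omega>. 1 / ?Z \<omega> \<partial>M)"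
      by (rule integral_mult_right_zero)
    also have "\<dots> \<le> K * \<tau> n powr (4 * s - 1) * (C * \<tau> n powr - a1)"
      using C(2)[OF n1] K by (intro mult_left_mono) auto
    also have "\<dots> = cc n"
    proof -
      have "\<tau> n powr (4 * s - 1) * \<tau> n powr - a1 = \<tau> n powr (4 * s - 1 + - a1)"
        by (rule powr_add[symmetric])
      also have "4 * s - 1 + - a1 = - 1 - a1 / 2" by (simp add: s_def)
      finally show ?thesis unfolding cc_def by (metis mult.assoc mult.left_commute)
    qed
    finally show "(\<integral>\<omega>. f (hist n \<omega>) * F (Suc n) (top_weight (Suc n) (tree (Suc n) \<omega>)) \<partial>M)
        \<le> (\<integral>\<omega>. f (hist n \<omega>) * F n (top_weight n (tree n \<omega>)) \<partial>M) + cc n"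
      by (simp add: max_weight_eq)
  qed
  then have "AE \<omega> in M. \<exists>B. \<forall>n\<ge>n0. (max_weight n \<omega> / \<tau> n) powr -s \<le> x n powr -s + B * \<rho> n powr s"
  proof eventually_elim
    case (elim \<omega>)
    then obtain B where B: "\<And>n. n \<ge> n0 \<Longrightarrow> F n (max_weight n \<omega>) \<le> B" by (auto simp: max_weight_eq)
    have "(max_weight n \<omega> / \<tau> n) powr -s \<le> x n powr -s + sqrt B * \<rho> n powr s" if n: "n \<ge> n0" for n
    proof -
      have pos: "max_weight n \<omega> > 0" "\<tau> n > 0" using max_weight_pos \<tau>_pos n n0 by auto
      have "max 0 ((\<tau> n / max_weight n \<omega>) powr s - x n powr -s) / \<rho> n powr s \<le> sqrt B"
        using B[OF n] by (intro real_le_rsqrt) (simp add: F_def)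
      then have "(\<tau> n / max_weight n \<omega>) powr s - x n powr -s \<le> sqrt B * \<rho> n powr s"
        using \<rho>[OF n] by (simp add: pos_divide_le_eq)
      moreover have "(\<tau> n / max_weight n \<omega>) powr s = (max_weight n \<omega> / \<tau> n) powr -s"
        using pos by (simp add: powr_divide powr_minus field_simps)
      ultimately show ?thesis by linarith
    qed
    then show ?case by blast
  qed
  then show ?thesis using that s(1) by blast
qed

end

subsection \<open>The three regimes\<close>

lemma tendsto_sandwich_family:
  fixes f :: "nat \<Rightarrow> real" and l u :: "nat \<Rightarrow> real"
  assumes "\<And>m. eventually (\<lambda>n. l m \<le> f n) sequentially" "\<And>m. eventually (\<lambda>n. f n \<le> u m) sequentially"
    and "l \<longlonglongrightarrow> c" "u \<longlonglongrightarrow> c"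
  shows "f \<longlonglongrightarrow> c"
proof (rule order_tendstoI)
  fix a assume "a < c"
  then obtain m where "a < l m"
    using order_tendstoD(1)[OF assms(3)] by (auto simp: eventually_sequentially)
  then show "eventually (\<lambda>n. a < f n) sequentially"
    using assms(1)[of m] by (auto elim: eventually_mono)
next
  fix a assume "a > c"
  then obtain m where "a > u m"
    using order_tendstoD(2)[OF assms(4)] by (auto simp: eventually_sequentially)
  then show "eventually (\<lambda>n. f n < a) sequentially"
    using assms(2)[of m] by (auto elim: eventually_mono)
qed

lemma power_le_pochhammer:
  fixes z :: real
  assumes "z > 0"
  shows "z ^ k \<le> pochhammer z k"
proof (induction k)
  case (Suc k)
  have "z ^ k * z \<le> pochhammer z k * (z + real k)"
    using Suc assms pochhammer_pos[OF assms, of k] by (intro mult_mono) auto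
  then show ?case by (simp add: pochhammer_Suc mult.commute)
qed simp

lemma (in prob_space) prob_tendsto_1:
  assumes ev: "\<And>n. {\<omega> \<in> space M. P n \<omega>} \<in> events"
    and ae: "AE \<omega> in M. eventually (\<lambda>n. P n \<omega>) sequentially"
  shows "(\<lambda>n. prob {\<omega> \<in> space M. P n \<omega>}) \<longlonglongrightarrow> 1"
proof -
  have "(\<lambda>n. \<integral>\<omega>. indicator {\<omega> \<in> space M. P n \<omega>} \<omega> \<partial>M) \<longlonglongrightarrow> (\<integral>\<omega>. (1::real) \<partial>M)"
  proof (rule integral_dominated_convergence[where w = "\<lambda>_. 1"])
    show "AE \<omega> in M. (\<lambda>n. indicator {\<omega> \<in> space M. P n \<omega>} \<omega> :: real) \<longlonglongrightarrow> 1"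
      using ae AE_space
    proof eventually_elim
      case (elim \<omega>)
      then have "eventually (\<lambda>n. indicator {\<omega> \<in> space M. P n \<omega>} \<omega> = (1::real)) sequentially"
        by (auto elim!: eventually_mono)
      then show ?case by (rule tendsto_eventually)
    qed
  qed (use ev in \<open>auto simp: indicator_def\<close>)
  then show ?thesis using ev by (simp add: prob_space)
qed

text \<open>\<open>moment 2\<close> is a Lipschitz constant of \<open>r\<close> up to a factor, and
  \<open>r\<close> is not constant when the mean exceeds 1.\<close>

lemma (in sampling_law) moment_2_pos:
  assumes "mean > 1"
  shows "moment 2 > 0"
proof -
  have "r w < r 0" using rate_strict_antimono[of 0 w] assms w by simp
  moreover have "r 0 - r w \<le> moment 2 / w\<^sup>2 * (w - 0)" using rate_lipschitz[of 0 w] w by simp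
  ultimately have "moment 2 \<noteq> 0" by auto
  then show ?thesis using moment_nonneg[of 2] by simp
qed

context mori_tree_moments
begin

text \<open>An asymptotic form of \<open>max_weight_upper\<close>: the drift is replaced by an
  explicit lower bound \<open>\<sigma>\<close>, so that the step conditions become limits of
  elementary functions. As \<open>\<rho> n / x n\<close> tends to 0, the random constant in front of
  \<open>\<rho>\<close> is absorbed into \<open>\<delta>\<close>.\<close>

lemma max_weight_upper_ratio:
  fixes x \<rho> \<sigma> :: "nat \<Rightarrow> real"
  assumes x: "\<forall>\<^sub>F n in sequentially. 0 < x n" "\<forall>\<^sub>F n in sequentially. x n \<le> w"
    and \<rho>: "\<forall>\<^sub>F n in sequentially. 0 < \<rho> n"
    and \<sigma>: "\<forall>\<^sub>F n in sequentially. \<sigma> n \<le> 1 - r (x n)"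
    and x_step: "\<forall>\<^sub>F n in sequentially. (1 - \<sigma> n / (\<tau> n + 1)) * x n \<le> x (Suc n)"
    and \<rho>_step: "\<forall>\<^sub>F n in sequentially. (1 - \<sigma> n / (\<tau> n + 1)) * \<rho> n \<le> \<rho> (Suc n)"
    and new: "\<forall>\<^sub>F n in sequentially. (1 + \<beta>) / (\<tau> n + 1) \<le> x (Suc n)"
    and summable: "summable (\<lambda>n. 1 / (\<rho> (Suc n) * (\<tau> n + 1))\<^sup>2)"
    and lim: "(\<lambda>n. \<rho> n / x n) \<longlonglongrightarrow> 0"
  shows "AE \<omega> in M. \<forall>\<delta>>0. \<forall>\<^sub>F n in sequentially. max_weight n \<omega> / \<tau> n \<le> (1 + \<delta>) * x n"
proof -
  have "\<forall>\<^sub>F n in sequentially. n \<ge> 1 \<and> 0 < x n \<and> x n \<le> w \<and> 0 < \<rho> n \<and> \<sigma> n \<le> 1 - r (x n) \<and>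
      (1 - \<sigma> n / (\<tau> n + 1)) * x n \<le> x (Suc n) \<and> (1 - \<sigma> n / (\<tau> n + 1)) * \<rho> n \<le> \<rho> (Suc n) \<and>
      (1 + \<beta>) / (\<tau> n + 1) \<le> x (Suc n)"
    by (intro eventually_conj assms eventually_ge_at_top)
  then obtain n0 where n0: "\<And>n. n \<ge> n0 \<Longrightarrow> n \<ge> 1 \<and> 0 < x n \<and> x n \<le> w \<and> 0 < \<rho> n \<and> \<sigma> n \<le> 1 - r (x n) \<and>
      (1 - \<sigma> n / (\<tau> n + 1)) * x n \<le> x (Suc n) \<and> (1 - \<sigma> n / (\<tau> n + 1)) * \<rho> n \<le> \<rho> (Suc n) \<and>
      (1 + \<beta>) / (\<tau> n + 1) \<le> x (Suc n)"
    by (auto simp: eventually_sequentially)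
  have contract: "(1 - (1 - r (x n)) / (\<tau> n + 1)) * y \<le> (1 - \<sigma> n / (\<tau> n + 1)) * y"
    if "n \<ge> n0" "y > 0" for n y
    using n0[OF that(1)] that(2) \<tau>_pos[of n]
    by (intro mult_right_mono diff_left_mono divide_right_mono) auto
  have "AE \<omega> in M. \<exists>B. \<forall>n\<ge>n0. max_weight n \<omega> / \<tau> n \<le> x n + B * \<rho> n"
  proof (rule max_weight_upper[OF _ _ _ _ _ _ _ summable])
    show "(1 - (1 - r (x n)) / (\<tau> n + 1)) * x n \<le> x (Suc n)" if "n \<ge> n0" for n
      by (rule order_trans[OF contract[OF that]]) (use n0[OF that] in auto)
    show "(1 - (1 - r (x n)) / (\<tau> n + 1)) * \<rho> n \<le> \<rho> (Suc n)" if "n \<ge> n0" for n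
      by (rule order_trans[OF contract[OF that]]) (use n0[OF that] in auto)
  qed (use n0 in auto)
  then show ?thesis
  proof eventually_elim
    case (elim \<omega>)
    then obtain B where B: "\<And>n. n \<ge> n0 \<Longrightarrow> max_weight n \<omega> / \<tau> n \<le> x n + B * \<rho> n" by blast
    show ?case
    proof (intro allI impI)
      fix \<delta> :: real assume "\<delta> > 0"
      have "(\<lambda>n. B * (\<rho> n / x n)) \<longlonglongrightarrow> B * 0" by (intro tendsto_intros lim)
      then have "\<forall>\<^sub>F n in sequentially. B * (\<rho> n / x n) < \<delta>"
        using \<open>\<delta> > 0\<close> by (intro order_tendstoD(2)) auto
      then show "\<forall>\<^sub>F n in sequentially. max_weight n \<omega> / \<tau> n \<le> (1 + \<delta>) * x n"
        using eventually_ge_at_top[of n0]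
      proof eventually_elim
        case (elim n)
        then have "x n > 0" using n0 by blast
        then have "B * \<rho> n \<le> \<delta> * x n" using elim by (simp add: field_simps)
        then show ?case using B[OF elim(2)] by (simp add: distrib_right)
      qed
    qed
  qed
qed

text \<open>Here \<open>\<rho>\<close> is compared with \<open>1 / x\<close>, because the underlying
  bound reads \<open>x n powr -s * (1 + B * (\<rho> n * x n) powr s)\<close>. Once
  \<open>\<rho> n * x n\<close> tends to 0, inverting the power gives the lower bound up to
  \<open>1 - \<delta>\<close>.\<close>

lemma max_weight_lower_ratio:
  fixes x \<rho> \<sigma> :: "nat \<Rightarrow> real"
  assumes x: "\<forall>\<^sub>F n in sequentially. 0 < x n" "\<forall>\<^sub>F n in sequentially. x n \<le> w"
    and \<rho>: "\<forall>\<^sub>F n in sequentially. 0 < \<rho> n"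
    and \<sigma>: "\<forall>\<^sub>F n in sequentially. 1 - r (x n) \<le> \<sigma> n"
    and x_step: "\<forall>\<^sub>F n in sequentially. x (Suc n) * exp (\<sigma> n / \<tau> n) \<le> x n"
    and \<rho>_step: "\<forall>\<^sub>F n in sequentially. \<rho> n * exp (\<sigma> n / \<tau> n) \<le> \<rho> (Suc n)"
    and \<rho>_ge: "\<forall>\<^sub>F n in sequentially. 1 / \<tau> n \<le> \<rho> n"
    and lim: "(\<lambda>n. \<rho> n * x n) \<longlonglongrightarrow> 0"
  shows "AE \<omega> in M. \<forall>\<delta>. 0 < \<delta> \<and> \<delta> < 1 \<longrightarrow>
    (\<forall>\<^sub>F n in sequentially. (1 - \<delta>) * x n \<le> max_weight n \<omega> / \<tau> n)"
proof -
  have \<tau>_ge: "\<forall>\<^sub>F n in sequentially. c \<le> \<tau> n" for c unfolding \<tau>_def by real_asymp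
  have "\<forall>\<^sub>F n in sequentially. n \<ge> 1 \<and> 1 \<le> \<tau> n \<and> 2 * (L.moment 2 / w\<^sup>2) * w \<le> \<tau> n \<and> 2 * (L.mean / w) \<le> \<tau> n \<and>
      0 < x n \<and> 0 < x (Suc n) \<and> x n \<le> w \<and> 0 < \<rho> n \<and> 1 - r (x n) \<le> \<sigma> n \<and> x (Suc n) * exp (\<sigma> n / \<tau> n) \<le> x n \<and>
      \<rho> n * exp (\<sigma> n / \<tau> n) \<le> \<rho> (Suc n) \<and> 1 / \<tau> n \<le> \<rho> n"
  proof (intro eventually_conj assms eventually_ge_at_top \<tau>_ge)
    show "\<forall>\<^sub>F n in sequentially. 0 < x (Suc n)" using x(1) by (subst eventually_sequentially_Suc)
  qed
  then obtain n0 where n0: "\<And>n. n \<ge> n0 \<Longrightarrow> n \<ge> 1 \<and> 1 \<le> \<tau> n \<and> 2 * (L.moment 2 / w\<^sup>2) * w \<le> \<tau> n \<and>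
      2 * (L.mean / w) \<le> \<tau> n \<and>
      0 < x n \<and> 0 < x (Suc n) \<and> x n \<le> w \<and> 0 < \<rho> n \<and> 1 - r (x n) \<le> \<sigma> n \<and> x (Suc n) * exp (\<sigma> n / \<tau> n) \<le> x n \<and>
      \<rho> n * exp (\<sigma> n / \<tau> n) \<le> \<rho> (Suc n) \<and> 1 / \<tau> n \<le> \<rho> n"
    by (auto simp: eventually_sequentially)
  have exp_le: "y * exp ((1 - r (x n)) / \<tau> n) \<le> y * exp (\<sigma> n / \<tau> n)" if "n \<ge> n0" "y > 0" for n y
    using n0[OF that(1)] that(2) by (intro mult_left_mono) (auto intro!: divide_right_mono)
  have n0': "n0 \<ge> 1" using n0[of n0] by simp
  obtain s where s: "s > 0"
    "AE \<omega> in M. \<exists>B. \<forall>n\<ge>n0. (max_weight n \<omega> / \<tau> n) powr -s \<le> x n powr -s + B * \<rho> n powr s"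
  proof (rule max_weight_lower[OF n0'])
    show "x (Suc n) * exp ((1 - r (x n)) / \<tau> n) \<le> x n" if "n \<ge> n0" for n
      by (rule order_trans[OF exp_le[OF that]]) (use n0[OF that] in auto)
    show "\<rho> n * exp ((1 - r (x n)) / \<tau> n) \<le> \<rho> (Suc n)" if "n \<ge> n0" for n
      by (rule order_trans[OF exp_le[OF that]]) (use n0[OF that] in auto)
  qed (use n0 in auto)
  show ?thesis using s(2)
  proof eventually_elim
    case (elim \<omega>)
    then obtain B where B: "\<And>n. n \<ge> n0 \<Longrightarrow>
      (max_weight n \<omega> / \<tau> n) powr -s \<le> x n powr -s + B * \<rho> n powr s" by blast
    show ?case
    proof (intro allI impI)
      fix \<delta> :: real assume \<delta>: "0 < \<delta> \<and> \<delta> < 1"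
      have "1 < (1 - \<delta>) powr -s"
        using \<delta> s(1) powr_less_mono2_neg[of "-s" "1 - \<delta>" 1] by simp
      have "(\<lambda>n. 1 + B * (\<rho> n * x n) powr s) \<longlonglongrightarrow> 1 + B * 0"
      proof (intro tendsto_intros)
        have "\<forall>\<^sub>F n in sequentially. 0 \<le> \<rho> n * x n"
          using x(1) \<rho> by eventually_elim simp
        then have "(\<lambda>n. (\<rho> n * x n) powr s) \<longlonglongrightarrow> 0 powr s"
          using s(1) by (intro tendsto_powr'[OF lim tendsto_const]) auto
        then show "(\<lambda>n. (\<rho> n * x n) powr s) \<longlonglongrightarrow> 0" using s(1) by simp
      qed
      then have "\<forall>\<^sub>F n in sequentially. 1 + B * (\<rho> n * x n) powr s < (1 - \<delta>) powr -s"
        using \<open>1 < (1 - \<delta>) powr -s\<close> by (intro order_tendstoD(2)) auto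
      then show "\<forall>\<^sub>F n in sequentially. (1 - \<delta>) * x n \<le> max_weight n \<omega> / \<tau> n"
        using eventually_ge_at_top[of n0]
      proof eventually_elim
        case (elim n)
        have pos: "x n > 0" "\<rho> n > 0" "max_weight n \<omega> / \<tau> n > 0"
          using n0[OF elim(2)] max_weight_pos[of n \<omega>] by auto
        show ?case
        proof (rule ccontr)
          assume "\<not> (1 - \<delta>) * x n \<le> max_weight n \<omega> / \<tau> n"
          then have "((1 - \<delta>) * x n) powr -s < (max_weight n \<omega> / \<tau> n) powr -s"
            using pos s(1) by (intro powr_less_mono2_neg) auto
          also have "\<dots> \<le> x n powr -s + B * \<rho> n powr s" by (rule B[OF elim(2)])
          also have "\<rho> n powr s = x n powr -s * (\<rho> n * x n) powr s"
            using pos by (simp add: powr_mult powr_minus)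
          also have "x n powr -s + B * (x n powr -s * (\<rho> n * x n) powr s) =
              x n powr -s * (1 + B * (\<rho> n * x n) powr s)" by (simp add: algebra_simps)
          also have "\<dots> < x n powr -s * (1 - \<delta>) powr -s"
            using elim(1) pos by (intro mult_strict_left_mono) auto
          also have "\<dots> = ((1 - \<delta>) * x n) powr -s" by (simp add: powr_mult mult.commute)
          finally show False by simp
        qed
      qed
    qed
  qed
qed

text \<open>Constant thresholds suffice: strict monotonicity gives
  \<open>r (u m) < 1 < r (l m)\<close>, so above \<open>u m\<close> the relative weight is pushed
  down and below \<open>l m\<close> it is pushed up. The denominators \<open>real m + 2\<close> keep
  \<open>l m\<close> positive and \<open>u m\<close> below \<open>w\<close> for every
  \<open>m\<close>.\<close>

lemma max_weight_supercritical:
  assumes mean: "L.mean > w" and x: "0 < x" "x < 1" "r x = 1"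
  shows "AE \<omega> in M. (\<lambda>n. max_weight n \<omega> / \<tau> n) \<longlonglongrightarrow> x"
proof -
  have mean1: "L.mean > 1" using mean w_gt_1 by simp
  define l where "l m = x * (1 - 1 / (real m + 2))" for m :: nat
  define u where "u m = x + (w - x) / (real m + 2)" for m :: nat
  have "AE \<omega> in M. \<forall>\<delta>>0. \<forall>\<^sub>F n in sequentially. max_weight n \<omega> / \<tau> n \<le> (1 + \<delta>) * u m" for m
  proof -
    have "(w - x) / (real m + 2) < (w - x) / 1"
      using x w_gt_1 by (intro divide_strict_left_mono) auto
    then have um: "x < u m" "u m < w" using x w_gt_1 by (auto simp: u_def)
    define s where "s = 1 - r (u m)"
    have s: "s > 0" using L.rate_strict_antimono[of x "u m"] x um mean1 by (simp add: s_def)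
    \<comment> \<open>The width \<open>1 / ln n\<close> tends to 0 more slowly than every negative
      power of \<open>n\<close>, as the contraction by \<open>s\<close> demands, while
      \<open>(ln n)\<^sup>2 / n\<^sup>2\<close> remains summable.\<close>
    show ?thesis
    proof (rule max_weight_upper_ratio[where \<sigma> = "\<lambda>_. s" and \<rho> = "\<lambda>n. 1 / ln n"])
      show "\<forall>\<^sub>F n in sequentially. (1 - s / (\<tau> n + 1)) * u m \<le> u m"
      proof (intro eventually_sequentiallyI)
        fix n :: nat assume "n \<ge> 1"
        then show "(1 - s / (\<tau> n + 1)) * u m \<le> u m"
          using s um x \<tau>_pos[of n] by (simp add: mult_le_cancel_right1)
      qed
      show "\<forall>\<^sub>F n in sequentially. 0 < 1 / ln (real n)" by real_asymp
      show "\<forall>\<^sub>F n in sequentially. (1 - s / (\<tau> n + 1)) * (1 / ln (real n)) \<le> 1 / ln (real (Suc n))"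
        unfolding \<tau>_def using s by real_asymp
      show "\<forall>\<^sub>F n in sequentially. (1 + \<beta>) / (\<tau> n + 1) \<le> u m"
        unfolding \<tau>_def using um x by real_asymp
      show "summable (\<lambda>n. 1 / (1 / ln (real (Suc n)) * (\<tau> n + 1))\<^sup>2)"
      proof (rule summable_comparison_test_bigo)
        show "summable (\<lambda>n. norm (real n powr (- 3 / 2)))" by (simp add: summable_real_powr_iff)
        show "(\<lambda>n. 1 / (1 / ln (real (Suc n)) * (\<tau> n + 1))\<^sup>2) \<in> O(\<lambda>n. real n powr (- 3 / 2))"
          unfolding \<tau>_def by real_asymp
      qed
      show "(\<lambda>n. 1 / ln (real n) / u m) \<longlonglongrightarrow> 0" using um x by real_asymp
    qed (use um x s_def in auto)
  qed
  then have upper: "AE \<omega> in M. \<forall>m. \<forall>\<delta>>0. \<forall>\<^sub>F n in sequentially. max_weight n \<omega> / \<tau> n \<le> (1 + \<delta>) * u m"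
    by (subst AE_all_countable) auto
  have "AE \<omega> in M. \<forall>\<delta>. 0 < \<delta> \<and> \<delta> < 1 \<longrightarrow>
      (\<forall>\<^sub>F n in sequentially. (1 - \<delta>) * l m \<le> max_weight n \<omega> / \<tau> n)" for m
  proof -
    have "l m = x * ((real m + 1) / (real m + 2))" by (simp add: l_def field_simps)
    then have lm0: "l m > 0" using x by simp
    have lm: "0 < l m" "l m < x" using lm0 x by (auto simp: l_def)
    define s where "s = 1 - r (l m)"
    have s: "s < 0" using L.rate_strict_antimono[of "l m" x] x lm mean1 w_gt_1 by (simp add: s_def)
    show ?thesis
    proof (rule max_weight_lower_ratio[where \<sigma> = "\<lambda>_. s" and \<rho> = "\<lambda>n. 1 / ln n"])
      show "\<forall>\<^sub>F n in sequentially. l m * exp (s / \<tau> n) \<le> l m"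
      proof (intro eventually_sequentiallyI)
        fix n :: nat assume "n \<ge> 1"
        then show "l m * exp (s / \<tau> n) \<le> l m"
          using s lm \<tau>_pos[of n] by (simp add: mult_le_cancel_left2 divide_nonpos_pos)
      qed
      show "\<forall>\<^sub>F n in sequentially. 0 < 1 / ln (real n)" by real_asymp
      show "\<forall>\<^sub>F n in sequentially. 1 / ln (real n) * exp (s / \<tau> n) \<le> 1 / ln (real (Suc n))"
        unfolding \<tau>_def using s by real_asymp
      show "\<forall>\<^sub>F n in sequentially. 1 / \<tau> n \<le> 1 / ln (real n)" unfolding \<tau>_def by real_asymp
      show "(\<lambda>n. 1 / ln (real n) * l m) \<longlonglongrightarrow> 0" using lm by real_asymp
    qed (use lm x w_gt_1 s_def in auto)
  qed
  then have lower: "AE \<omega> in M. \<forall>m. \<forall>\<delta>. 0 < \<delta> \<and> \<delta> < 1 \<longrightarrow>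
      (\<forall>\<^sub>F n in sequentially. (1 - \<delta>) * l m \<le> max_weight n \<omega> / \<tau> n)"
    by (subst AE_all_countable) auto
  show ?thesis using upper lower
  proof eventually_elim
    case (elim \<omega>)
    show ?case
    proof (rule tendsto_sandwich_family)
      show "\<forall>\<^sub>F n in sequentially. (1 - 1 / (real m + 2)) * l m \<le> max_weight n \<omega> / \<tau> n" for m
        using elim(2) by simp
      show "\<forall>\<^sub>F n in sequentially. max_weight n \<omega> / \<tau> n \<le> (1 + 1 / (real m + 2)) * u m" for m
        using elim(1) by (simp add: add_pos_pos)
      show "(\<lambda>m. (1 - 1 / (real m + 2)) * l m) \<longlonglongrightarrow> x" unfolding l_def by real_asymp
      show "(\<lambda>m. (1 + 1 / (real m + 2)) * u m) \<longlonglongrightarrow> x" unfolding u_def by real_asymp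
    qed
  qed
qed

text \<open>Since \<open>r u\<close> is about \<open>1 - u / k\<close>, the noise-free equation is
  \<open>\<tau> * u' = - u\<^sup>2 / k\<close> with solution \<open>k / ln \<tau>\<close>. The
  thresholds are this solution with \<open>k\<close> slightly enlarged or reduced.\<close>

lemma max_weight_critical:
  assumes mean: "L.mean = w"
  shows "AE \<omega> in M. (\<lambda>n. max_weight n \<omega> / \<tau> n * ln (real n)) \<longlonglongrightarrow> w\<^sup>2 / L.moment 2"
proof -
  define k where "k = w\<^sup>2 / L.moment 2"
  have m2: "L.moment 2 > 0" using L.moment_2_pos mean w_gt_1 by simp
  have k: "k > 0" using m2 w_gt_1 by (simp add: k_def)
  have quad: "L.moment 2 / w\<^sup>2 = 1 / k" by (simp add: k_def)
  have r0: "r 0 = 1" using mean w_gt_1 by (simp add: L.rate_zero)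
  have upper: "AE \<omega> in M. \<forall>m. \<forall>\<delta>>0. \<forall>\<^sub>F n in sequentially.
      max_weight n \<omega> / \<tau> n \<le> (1 + \<delta>) * ((1 + 2 / (real m + 1)) * k / ln (real n))"
    unfolding AE_all_countable
  proof
    fix m
    define d where "d = 1 / (real m + 1)"
    have d: "d > 0" by (simp add: d_def)
    define K where "K = (1 + 2 * d) * k"
    have K: "K > 0" using d k by (simp add: K_def)
    define c where "c = L.moment 3 / w ^ 3 * K\<^sup>2"
    \<comment> \<open>In units of \<open>1 / (n * ln n)\<close> the threshold decays at rate 1 and
      the drift allows \<open>1 + 2 * d\<close>; the width is given the intermediate rate
      \<open>1 + d\<close>, so its ratio to the threshold is of order \<open>ln n powr - d\<close>.
      The term with \<open>c\<close> is the quadratic correction from \<open>moment 3\<close>, of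
      lower order.\<close>
    have "AE \<omega> in M. \<forall>\<delta>>0. \<forall>\<^sub>F n in sequentially. max_weight n \<omega> / \<tau> n \<le> (1 + \<delta>) * (K / ln (real n))"
    proof (rule max_weight_upper_ratio[where \<sigma> = "\<lambda>n. (1 + 2 * d) / ln n - c / (ln n)\<^sup>2"
          and \<rho> = "\<lambda>n. ln n powr - (1 + d)"])
      show le_w: "\<forall>\<^sub>F n in sequentially. K / ln (real n) \<le> w" using w_gt_1 by real_asymp
      show pos: "\<forall>\<^sub>F n in sequentially. 0 < K / ln (real n)" using K by real_asymp
      show "\<forall>\<^sub>F n in sequentially. (1 + 2 * d) / ln (real n) - c / (ln (real n))\<^sup>2 \<le> 1 - r (K / ln (real n))"
        using le_w pos
      proof eventually_elim
        case (elim n)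
        have "r (K / ln (real n)) \<le> 1 - 1 / k * (K / ln (real n)) + L.moment 3 / w ^ 3 * (K / ln (real n))\<^sup>2"
          using L.rate_le_quadratic[of "K / ln (real n)"] elim mean w_gt_1 by (simp add: quad)
        moreover have "1 / k * (K / ln (real n)) = (1 + 2 * d) / ln (real n)" using k by (simp add: K_def)
        moreover have "L.moment 3 / w ^ 3 * (K / ln (real n))\<^sup>2 = c / (ln (real n))\<^sup>2" by (simp add: c_def power_divide)
        ultimately show ?case by linarith
      qed
      show "\<forall>\<^sub>F n in sequentially. 0 < ln (real n) powr - (1 + d)" by real_asymp
      show "\<forall>\<^sub>F n in sequentially. (1 - ((1 + 2 * d) / ln (real n) - c / (ln (real n))\<^sup>2) / (\<tau> n + 1)) *
          (K / ln (real n)) \<le> K / ln (real (Suc n))"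
      proof -
        have "\<forall>\<^sub>F n in sequentially. (1 - ((1 + 2 * d) / ln (real n) - c / (ln (real n))\<^sup>2) / (\<tau> n + 1)) *
          (1 / ln (real n)) \<le> 1 / ln (real (Suc n))"
          unfolding \<tau>_def using d by real_asymp
        then show ?thesis
        proof eventually_elim
          case (elim n)
          from mult_left_mono[OF elim, of K] K show ?case by (simp add: mult_ac)
        qed
      qed
      show "\<forall>\<^sub>F n in sequentially. (1 - ((1 + 2 * d) / ln (real n) - c / (ln (real n))\<^sup>2) / (\<tau> n + 1)) *
          ln (real n) powr - (1 + d) \<le> ln (real (Suc n)) powr - (1 + d)"
        unfolding \<tau>_def using d by real_asymp
      show "\<forall>\<^sub>F n in sequentially. (1 + \<beta>) / (\<tau> n + 1) \<le> K / ln (real (Suc n))"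
        unfolding \<tau>_def using K by real_asymp
      show "summable (\<lambda>n. 1 / (ln (real (Suc n)) powr - (1 + d) * (\<tau> n + 1))\<^sup>2)"
      proof (rule summable_comparison_test_bigo)
        show "summable (\<lambda>n. norm (real n powr (- 3 / 2)))" by (simp add: summable_real_powr_iff)
        show "(\<lambda>n. 1 / (ln (real (Suc n)) powr - (1 + d) * (\<tau> n + 1))\<^sup>2) \<in> O(\<lambda>n. real n powr (- 3 / 2))"
          unfolding \<tau>_def using d by real_asymp
      qed
      show "(\<lambda>n. ln (real n) powr - (1 + d) / (K / ln (real n))) \<longlonglongrightarrow> 0" using K d by real_asymp
    qed
    then show "AE \<omega> in M. \<forall>\<delta>>0. \<forall>\<^sub>F n in sequentially.
        max_weight n \<omega> / \<tau> n \<le> (1 + \<delta>) * ((1 + 2 / (real m + 1)) * k / ln (real n))"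
      by (simp add: K_def d_def)
  qed
  have lower: "AE \<omega> in M. \<forall>m. \<forall>\<delta>. 0 < \<delta> \<and> \<delta> < 1 \<longrightarrow> (\<forall>\<^sub>F n in sequentially.
      (1 - \<delta>) * ((1 - 2 / (real m + 3)) * k / ln (real n)) \<le> max_weight n \<omega> / \<tau> n)"
    unfolding AE_all_countable
  proof
    fix m
    define d where "d = 1 / (real m + 3)"
    \<comment> \<open>The offset 3 in \<open>d\<close> ensures \<open>2 * d < 1\<close>, hence
      \<open>K > 0\<close> for every \<open>m\<close>.\<close>
    have d: "d > 0" "2 * d < 1" by (auto simp: d_def field_simps)
    define K where "K = (1 - 2 * d) * k"
    have K: "K > 0" using d k by (simp add: K_def)
    \<comment> \<open>The inverse threshold grows at rate 1 and the drift is at most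
      \<open>1 - 2 * d\<close>, again in units of \<open>1 / (n * ln n)\<close>. The width grows at
      rate \<open>1 - d\<close>, so its product with the threshold is of order
      \<open>ln n powr - d\<close>.\<close>
    have "AE \<omega> in M. \<forall>\<delta>. 0 < \<delta> \<and> \<delta> < 1 \<longrightarrow>
        (\<forall>\<^sub>F n in sequentially. (1 - \<delta>) * (K / ln (real n)) \<le> max_weight n \<omega> / \<tau> n)"
    proof (rule max_weight_lower_ratio[where \<sigma> = "\<lambda>n. (1 - 2 * d) / ln n" and \<rho> = "\<lambda>n. ln n powr (1 - d)"])
      have d': "d < 1" using d by simp
      show le_w: "\<forall>\<^sub>F n in sequentially. K / ln (real n) \<le> w" using w_gt_1 by real_asymp
      show pos: "\<forall>\<^sub>F n in sequentially. 0 < K / ln (real n)" using K by real_asymp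
      show "\<forall>\<^sub>F n in sequentially. 1 - r (K / ln (real n)) \<le> (1 - 2 * d) / ln (real n)"
        using le_w pos
      proof eventually_elim
        case (elim n)
        have "r 0 - r (K / ln (real n)) \<le> 1 / k * (K / ln (real n))"
          using L.rate_lipschitz[of 0 "K / ln (real n)"] elim by (simp add: quad)
        moreover have "1 / k * (K / ln (real n)) = (1 - 2 * d) / ln (real n)" using k by (simp add: K_def)
        ultimately show ?case using r0 by linarith
      qed
      show "\<forall>\<^sub>F n in sequentially. 0 < ln (real n) powr (1 - d)" by real_asymp
      show "\<forall>\<^sub>F n in sequentially. K / ln (real (Suc n)) * exp ((1 - 2 * d) / ln (real n) / \<tau> n) \<le> K / ln (real n)"
      proof -
        have "\<forall>\<^sub>F n in sequentially. 1 / ln (real (Suc n)) * exp ((1 - 2 * d) / ln (real n) / \<tau> n) \<le> 1 / ln (real n)"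
          unfolding \<tau>_def using d(1) by real_asymp
        then show ?thesis
        proof eventually_elim
          case (elim n)
          from mult_left_mono[OF elim, of K] K show ?case by (simp add: mult_ac)
        qed
      qed
      show "\<forall>\<^sub>F n in sequentially. ln (real n) powr (1 - d) * exp ((1 - 2 * d) / ln (real n) / \<tau> n)
          \<le> ln (real (Suc n)) powr (1 - d)"
        unfolding \<tau>_def using d(1) d' by real_asymp
      show "\<forall>\<^sub>F n in sequentially. 1 / \<tau> n \<le> ln (real n) powr (1 - d)"
        unfolding \<tau>_def by real_asymp
      show "(\<lambda>n. ln (real n) powr (1 - d) * (K / ln (real n))) \<longlonglongrightarrow> 0" using K d by real_asymp
    qed
    then show "AE \<omega> in M. \<forall>\<delta>. 0 < \<delta> \<and> \<delta> < 1 \<longrightarrow> (\<forall>\<^sub>F n in sequentially.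
        (1 - \<delta>) * ((1 - 2 / (real m + 3)) * k / ln (real n)) \<le> max_weight n \<omega> / \<tau> n)"
      by (simp add: K_def d_def)
  qed
  show ?thesis unfolding k_def[symmetric] using upper lower
  proof eventually_elim
    case (elim \<omega>)
    have ln_pos: "\<forall>\<^sub>F n in sequentially. 0 < ln (real n)" by real_asymp
    show ?case
    proof (rule tendsto_sandwich_family)
      fix m
      have "\<forall>\<^sub>F n in sequentially.
          (1 - 1 / (real m + 2)) * ((1 - 2 / (real m + 3)) * k / ln (real n)) \<le> max_weight n \<omega> / \<tau> n"
        using elim(2) by simp
      then show "\<forall>\<^sub>F n in sequentially.
          (1 - 1 / (real m + 2)) * ((1 - 2 / (real m + 3)) * k) \<le> max_weight n \<omega> / \<tau> n * ln (real n)"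
        using ln_pos by eventually_elim (simp add: pos_divide_le_eq)
      have "\<forall>\<^sub>F n in sequentially. max_weight n \<omega> / \<tau> n \<le>
          (1 + 1 / (real m + 2)) * ((1 + 2 / (real m + 1)) * k / ln (real n))"
        using elim(1) by (simp add: add_pos_pos)
      then show "\<forall>\<^sub>F n in sequentially. max_weight n \<omega> / \<tau> n * ln (real n) \<le>
          (1 + 1 / (real m + 2)) * ((1 + 2 / (real m + 1)) * k)"
        using ln_pos by eventually_elim (simp add: pos_le_divide_eq)
    next
      show "(\<lambda>m. (1 - 1 / (real m + 2)) * ((1 - 2 / (real m + 3)) * k)) \<longlonglongrightarrow> k" by real_asymp
      show "(\<lambda>m. (1 + 1 / (real m + 2)) * ((1 + 2 / (real m + 1)) * k)) \<longlonglongrightarrow> k" by real_asymp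
    qed
  qed
qed

end

section \<open>Binomial moments and the limit theorems for the maximal degree\<close>

lemma nn_integral_pmf_choose:
  "(\<integral>\<^sup>+k. ennreal (real (k choose j)) \<partial>measure_pmf D) = binom_moment D j"
proof -
  let ?f = "\<lambda>k. ennreal (pmf D k * real (k choose j))"
  have "(\<integral>\<^sup>+k. ennreal (real (k choose j)) \<partial>measure_pmf D) =
      (\<integral>\<^sup>+k. ?f k \<partial>count_space UNIV)"
    by (simp add: nn_integral_measure_pmf ennreal_mult)
  also have "\<dots> = (\<Sum>k. ?f k)" by (rule nn_integral_count_space_nat)
  also have "\<dots> = (\<Sum>\<^sub>\<infinity>k. ?f k)"
  proof -
    have "(?f has_sum (\<Sum>\<^sub>\<infinity>k. ?f k)) UNIV"
      by (intro has_sum_infsum nonneg_summable_on_complete) simp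
    then show ?thesis by (intro sums_unique[symmetric] has_sum_imp_sums)
  qed
  \<comment> \<open>Indices below \<open>j\<close> drop out because \<open>k choose j\<close>
    vanishes there.\<close>
  also have "\<dots> = (\<Sum>\<^sub>\<infinity>k\<in>{j..}. ?f k)"
    by (rule infsum_cong_neutral) (auto simp: not_le)
  finally show ?thesis by (simp add: binom_moment_def)
qed

lemma integrable_choose_iff:
  "integrable (measure_pmf D) (\<lambda>k. real (k choose j)) \<longleftrightarrow> binom_moment D j < \<infinity>"
  by (simp add: integrable_iff_bounded nn_integral_pmf_choose)

lemma expectation_choose:
  "measure_pmf.expectation D (\<lambda>k. real (k choose j)) = enn2real (binom_moment D j)"
  by (subst integral_eq_nn_integral) (auto simp: nn_integral_pmf_choose)

context mori_tree_moments
begin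

lemma mean_ge_1: "L.mean \<ge> 1"
  using L.rate_ge[of 0] w_gt_1 by (simp add: L.rate_zero field_simps)

text \<open>Both sides are the probability that a vertex of relative weight \<open>u\<close> is
  sampled. This links the fixed-point equation for the limit to \<open>r\<close>.\<close>

lemma infsum_sampling_eq:
  assumes "0 \<le> u" "u \<le> w"
  shows "(\<Sum>\<^sub>\<infinity>i\<in>{1..}. pmf D i * (1 - (1 - u / w) ^ i)) = u * r u"
proof -
  let ?f = "\<lambda>i. pmf D i * (1 - (1 - u / w) ^ i)"
  have q: "0 \<le> 1 - u / w" "1 - u / w \<le> 1" using assms w_gt_1 by auto
  have "integrable (measure_pmf D) (\<lambda>i. 1 - (1 - u / w) ^ i)"
    using L.integrable_power[OF assms] by simp
  from pmf_sums_expectation[OF this] have "?f sums (u * r u)"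
    using L.sampling_probability[OF assms] L.integrable_power[OF assms] by simp
  then have "(?f has_sum (u * r u)) UNIV"
    using q by (intro sums_nonneg_imp_has_sum) (auto simp: power_le_one)
  then have "(\<Sum>\<^sub>\<infinity>i. ?f i) = u * r u" by (rule infsumI)
  moreover have "(\<Sum>\<^sub>\<infinity>i. ?f i) = (\<Sum>\<^sub>\<infinity>i\<in>{1..}. ?f i)"
    by (rule infsum_cong_neutral) (auto simp: not_le)
  ultimately show ?thesis by simp
qed

lemma max_degree_subcritical_upper:
  assumes "\<epsilon> > 0"
  shows "AE \<omega> in M. \<forall>\<^sub>F n in sequentially.
    real (max_degree (\<lambda>k. Y k \<omega>) n) < real n powr (L.mean / w + \<epsilon>)"
proof -
  define a where "a = L.mean / w"
  have a: "a > 0" using mean_ge_1 w_gt_1 by (simp add: a_def)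
  \<comment> \<open>The least integer for which the moment bound applies. One such \<open>k\<close>
    is enough for every \<open>\<epsilon>\<close>, since that bound holds almost surely with a
    finite random constant and a k-th root gives order \<open>\<tau> n powr a\<close>.\<close>
  define k where "k = nat \<lceil>2 / a\<rceil>"
  have "2 / a \<le> real k" unfolding k_def by (rule real_nat_ceiling_ge)
  then have k: "real k * a \<ge> 2" using a by (simp add: field_simps)
  then have k0: "k > 0" using a by (cases "k = 0") auto
  have "AE \<omega> in M. \<exists>B. \<forall>n\<ge>1. pochhammer (max_weight n \<omega>) k / \<tau> n powr (real k * a) \<le> B"
    unfolding a_def by (rule max_weight_le_powr) (use k in \<open>simp add: a_def\<close>)
  then show ?thesis unfolding a_def[symmetric]
  proof eventually_elim
    case (elim \<omega>)
    then obtain B where B: "\<And>n. n \<ge> 1 \<Longrightarrow> pochhammer (max_weight n \<omega>) k / \<tau> n powr (real k * a) \<le> B" by blast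
    define C where "C = max 1 B"
    have C: "C > 0" "C \<ge> 1" by (auto simp: C_def)
    have le: "max_weight n \<omega> \<le> C * \<tau> n powr a" if n: "n \<ge> 1" for n
    proof -
      have t: "\<tau> n > 0" using \<tau>_pos n by simp
      have "max_weight n \<omega> ^ k \<le> pochhammer (max_weight n \<omega>) k"
        by (rule power_le_pochhammer) (rule max_weight_pos[OF n])
      also have "\<dots> \<le> B * \<tau> n powr (real k * a)"
        using B[OF n] t by (simp add: pos_divide_le_eq)
      also have "\<dots> \<le> C ^ k * \<tau> n powr (real k * a)"
      proof (rule mult_right_mono)
        have "C ^ 1 \<le> C ^ k" using C k0 by (intro power_increasing) auto
        then show "B \<le> C ^ k" by (simp add: C_def)
      qed simp
      also have "\<dots> = (C * \<tau> n powr a) ^ k"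
        using t by (simp add: power_mult_distrib powr_power mult.commute)
      finally have "max_weight n \<omega> ^ Suc (k - 1) \<le> (C * \<tau> n powr a) ^ Suc (k - 1)"
        using k0 by simp
      then show ?thesis by (rule power_le_imp_le_base) (use C in simp)
    qed
    have "\<forall>\<^sub>F n in sequentially. C * \<tau> n powr a - \<beta> < real n powr (a + \<epsilon>)"
      unfolding \<tau>_def using a assms C(1) by real_asymp
    then show ?case using eventually_ge_at_top[of 1]
      by eventually_elim (use le in \<open>fastforce simp: max_weight_def\<close>)
  qed
qed

lemma max_degree_subcritical_lower:
  assumes mean: "L.mean < w" and \<epsilon>: "\<epsilon> > 0"
  shows "AE \<omega> in M. \<forall>\<^sub>F n in sequentially.
    real n powr (L.mean / w - \<epsilon>) < real (max_degree (\<lambda>k. Y k \<omega>) n)"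
proof -
  define a where "a = L.mean / w"
  define g where "g = 1 - a"
  have a: "a > 0" using mean_ge_1 w_gt_1 by (simp add: a_def)
  have g: "g > 0" using mean w_gt_1 by (simp add: g_def a_def)
  \<comment> \<open>The quarter of \<open>\<epsilon>\<close> leaves room for all losses in the
    exponent, and the quarter of \<open>a / 2\<close> keeps \<open>a - 4 * e\<close> positive, so
    that \<open>\<beta>\<close> is negligible at the end.\<close>
  define e where "e = min \<epsilon> (a / 2) / 4"
  have e: "e > 0" "4 * e \<le> \<epsilon>" "8 * e \<le> a" using a \<epsilon> by (auto simp: e_def)
  define c where "c = L.moment 2 / w\<^sup>2"
  \<comment> \<open>At relative weight near 0 the drift is \<open>g\<close>, and at the threshold it
    is eventually at most \<open>g + e\<close>. The inverse threshold grows with exponent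
    \<open>g + 2 * e\<close> and the width with \<open>g + 3 / 2 * e\<close>, strictly between the
    two.\<close>
  have "AE \<omega> in M. \<forall>\<delta>. 0 < \<delta> \<and> \<delta> < 1 \<longrightarrow>
      (\<forall>\<^sub>F n in sequentially. (1 - \<delta>) * real n powr - (g + 2 * e) \<le> max_weight n \<omega> / \<tau> n)"
  proof (rule max_weight_lower_ratio[where \<sigma> = "\<lambda>_. g + e" and \<rho> = "\<lambda>n. real n powr (g + 3 / 2 * e)"])
    show le_w: "\<forall>\<^sub>F n in sequentially. real n powr - (g + 2 * e) \<le> w"
      using w_gt_1 g e(1) by real_asymp
    show "\<forall>\<^sub>F n in sequentially. 0 < real n powr - (g + 2 * e)" by real_asymp
    have "\<forall>\<^sub>F n in sequentially. c * real n powr - (g + 2 * e) \<le> e" using g e(1) by real_asymp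
    then show "\<forall>\<^sub>F n in sequentially. 1 - r (real n powr - (g + 2 * e)) \<le> g + e"
      using le_w
    proof eventually_elim
      case (elim n)
      have "r 0 - r (real n powr - (g + 2 * e)) \<le> c * (real n powr - (g + 2 * e) - 0)"
        unfolding c_def using elim by (intro L.rate_lipschitz) auto
      then show ?case using elim by (simp add: L.rate_zero g_def a_def)
    qed
    show "\<forall>\<^sub>F n in sequentially. real (Suc n) powr - (g + 2 * e) * exp ((g + e) / \<tau> n) \<le> real n powr - (g + 2 * e)"
      unfolding \<tau>_def using g e(1) by real_asymp
    show "\<forall>\<^sub>F n in sequentially. 0 < real n powr (g + 3 / 2 * e)" by real_asymp
    show "\<forall>\<^sub>F n in sequentially. real n powr (g + 3 / 2 * e) * exp ((g + e) / \<tau> n) \<le> real (Suc n) powr (g + 3 / 2 * e)"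
      unfolding \<tau>_def using g e(1) by real_asymp
    show "\<forall>\<^sub>F n in sequentially. 1 / \<tau> n \<le> real n powr (g + 3 / 2 * e)"
      unfolding \<tau>_def using g e(1) by real_asymp
    show "(\<lambda>n. real n powr (g + 3 / 2 * e) * real n powr - (g + 2 * e)) \<longlonglongrightarrow> 0"
      using g e(1) by real_asymp
  qed
  then show ?thesis
  proof eventually_elim
    case (elim \<omega>)
    have lower: "\<forall>\<^sub>F n in sequentially. (1 - 1 / 2) * real n powr - (g + 2 * e) \<le> max_weight n \<omega> / \<tau> n"
      using elim[rule_format, of "1 / 2"] by simp
    define b where "b = a - 4 * e"
    have b: "b > 0" using e by (simp add: b_def)
    have eq: "- (g + 2 * e) = b + 2 * e - 1" by (simp add: g_def b_def)
    have "\<forall>\<^sub>F n in sequentially. real n powr b < 1 / 2 * real n powr (b + 2 * e - 1) * \<tau> n - \<beta>"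
      unfolding \<tau>_def using b e(1) by real_asymp
    then show ?case using lower eventually_ge_at_top[of 1]
    proof eventually_elim
      case (elim n)
      have "real n powr (L.mean / w - \<epsilon>) \<le> real n powr b"
        using elim(3) e by (intro powr_mono) (auto simp: b_def a_def)
      also have "\<dots> < 1 / 2 * real n powr (b + 2 * e - 1) * \<tau> n - \<beta>" by (rule elim(1))
      also have "1 / 2 * real n powr (b + 2 * e - 1) * \<tau> n \<le> max_weight n \<omega>"
        using elim(2)[unfolded eq] \<tau>_pos[of n] elim(3) by (simp add: pos_le_divide_eq)
      finally show ?case by (simp add: max_weight_def)
    qed
  qed
qed

lemma max_degree_sets: "{\<omega> \<in> space M. P (max_degree (\<lambda>k. Y k \<omega>) n)} \<in> events"
proof -
  have "{\<omega> \<in> space M. indicator {m. P m} (Max ((\<lambda>v. vdegree (tree n \<omega>) v) ` {1..n + 1})) = (1::real)} \<in> events"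
    using borel_measurable_eq[OF borel_measurable_tree borel_measurable_const,
        of "\<lambda>E. indicator {m. P m} (Max ((\<lambda>v. vdegree E v) ` {1..n + 1}))" n 1] by simp
  then show ?thesis by (simp add: max_degree_def indicator_eq_1_iff)
qed

lemma subcritical:
  assumes "L.mean < w" "\<epsilon> > 0"
  shows "(\<lambda>n. prob {\<omega> \<in> space M.
      real n powr (L.mean / w - \<epsilon>) < real (max_degree (\<lambda>k. Y k \<omega>) n) \<and>
      real (max_degree (\<lambda>k. Y k \<omega>) n) < real n powr (L.mean / w + \<epsilon>)}) \<longlonglongrightarrow> 1"
proof (rule prob_tendsto_1)
  show "AE \<omega> in M. \<forall>\<^sub>F n in sequentially.
      real n powr (L.mean / w - \<epsilon>) < real (max_degree (\<lambda>k. Y k \<omega>) n) \<and>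
      real (max_degree (\<lambda>k. Y k \<omega>) n) < real n powr (L.mean / w + \<epsilon>)"
    using max_degree_subcritical_lower[OF assms] max_degree_subcritical_upper[OF assms(2)]
    by eventually_elim (rule eventually_conj)
qed (rule max_degree_sets)

lemma supercritical:
  assumes mean: "L.mean > w"
  shows "\<exists>x. (\<forall>z. (0 < z \<and> z \<le> 1 \<and> (\<Sum>\<^sub>\<infinity>i\<in>{1..}. pmf D i * (1 - (1 - z / w) ^ i)) = z) \<longleftrightarrow> z = x) \<and>
    (AE \<omega> in M. (\<lambda>n. real (max_degree (\<lambda>k. Y k \<omega>) n) / real n) \<longlonglongrightarrow> x)"
proof -
  obtain x where x: "0 < x" "x < 1" "r x = 1" using L.rate_eq_1_ex[OF mean] by blast
  have mean1: "L.mean > 1" using mean w_gt_1 by simp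
  have "(0 < z \<and> z \<le> 1 \<and> (\<Sum>\<^sub>\<infinity>i\<in>{1..}. pmf D i * (1 - (1 - z / w) ^ i)) = z) \<longleftrightarrow> z = x" for z
  proof -
    have "(\<Sum>\<^sub>\<infinity>i\<in>{1..}. pmf D i * (1 - (1 - z / w) ^ i)) = z * r z" if "0 < z" "z \<le> 1"
      using infsum_sampling_eq[of z] that w_gt_1 by simp
    moreover have "r z = 1 \<longleftrightarrow> z = x" if "0 < z" "z \<le> 1"
      using L.rate_strict_antimono[of x z] L.rate_strict_antimono[of z x] x that mean1 w_gt_1
      by (cases z x rule: linorder_cases) auto
    ultimately show ?thesis using x by (cases "0 < z \<and> z \<le> 1") auto
  qed
  moreover have "AE \<omega> in M. (\<lambda>n. real (max_degree (\<lambda>k. Y k \<omega>) n) / real n) \<longlonglongrightarrow> x"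
    using max_weight_supercritical[OF mean x]
  proof eventually_elim
    case (elim \<omega>)
    have "(\<lambda>n. \<tau> n / real n) \<longlonglongrightarrow> 1" "(\<lambda>n. \<beta> / real n) \<longlonglongrightarrow> 0" unfolding \<tau>_def by real_asymp+
    with elim have "(\<lambda>n. max_weight n \<omega> / \<tau> n * (\<tau> n / real n) - \<beta> / real n) \<longlonglongrightarrow> x * 1 - 0"
      by (intro tendsto_intros)
    moreover have "\<forall>\<^sub>F n in sequentially. max_weight n \<omega> / \<tau> n * (\<tau> n / real n) - \<beta> / real n =
        real (max_degree (\<lambda>k. Y k \<omega>) n) / real n"
      using eventually_ge_at_top[of 1]
    proof eventually_elim
      case (elim n)
      then show ?case using \<tau>_pos[of n] by (simp add: max_weight_def diff_divide_distrib[symmetric])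
    qed
    ultimately have "(\<lambda>n. real (max_degree (\<lambda>k. Y k \<omega>) n) / real n) \<longlonglongrightarrow> x * 1 - 0"
      by (rule Lim_transform_eventually)
    then show ?case by simp
  qed
  ultimately show ?thesis by blast
qed

lemma critical:
  assumes mean: "L.mean = w"
  shows "AE \<omega> in M. (\<lambda>n. real (max_degree (\<lambda>k. Y k \<omega>) n) * ln (real n) / real n)
      \<longlonglongrightarrow> w\<^sup>2 / enn2real (binom_moment D 2)"
  using max_weight_critical[OF mean] unfolding expectation_choose[symmetric] L.moment_def
proof eventually_elim
  case (elim \<omega>)
  have "(\<lambda>n. \<tau> n / real n) \<longlonglongrightarrow> 1" "(\<lambda>n. \<beta> * ln (real n) / real n) \<longlonglongrightarrow> 0"
    unfolding \<tau>_def by real_asymp+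
  with elim have "(\<lambda>n. max_weight n \<omega> / \<tau> n * ln (real n) * (\<tau> n / real n) - \<beta> * ln (real n) / real n)
      \<longlonglongrightarrow> w\<^sup>2 / measure_pmf.expectation D (\<lambda>k. real (k choose 2)) * 1 - 0"
    by (intro tendsto_intros)
  moreover have "\<forall>\<^sub>F n in sequentially.
      max_weight n \<omega> / \<tau> n * ln (real n) * (\<tau> n / real n) - \<beta> * ln (real n) / real n =
      real (max_degree (\<lambda>k. Y k \<omega>) n) * ln (real n) / real n"
    using eventually_ge_at_top[of 1]
  proof eventually_elim
    case (elim n)
    have "(m + \<beta>) / t * l * (t / k) - \<beta> * l / k = m * l / k" if "t > 0" "k > 0" for m t l k
      using that by (simp add: field_simps)
    then show ?case using elim \<tau>_pos[of n] by (simp add: max_weight_def)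
  qed
  ultimately have "(\<lambda>n. real (max_degree (\<lambda>k. Y k \<omega>) n) * ln (real n) / real n)
      \<longlonglongrightarrow> w\<^sup>2 / measure_pmf.expectation D (\<lambda>k. real (k choose 2)) * 1 - 0"
    by (rule Lim_transform_eventually)
  then show ?case by simp
qed

end

theorem theorem1p1:
  fixes M :: "'a measure" and \<beta> C :: real and D :: "nat pmf"
    and d :: "nat \<Rightarrow> 'a \<Rightarrow> nat" and X :: "nat \<Rightarrow> 'a \<Rightarrow> nat list" and Y :: "nat \<Rightarrow> 'a \<Rightarrow> nat"
  assumes "\<beta> > -1"
    and "set_pmf D \<subseteq> {1..}"
    and "C > 0"
    and "\<And>j. j \<ge> 1 \<Longrightarrow> binom_moment D j < ennreal (C ^ j)"
    and "max_choice_mori M \<beta> D d X Y"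
  shows "(measure_pmf.expectation D real < 2 + \<beta> \<longrightarrow>
           (\<forall>\<epsilon>>0.
             (\<lambda>n. measure M {\<omega> \<in> space M.
                real n powr (measure_pmf.expectation D real / (2 + \<beta>) - \<epsilon>)
                  < real (max_degree (\<lambda>k. Y k \<omega>) n) \<and>
                real (max_degree (\<lambda>k. Y k \<omega>) n)
                  < real n powr (measure_pmf.expectation D real / (2 + \<beta>) + \<epsilon>)})
             \<longlonglongrightarrow> 1)) \<and>
         (measure_pmf.expectation D real > 2 + \<beta> \<longrightarrow>
           (\<exists>x. (\<forall>z. (0 < z \<and> z \<le> 1 \<and>
                      (\<Sum>\<^sub>\<infinity>i\<in>{1..}. pmf D i * (1 - (1 - z / (2 + \<beta>)) ^ i)) = z)
                     \<longleftrightarrow> z = x) \<and>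
                (AE \<omega> in M. (\<lambda>n. real (max_degree (\<lambda>k. Y k \<omega>) n) / real n) \<longlonglongrightarrow> x))) \<and>
         (measure_pmf.expectation D real = 2 + \<beta> \<longrightarrow>
           (AE \<omega> in M. (\<lambda>n. real (max_degree (\<lambda>k. Y k \<omega>) n) * ln (real n) / real n)
                         \<longlonglongrightarrow> (2 + \<beta>)\<^sup>2 / enn2real (binom_moment D 2)))"
proof -
  interpret max_choice_mori M \<beta> D d X Y by (rule assms(5))
  interpret mori_tree_moments M \<beta> D d X Y
  proof unfold_locales
    show "integrable (measure_pmf D) (\<lambda>k. real (k choose j))" for j
    \<comment> \<open>The assumed bounds start at \<open>j = 1\<close>; for \<open>j = 0\<close> the
      integrand is the constant 1.\<close>
    proof (cases "j = 0")
      case False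
      then have "binom_moment D j < ennreal (C ^ j)" using assms(4) by simp
      also have "\<dots> < \<infinity>" by simp
      finally show ?thesis by (simp only: integrable_choose_iff)
    qed simp
  qed (rule assms)+
  show ?thesis
    using subcritical supercritical critical unfolding L.mean_def w_def by auto
qed

end
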